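(* Let $a'<a$ and $b<b'$ be real constants, $r,\delta,\beta,\eta,w>0$ and $\alpha\in(0,1)$. Suppose that there exists a probability $\mathsf{P}$ with $\mathsf{P}\in\mathcal{P}^1\cap\mathcal{P}^2$, and that $\delta>\alpha r$. Then the optimal consumption plan for the utility maximization problem $$\sup_{C\in\mathcal{A}(w)}\mathcal{E}^1\Big[\int_0^\infty e^{-\delta t}\tfrac1\alpha(Y^C_t)^\alpha\,\mathrm{d}t\Big]$$ is deterministic.
   Context: $B$ is a one-dimensional Brownian motion on a filtered probability space with filtration $(\mathcal{F}_t)_{t\ge0}$ and reference measure $\mathsf{P}_0$; $\mathsf{E}$ is expectation under $\mathsf{P}_0$. For a bounded adapted $\xi$, $\varepsilon^\xi_t=\exp(\int_0^t\xi_s\mathrm{d}B_s-\frac12\int_0^t\xi_s^2\mathrm{d}s)$ and $\mathsf{P}^\xi$ is the measure with $\frac{\mathrm{d}\mathsf{P}^\xi}{\mathrm{d}\mathsf{P}_0}|_{\mathcal{F}_t}=\varepsilon^\xi_t$, $0<t<\infty$. Expectations of infinite-horizon integrals are understood as $\mathsf{E}^{\mathsf{P}^\xi}[\int_0^\infty X_t\mathrm{d}t]=\mathsf{E}[\int_0^\infty\varepsilon^\xi_tX_t\mathrm{d}t]$ and $\mathsf{E}^{\mathsf{P}^\xi}[\int_0^\infty X_t\mathrm{d}C_t]=\mathsf{E}[\int_0^\infty\varepsilon^\xi_tX_t\mathrm{d}C_t]$ for nonnegative adapted $X$ and consumption plans $C$. $\mathcal{X}_\infty$ is the set of distribution functions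 of nonnegative optional random measures on $[0,\infty)$ (adapted, right-continuous, nondecreasing, $C_{0-}=0$); integrals with respect to $\mathrm{d}C$ starting from $0$ include a jump at $0$. $Y^C_t=\eta e^{-\beta t}+\int_0^t\beta e^{-\beta(t-s)}\mathrm{d}C_s$. $\mathcal{P}^1=\{\mathsf{P}^\xi:\xi$ adapted with values in $[b,b']\}$, $\mathcal{P}^2=\{\mathsf{P}^\xi:\xi$ adapted with values in $[a',a]\}$ (here the ordering $a<b$ is not imposed, so the sets may intersect); $\mathcal{E}^1[X]=\inf_{\mathsf{P}\in\mathcal{P}^1}\mathsf{E}^{\mathsf{P}}[X]$, $\mathcal{E}^2[X]=\sup_{\mathsf{P}\in\mathcal{P}^2}\mathsf{E}^{\mathsf{P}}[X]$; $\mathcal{A}(w)=\{C\in\mathcal{X}_\infty:\mathcal{E}^2[\int_0^\infty e^{-rt}\mathrm{d}C_t]\le w\}$. *)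

theory Defs
  imports "HOL-Probability.Probability"
begin

text \<open>
  Only times \<open>t \<ge> 0\<close> matter: a filtration on \<open>[0, \<infinity>)\<close> is extended to negative times by, say,
  \<open>F t = F 0\<close>.  The usual conditions are not required.
\<close>

locale brownian_motion = prob_space M + filtration "space M" F
  for M :: "'a measure" and F :: "real \<Rightarrow> 'a measure" +
  fixes B :: "real \<Rightarrow> 'a \<Rightarrow> real"
  assumes subalgebra_F: "\<And>t. subalgebra M (F t)"
    and adapted: "\<And>t. 0 \<le> t \<Longrightarrow> B t \<in> borel_measurable (F t)"
    and starts_at_0: "AE \<omega> in M. B 0 \<omega> = 0"
    and gaussian_increments: "\<And>s t. 0 \<le> s \<Longrightarrow> s < t \<Longrightarrow>
      distributed M lborel (\<lambda>\<omega>. B t \<omega> - B s \<omega>) (normal_density 0 (sqrt (t - s)))"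
    and independent_increments: "\<And>s t. 0 \<le> s \<Longrightarrow> s < t \<Longrightarrow>
      indep_set (sets (F s)) {(\<lambda>\<omega>. B t \<omega> - B s \<omega>) -` S \<inter> space M | S. S \<in> sets borel}"
    and continuous_paths: "AE \<omega> in M. continuous_on {0..} (\<lambda>t. B t \<omega>)"

subsection \<open>Stochastic integral of bounded integrands\<close>

definition progressive :: "(real \<Rightarrow> 'a measure) \<Rightarrow> (real \<Rightarrow> 'a \<Rightarrow> real) \<Rightarrow> bool" where
  "progressive F \<xi> \<longleftrightarrow>
     (\<forall>T\<ge>0. (\<lambda>(s, \<omega>). \<xi> s \<omega>) \<in> borel_measurable (restrict_space borel {0..T} \<Otimes>\<^sub>M F T))"

text \<open>
  A simple integrand \<open>\<Sum>i<n. \<phi> i \<cdot> 1_(\<tau> i, \<tau> (i+1)]\<close> with deterministic grid \<open>\<tau>\<close> and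
  bounded \<open>F (\<tau> i)\<close>-measurable \<open>\<phi> i\<close>, and its elementary integral against \<open>B\<close> up to time \<open>t\<close>.
\<close>

definition simple_integrand ::
  "'a measure \<Rightarrow> (real \<Rightarrow> 'a measure) \<Rightarrow> nat \<Rightarrow> (nat \<Rightarrow> real) \<Rightarrow> (nat \<Rightarrow> 'a \<Rightarrow> real) \<Rightarrow> bool" where
  "simple_integrand M F n \<tau> \<phi> \<longleftrightarrow>
     0 \<le> \<tau> 0 \<and> (\<forall>i<n. \<tau> i \<le> \<tau> (Suc i)) \<and>
     (\<forall>i<n. \<phi> i \<in> borel_measurable (F (\<tau> i)) \<and> bounded (\<phi> i ` space M))"

definition simple_process ::
  "nat \<Rightarrow> (nat \<Rightarrow> real) \<Rightarrow> (nat \<Rightarrow> 'a \<Rightarrow> real) \<Rightarrow> real \<Rightarrow> 'a \<Rightarrow> real" where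
  "simple_process n \<tau> \<phi> s \<omega> = (\<Sum>i<n. \<phi> i \<omega> * indicator {\<tau> i<..\<tau> (Suc i)} s)"

definition elementary_integral ::
  "(real \<Rightarrow> 'a \<Rightarrow> real) \<Rightarrow> nat \<Rightarrow> (nat \<Rightarrow> real) \<Rightarrow> (nat \<Rightarrow> 'a \<Rightarrow> real) \<Rightarrow> real \<Rightarrow> 'a \<Rightarrow> real" where
  "elementary_integral B n \<tau> \<phi> t \<omega> =
     (\<Sum>i<n. \<phi> i \<omega> * (B (min t (\<tau> (Suc i))) \<omega> - B (min t (\<tau> i)) \<omega>))"

text \<open>
  \<open>I\<close> is a continuous version of the Ito integral of \<open>\<xi>\<close>, the \<open>L\<^sup>2\<close>-limit of elementary integrals.
  It is determined up to indistinguishability.  Measurability is asked with respect to \<open>M\<close> only: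
  \<open>I t\<close> is automatically almost surely equal to an \<open>F t\<close>-measurable variable, but without completeness
  of \<open>F\<close> an exactly adapted version with all paths continuous need not exist.
\<close>

definition ito_integral ::
  "'a measure \<Rightarrow> (real \<Rightarrow> 'a measure) \<Rightarrow> (real \<Rightarrow> 'a \<Rightarrow> real) \<Rightarrow> (real \<Rightarrow> 'a \<Rightarrow> real)
    \<Rightarrow> (real \<Rightarrow> 'a \<Rightarrow> real) \<Rightarrow> bool" where
  "ito_integral M F B \<xi> I \<longleftrightarrow>
     (\<forall>t\<ge>0. I t \<in> borel_measurable M) \<and>
     (\<forall>\<omega>\<in>space M. continuous_on {0..} (\<lambda>t. I t \<omega>)) \<and>
     (\<exists>n \<tau> \<phi>. (\<forall>k. simple_integrand M F (n k) (\<tau> k) (\<phi> k)) \<and>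
       (\<forall>T\<ge>0. (\<lambda>k. \<integral>\<^sup>+\<omega>. (\<integral>\<^sup>+s\<in>{0..T}.
            ennreal ((simple_process (n k) (\<tau> k) (\<phi> k) s \<omega> - \<xi> s \<omega>)\<^sup>2) \<partial>lborel) \<partial>M)
          \<longlonglongrightarrow> 0) \<and>
       (\<forall>t\<ge>0. (\<lambda>k. \<integral>\<^sup>+\<omega>.
            ennreal ((elementary_integral B (n k) (\<tau> k) (\<phi> k) t \<omega> - I t \<omega>)\<^sup>2) \<partial>M)
          \<longlonglongrightarrow> 0))"

subsection \<open>Priors and nonlinear expectations\<close>

definition drift :: "'a measure \<Rightarrow> (real \<Rightarrow> 'a measure) \<Rightarrow> real \<Rightarrow> real \<Rightarrow> (real \<Rightarrow> 'a \<Rightarrow> real) \<Rightarrow> bool" where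
  "drift M F l u \<xi> \<longleftrightarrow> progressive F \<xi> \<and> (\<forall>t\<ge>0. \<forall>\<omega>\<in>space M. \<xi> t \<omega> \<in> {l..u})"

definition stochastic_exponential ::
  "'a measure \<Rightarrow> (real \<Rightarrow> 'a measure) \<Rightarrow> (real \<Rightarrow> 'a \<Rightarrow> real) \<Rightarrow> (real \<Rightarrow> 'a \<Rightarrow> real)
    \<Rightarrow> (real \<Rightarrow> 'a \<Rightarrow> real) \<Rightarrow> bool" where
  "stochastic_exponential M F B \<xi> \<epsilon> \<longleftrightarrow>
     (\<exists>I. ito_integral M F B \<xi> I \<and>
       (\<forall>t\<ge>0. \<forall>\<omega>\<in>space M. \<epsilon> t \<omega> = exp (I t \<omega> - (1/2) * (LINT s:{0..t}|lborel. (\<xi> s \<omega>)\<^sup>2))))"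

text \<open>
  The density processes need not be uniformly integrable, so a measure with these densities on all
  \<open>F t\<close> need not exist on \<open>\<Or>t. F t\<close>.  A prior is therefore represented by the consistent family of
  its restrictions to the sigma-algebras \<open>F t\<close>, \<open>t \<ge> 0\<close>.
\<close>

type_synonym 'a prior = "real \<Rightarrow> 'a measure"

definition prior_with_density ::
  "'a measure \<Rightarrow> (real \<Rightarrow> 'a measure) \<Rightarrow> (real \<Rightarrow> 'a \<Rightarrow> real) \<Rightarrow> 'a prior" where
  "prior_with_density M F \<epsilon> =
     (\<lambda>t\<in>{0..}. restr_to_subalg (density M (\<lambda>\<omega>. ennreal (\<epsilon> t \<omega>))) (F t))"

definition priors ::
  "'a measure \<Rightarrow> (real \<Rightarrow> 'a measure) \<Rightarrow> (real \<Rightarrow> 'a \<Rightarrow> real) \<Rightarrow> real \<Rightarrow> real \<Rightarrow> 'a prior set" where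
  "priors M F B l u =
     {prior_with_density M F \<epsilon> | \<xi> \<epsilon>. drift M F l u \<xi> \<and> stochastic_exponential M F B \<xi> \<epsilon>}"

text \<open>
  The density process of a prior is unique up to indistinguishability, hence the choice does not
  affect the expectations below.
\<close>

definition density_process ::
  "'a measure \<Rightarrow> (real \<Rightarrow> 'a measure) \<Rightarrow> (real \<Rightarrow> 'a \<Rightarrow> real) \<Rightarrow> 'a prior \<Rightarrow> real \<Rightarrow> 'a \<Rightarrow> real" where
  "density_process M F B P =
     (SOME \<epsilon>. (\<exists>\<xi> l u. drift M F l u \<xi> \<and> stochastic_exponential M F B \<xi> \<epsilon>) \<and>
        P = prior_with_density M F \<epsilon>)"

text \<open>Expectations under a prior of \<open>\<integral>\<^sub>0\<^sup>\<infinity> X dt\<close> and \<open>\<integral>\<^sub>0\<^sup>\<infinity> X dC\<close>, for nonnegative \<open>X\<close>.\<close>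

definition expectation_dt ::
  "'a measure \<Rightarrow> (real \<Rightarrow> 'a measure) \<Rightarrow> (real \<Rightarrow> 'a \<Rightarrow> real) \<Rightarrow> 'a prior
    \<Rightarrow> (real \<Rightarrow> 'a \<Rightarrow> real) \<Rightarrow> ennreal" where
  "expectation_dt M F B P X =
     (\<integral>\<^sup>+\<omega>. (\<integral>\<^sup>+t\<in>{0..}. ennreal (density_process M F B P t \<omega> * X t \<omega>) \<partial>lborel) \<partial>M)"

definition expectation_dC ::
  "'a measure \<Rightarrow> (real \<Rightarrow> 'a measure) \<Rightarrow> (real \<Rightarrow> 'a \<Rightarrow> real) \<Rightarrow> 'a prior
    \<Rightarrow> (real \<Rightarrow> 'a \<Rightarrow> real) \<Rightarrow> (real \<Rightarrow> 'a \<Rightarrow> real) \<Rightarrow> ennreal" where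
  "expectation_dC M F B P X C =
     (\<integral>\<^sup>+\<omega>. (\<integral>\<^sup>+t\<in>{0..}. ennreal (density_process M F B P t \<omega> * X t \<omega>)
        \<partial>interval_measure (\<lambda>t. C t \<omega>)) \<partial>M)"

definition lower_expectation_dt ::
  "'a measure \<Rightarrow> (real \<Rightarrow> 'a measure) \<Rightarrow> (real \<Rightarrow> 'a \<Rightarrow> real) \<Rightarrow> 'a prior set
    \<Rightarrow> (real \<Rightarrow> 'a \<Rightarrow> real) \<Rightarrow> ennreal" where
  "lower_expectation_dt M F B \<P> X = (INF P\<in>\<P>. expectation_dt M F B P X)"

definition upper_expectation_dC ::
  "'a measure \<Rightarrow> (real \<Rightarrow> 'a measure) \<Rightarrow> (real \<Rightarrow> 'a \<Rightarrow> real) \<Rightarrow> 'a prior set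
    \<Rightarrow> (real \<Rightarrow> 'a \<Rightarrow> real) \<Rightarrow> (real \<Rightarrow> 'a \<Rightarrow> real) \<Rightarrow> ennreal" where
  "upper_expectation_dC M F B \<P> X C = (SUP P\<in>\<P>. expectation_dC M F B P X C)"

subsection \<open>Consumption plans and utility\<close>

text \<open>
  Setting \<open>C t = 0\<close> for \<open>t < 0\<close> encodes \<open>C\<^sub>0\<^sub>- = 0\<close> and gives the measure \<open>dC\<close>, that is
  \<^term>\<open>interval_measure (\<lambda>t. C t \<omega>)\<close>, an atom of mass \<open>C 0\<close> at time \<open>0\<close>.
\<close>

definition consumption_plans ::
  "'a measure \<Rightarrow> (real \<Rightarrow> 'a measure) \<Rightarrow> (real \<Rightarrow> 'a \<Rightarrow> real) set" where
  "consumption_plans M F =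
     {C. (\<forall>t\<ge>0. C t \<in> borel_measurable (F t)) \<and>
         (\<forall>\<omega>\<in>space M. mono (\<lambda>t. C t \<omega>) \<and> (\<forall>t. continuous (at_right t) (\<lambda>s. C s \<omega>)) \<and>
            (\<forall>t<0. C t \<omega> = 0))}"

definition satisfaction ::
  "real \<Rightarrow> real \<Rightarrow> (real \<Rightarrow> 'a \<Rightarrow> real) \<Rightarrow> real \<Rightarrow> 'a \<Rightarrow> real" where
  "satisfaction \<beta> \<eta> C t \<omega> = \<eta> * exp (- \<beta> * t) +
     (LINT s:{0..t}|interval_measure (\<lambda>s. C s \<omega>). \<beta> * exp (- \<beta> * (t - s)))"

definition budget_set ::
  "'a measure \<Rightarrow> (real \<Rightarrow> 'a measure) \<Rightarrow> (real \<Rightarrow> 'a \<Rightarrow> real) \<Rightarrow> 'a prior set \<Rightarrow> real \<Rightarrow> real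
    \<Rightarrow> (real \<Rightarrow> 'a \<Rightarrow> real) set" where
  "budget_set M F B \<P> r w =
     {C \<in> consumption_plans M F.
        upper_expectation_dC M F B \<P> (\<lambda>t \<omega>. exp (- r * t)) C \<le> ennreal w}"

definition utility ::
  "'a measure \<Rightarrow> (real \<Rightarrow> 'a measure) \<Rightarrow> (real \<Rightarrow> 'a \<Rightarrow> real) \<Rightarrow> 'a prior set
    \<Rightarrow> real \<Rightarrow> real \<Rightarrow> real \<Rightarrow> real \<Rightarrow> (real \<Rightarrow> 'a \<Rightarrow> real) \<Rightarrow> ennreal" where
  "utility M F B \<P> \<delta> \<alpha> \<beta> \<eta> C =
     lower_expectation_dt M F B \<P>
       (\<lambda>t \<omega>. exp (- \<delta> * t) * (1 / \<alpha>) * (satisfaction \<beta> \<eta> C t \<omega>) powr \<alpha>)"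

definition optimal_in :: "'c set \<Rightarrow> ('c \<Rightarrow> ennreal) \<Rightarrow> 'c \<Rightarrow> bool" where
  "optimal_in A U C \<longleftrightarrow> C \<in> A \<and> U C = (SUP C'\<in>A. U C')"

end

theory Submission
  imports Defs
begin

text \<open>
  Let \<open>P\<close> be the common prior and \<open>\<epsilon>\<close> its density process.  The utility of a plan is at most its
  expected utility under \<open>P\<close>, and the \<open>P\<close>-expected cost of a plan is at most its budget cost; for a
  deterministic plan both are equalities, because \<open>\<epsilon>\<close> has mean 1.  So it suffices to compare all plans,
  under \<open>P\<close> alone, with the solution \<open>c\<close> of the deterministic problem.  There the satisfaction follows
  \<open>\<eta> e\<^sup>-\<^sup>\<beta>\<^sup>t\<close> until it meets a curve \<open>K e\<^sup>-\<^sup>\<theta>\<^sup>t\<close> with \<open>\<theta> = min \<beta> ((\<delta> - r) / (1 - \<alpha>))\<close> and stays on the curve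
  afterwards; the curve is reached at once, by an initial jump, if \<open>w\<close> is large.

  Optimality is the tangent inequality for \<open>x powr \<alpha>\<close> along \<open>c\<close>: it reduces to the bound
  \<open>E \<integral> \<epsilon> e\<^sup>-\<^sup>q\<^sup>t (\<integral>\<^sub>0\<^sup>t \<beta> e\<^sup>-\<^sup>\<beta>\<^sup>(\<^sup>t\<^sup>-\<^sup>s\<^sup>) dC) dt \<le> \<beta> / (q + \<beta>) E \<integral> \<epsilon> e\<^sup>-\<^sup>q\<^sup>s dC\<close>, where
  \<open>q = \<delta> - (1 - \<alpha>) \<theta> \<ge> r\<close>.  That bound is Tonelli together with
  \<open>E (\<epsilon>\<^sub>t \<integral>\<^sub>0\<^sup>t h dC) \<le> E \<integral>\<^sub>0\<^sup>t \<epsilon> h dC\<close>, which follows by Riemann sums from the supermartingale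
  property of the truncations \<open>min \<epsilon> k\<close>.  Strictness of the tangent inequality forces any optimal plan
  to have the satisfaction of \<open>c\<close>, and the satisfaction determines the plan.
\<close>

subsection \<open>Increments and elementary stochastic exponentials\<close>

text \<open>The rate \<theta> comes from a first-order condition: while consumption is active, the
  marginal utility \<open>exp (- \<delta> * t) * (K * exp (- \<theta> * t)) powr (\<alpha> -
  1)\<close> must decay like the price \<open>exp (- r * t)\<close>, that is, \<delta> - (1 -
  \<alpha>) \<theta> = r. Satisfaction cannot decay faster than at rate \<beta>, whence the minimum;
  if \<theta> = \<beta>, the whole budget is spent at time 0. In the uncapped case \<delta> >
  \<alpha> r says exactly r + \<theta> > 0, so the plan has finite cost.

  The main obstacle is the density. The stochastic integral is only an L2 limit of elementary
  integrals, so the martingale property is proved for simple integrands and carried to the limit.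
  The approximants are first clipped to the bound of the drift: their exponentials are then bounded
  in L2, hence uniformly integrable. The limit is adapted only up to null sets and need not be
  bounded, and neither need a plan; so both are truncated before Riemann sums are taken.\<close>

lemma nn_integral_exp_normal_density:
  assumes "\<sigma> > 0"
  shows "(\<integral>\<^sup>+y. ennreal (exp (p * y - p\<^sup>2 * \<sigma>\<^sup>2 / 2) * normal_density 0 \<sigma> y) \<partial>lborel) = 1"
proof -
  \<comment> \<open>Completing the square: the exponential tilt moves the mean of the Gaussian to
    \<open>p * \<sigma>\<^sup>2\<close>.\<close>
  have "exp (p * y - p\<^sup>2 * \<sigma>\<^sup>2 / 2) * normal_density 0 \<sigma> y = normal_density (p * \<sigma>\<^sup>2) \<sigma> y" for y
  proof -
    have "p * y - p\<^sup>2 * \<sigma>\<^sup>2 / 2 + - (y - 0)\<^sup>2 / (2 * \<sigma>\<^sup>2) = - (y - p * \<sigma>\<^sup>2)\<^sup>2 / (2 * \<sigma>\<^sup>2)"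
      using assms by (simp add: field_simps power2_eq_square)
    then show ?thesis
      by (simp add: normal_density_def exp_add[symmetric])
  qed
  moreover have "(\<integral>\<^sup>+y. ennreal (normal_density m \<sigma> y) \<partial>lborel) = 1" for m
    using integral_normal_density[OF assms, of m] integrable_normal_density[OF assms, of m]
    by (subst nn_integral_eq_integral) auto
  ultimately show ?thesis by simp
qed

text \<open>Expanding the square leaves the zeroth, first and second Gaussian moments, and the first
  one vanishes.\<close>

lemma nn_integral_square_normal_density:
  assumes "\<sigma> > 0"
  shows "(\<integral>\<^sup>+y. ennreal ((x + p * y)\<^sup>2 * normal_density 0 \<sigma> y) \<partial>lborel) = ennreal (x\<^sup>2 + p\<^sup>2 * \<sigma>\<^sup>2)"
proof -
  have "has_bochner_integral lborel
    (\<lambda>y. x\<^sup>2 * normal_density 0 \<sigma> y + (2 * x * p) * (normal_density 0 \<sigma> y * y)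
       + p\<^sup>2 * (normal_density 0 \<sigma> y * (y - 0) ^ (2 * 1)))
    (x\<^sup>2 * 1 + (2 * x * p) * 0 + p\<^sup>2 * (fact (2 * 1) / ((2 / \<sigma>\<^sup>2) ^ 1 * fact 1)))"
    using integral_normal_density[OF assms, of 0] integrable_normal_density[OF assms, of 0]
    by (intro has_bochner_integral_add has_bochner_integral_mult_right
        normal_moment_nz_1 normal_moment_even assms)
       (auto simp: has_bochner_integral_iff)
  moreover have "x\<^sup>2 * normal_density 0 \<sigma> y + (2 * x * p) * (normal_density 0 \<sigma> y * y)
       + p\<^sup>2 * (normal_density 0 \<sigma> y * (y - 0) ^ (2 * 1)) = (x + p * y)\<^sup>2 * normal_density 0 \<sigma> y" for y
    by (simp add: power2_eq_square algebra_simps)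
  moreover have "x\<^sup>2 * 1 + (2 * x * p) * 0 + p\<^sup>2 * (fact (2 * 1) / ((2 / \<sigma>\<^sup>2) ^ 1 * fact 1)) = x\<^sup>2 + p\<^sup>2 * \<sigma>\<^sup>2"
    by (simp add: fact_2)
  ultimately have "has_bochner_integral lborel (\<lambda>y. (x + p * y)\<^sup>2 * normal_density 0 \<sigma> y) (x\<^sup>2 + p\<^sup>2 * \<sigma>\<^sup>2)"
    by simp
  then show ?thesis
    by (intro nn_integral_eq_integral[THEN trans]) (auto simp: has_bochner_integral_iff)
qed

section \<open>Integrating out a Brownian increment given the past\<close>

context brownian_motion
begin

lemma measurable_F_M [measurable_dest]: "f \<in> measurable (F t) N \<Longrightarrow> f \<in> measurable M N"
  using measurable_from_subalg[OF subalgebra_F] .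

lemma measurable_F_mono: "s \<le> t \<Longrightarrow> f \<in> measurable (F s) N \<Longrightarrow> f \<in> measurable (F t) N"
  using sets_F_mono[of s t] space_F by (auto simp: measurable_def)

lemma borel_measurable_B [measurable (raw)]: "0 \<le> t \<Longrightarrow> B t \<in> borel_measurable M"
  using adapted by measurable

text \<open>Independence in product form. Taking the identity into \<open>F s\<close> as the random
  variable of the past makes Tonelli applicable to any function of the past and the next
  increment.\<close>

lemma distr_pair_increment:
  assumes "0 \<le> s" "s < t"
  shows "distr M (F s) (\<lambda>\<omega>. \<omega>) \<Otimes>\<^sub>M distr M borel (\<lambda>\<omega>. B t \<omega> - B s \<omega>)
    = distr M (F s \<Otimes>\<^sub>M borel) (\<lambda>\<omega>. (\<omega>, B t \<omega> - B s \<omega>))"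
proof -
  let ?X = "\<lambda>\<omega>. B t \<omega> - B s \<omega>"
  have id [measurable]: "(\<lambda>\<omega>. \<omega>) \<in> measurable M (F s)"
    using measurable_from_subalg[OF subalgebra_F measurable_ident_sets[OF refl]] .
  have X [measurable]: "?X \<in> borel_measurable M"
    using assms by (intro borel_measurable_diff borel_measurable_B) auto
  interpret d1: prob_space "distr M (F s) (\<lambda>\<omega>. \<omega>)" by (intro prob_space_distr id)
  interpret d2: prob_space "distr M borel ?X" by (intro prob_space_distr X)
  show ?thesis
  proof (intro pair_measure_eqI)
    show "sigma_finite_measure (distr M (F s) (\<lambda>\<omega>. \<omega>))" "sigma_finite_measure (distr M borel ?X)" by unfold_locales
    show "sets (distr M (F s) (\<lambda>\<omega>. \<omega>) \<Otimes>\<^sub>M distr M borel ?X) = sets (distr M (F s \<Otimes>\<^sub>M borel) (\<lambda>\<omega>. (\<omega>, ?X \<omega>)))"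
      by simp
    fix A S assume "A \<in> sets (distr M (F s) (\<lambda>\<omega>. \<omega>))" "S \<in> sets (distr M borel ?X)"
    then have A: "A \<in> sets (F s)" and S: "S \<in> sets borel" by auto
    have AM: "A \<subseteq> space M" "A \<in> sets M"
      using sets.sets_into_space[OF A] A subalgebra_F[of s] by (auto simp: space_F subalgebra_def)
    have XS: "?X -` S \<inter> space M \<in> sets M" using S by measurable
    have eq: "A \<inter> space M = A" "(\<lambda>\<omega>. (\<omega>, ?X \<omega>)) -` (A \<times> S) \<inter> space M = A \<inter> (?X -` S \<inter> space M)"
      using AM by auto
    have "prob (A \<inter> (?X -` S \<inter> space M)) = prob A * prob (?X -` S \<inter> space M)"
      using S by (intro indep_setD[OF independent_increments[OF assms]] A) auto
    then show "emeasure (distr M (F s) (\<lambda>\<omega>. \<omega>)) A * emeasure (distr M borel ?X) S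
        = emeasure (distr M (F s \<Otimes>\<^sub>M borel) (\<lambda>\<omega>. (\<omega>, ?X \<omega>))) (A \<times> S)"
      using A S AM XS
      by (simp add: emeasure_distr eq emeasure_eq_measure ennreal_mult[symmetric] del: vimage_Int)
  qed
qed

text \<open>This takes the place of conditioning on \<open>F s\<close>: for each frozen scenario the
  increment is averaged under its Gaussian law.\<close>

lemma nn_integral_increment:
  assumes "0 \<le> s" "s < t" and f: "f \<in> borel_measurable (F s \<Otimes>\<^sub>M borel)"
  shows "(\<integral>\<^sup>+\<omega>. f (\<omega>, B t \<omega> - B s \<omega>) \<partial>M) =
    (\<integral>\<^sup>+\<omega>. (\<integral>\<^sup>+y. f (\<omega>, y) * normal_density 0 (sqrt (t - s)) y \<partial>lborel) \<partial>M)"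
proof -
  let ?X = "\<lambda>\<omega>. B t \<omega> - B s \<omega>" let ?n = "normal_density 0 (sqrt (t - s))"
  have id [measurable]: "(\<lambda>\<omega>. \<omega>) \<in> measurable M (F s)"
    using measurable_from_subalg[OF subalgebra_F measurable_ident_sets[OF refl]] .
  have X [measurable]: "?X \<in> borel_measurable M"
    using assms by (intro borel_measurable_diff borel_measurable_B) auto
  have d: "distr M borel ?X = density lborel ?n"
    using gaussian_increments[OF assms(1,2)] by (auto simp: distributed_def cong: distr_cong)
  interpret X: prob_space "distr M borel ?X" by (intro prob_space_distr X)
  note f [measurable]
  have "(\<integral>\<^sup>+\<omega>. f (\<omega>, ?X \<omega>) \<partial>M) = (\<integral>\<^sup>+z. f z \<partial>distr M (F s \<Otimes>\<^sub>M borel) (\<lambda>\<omega>. (\<omega>, ?X \<omega>)))"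
    by (subst nn_integral_distr) auto
  also have "\<dots> = (\<integral>\<^sup>+\<omega>. \<integral>\<^sup>+y. f (\<omega>, y) \<partial>distr M borel ?X \<partial>distr M (F s) (\<lambda>\<omega>. \<omega>))"
    unfolding distr_pair_increment[OF assms(1,2), symmetric]
    by (subst X.nn_integral_fst[symmetric]) (auto simp: measurable_split_conv)
  also have "\<dots> = (\<integral>\<^sup>+\<omega>. \<integral>\<^sup>+y. f (\<omega>, y) \<partial>distr M borel ?X \<partial>M)"
    by (subst nn_integral_distr) measurable
  also have "\<dots> = (\<integral>\<^sup>+\<omega>. (\<integral>\<^sup>+y. f (\<omega>, y) * ?n y \<partial>lborel) \<partial>M)"
    unfolding d
  proof (intro nn_integral_cong)
    fix \<omega> assume "\<omega> \<in> space M"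
    then have "\<omega> \<in> space (F s)" by (simp add: space_F)
    then have [measurable]: "(\<lambda>y. f (\<omega>, y)) \<in> borel_measurable borel" by measurable
    show "(\<integral>\<^sup>+y. f (\<omega>, y) \<partial>density lborel ?n) = (\<integral>\<^sup>+y. f (\<omega>, y) * ?n y \<partial>lborel)"
      by (subst nn_integral_density) (auto simp: mult.commute)
  qed
  finally show ?thesis .
qed

text \<open>One step of the exponential martingale. For every frozen value of
  \<open>\<phi> \<omega>\<close> the Gaussian mean of the exponential factor is 1. The case
  \<open>s = t\<close> is separate because the increment then has no density.\<close>

lemma exponential_increment:
  assumes "0 \<le> s" "s \<le> t" and [measurable]: "X \<in> borel_measurable (F s)" "\<phi> \<in> borel_measurable (F s)"
  shows "(\<integral>\<^sup>+\<omega>. X \<omega> * ennreal (exp (\<phi> \<omega> * (B t \<omega> - B s \<omega>) - (\<phi> \<omega>)\<^sup>2 * (t - s) / 2)) \<partial>M)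
    = (\<integral>\<^sup>+\<omega>. X \<omega> \<partial>M)"
proof (cases "s = t")
  case False
  then have st: "s < t" using assms by simp
  have "(\<integral>\<^sup>+\<omega>. X \<omega> * ennreal (exp (\<phi> \<omega> * (B t \<omega> - B s \<omega>) - (\<phi> \<omega>)\<^sup>2 * (t - s) / 2)) \<partial>M) =
    (\<integral>\<^sup>+\<omega>. (\<integral>\<^sup>+y. X \<omega> * ennreal (exp (\<phi> \<omega> * y - (\<phi> \<omega>)\<^sup>2 * (t - s) / 2)) * normal_density 0 (sqrt (t - s)) y \<partial>lborel) \<partial>M)"
    using nn_integral_increment[OF \<open>0 \<le> s\<close> st, where f="\<lambda>(\<omega>, y). X \<omega> * ennreal (exp (\<phi> \<omega> * y - (\<phi> \<omega>)\<^sup>2 * (t - s) / 2))"]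
    by simp
  also have "\<dots> = (\<integral>\<^sup>+\<omega>. X \<omega> \<partial>M)"
  proof (intro nn_integral_cong)
    fix \<omega>
    have "(\<integral>\<^sup>+y. X \<omega> * ennreal (exp (\<phi> \<omega> * y - (\<phi> \<omega>)\<^sup>2 * (t - s) / 2)) * normal_density 0 (sqrt (t - s)) y \<partial>lborel)
      = X \<omega> * (\<integral>\<^sup>+y. ennreal (exp (\<phi> \<omega> * y - (\<phi> \<omega>)\<^sup>2 * (sqrt (t - s))\<^sup>2 / 2) * normal_density 0 (sqrt (t - s)) y) \<partial>lborel)"
      using st by (subst nn_integral_cmult[symmetric]) (auto simp: ennreal_mult' mult.assoc)
    also have "\<dots> = X \<omega>"
      using st by (subst nn_integral_exp_normal_density) auto
    finally show "(\<integral>\<^sup>+y. X \<omega> * ennreal (exp (\<phi> \<omega> * y - (\<phi> \<omega>)\<^sup>2 * (t - s) / 2)) * normal_density 0 (sqrt (t - s)) y \<partial>lborel) = X \<omega>" .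
  qed
  finally show ?thesis .
qed simp

text \<open>One step of the Ito isometry: the increment is centred given the past, so the cross term
  disappears and only the two squares remain.\<close>

lemma square_increment:
  assumes "0 \<le> s" "s \<le> t" and [measurable]: "X \<in> borel_measurable (F s)" "\<phi> \<in> borel_measurable (F s)"
  shows "(\<integral>\<^sup>+\<omega>. ennreal ((X \<omega> + \<phi> \<omega> * (B t \<omega> - B s \<omega>))\<^sup>2) \<partial>M)
    = (\<integral>\<^sup>+\<omega>. ennreal ((X \<omega>)\<^sup>2) \<partial>M) + (\<integral>\<^sup>+\<omega>. ennreal ((\<phi> \<omega>)\<^sup>2 * (t - s)) \<partial>M)"
proof (cases "s = t")
  case False
  then have st: "s < t" using assms by simp
  have "(\<integral>\<^sup>+\<omega>. ennreal ((X \<omega> + \<phi> \<omega> * (B t \<omega> - B s \<omega>))\<^sup>2) \<partial>M) =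
    (\<integral>\<^sup>+\<omega>. (\<integral>\<^sup>+y. ennreal ((X \<omega> + \<phi> \<omega> * y)\<^sup>2) * normal_density 0 (sqrt (t - s)) y \<partial>lborel) \<partial>M)"
    using nn_integral_increment[OF \<open>0 \<le> s\<close> st, where f="\<lambda>(\<omega>, y). ennreal ((X \<omega> + \<phi> \<omega> * y)\<^sup>2)"]
    by simp
  also have "\<dots> = (\<integral>\<^sup>+\<omega>. ennreal ((X \<omega>)\<^sup>2 + (\<phi> \<omega>)\<^sup>2 * (t - s)) \<partial>M)"
    using st nn_integral_square_normal_density[of "sqrt (t - s)"]
    by (intro nn_integral_cong) (simp add: ennreal_mult'[symmetric])
  also have "\<dots> = (\<integral>\<^sup>+\<omega>. ennreal ((X \<omega>)\<^sup>2) + ennreal ((\<phi> \<omega>)\<^sup>2 * (t - s)) \<partial>M)"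
    using st by (intro nn_integral_cong ennreal_plus) auto
  also have "\<dots> = (\<integral>\<^sup>+\<omega>. ennreal ((X \<omega>)\<^sup>2) \<partial>M) + (\<integral>\<^sup>+\<omega>. ennreal ((\<phi> \<omega>)\<^sup>2 * (t - s)) \<partial>M)"
    by (intro nn_integral_add) measurable
  finally show ?thesis .
qed simp

end

section \<open>Simple integrands and their quadratic variation\<close>

lemma simple_integrandD:
  assumes "simple_integrand M F n \<tau> \<phi>"
  shows "i \<le> n \<Longrightarrow> 0 \<le> \<tau> i" "i < n \<Longrightarrow> \<tau> i \<le> \<tau> (Suc i)"
    "i < n \<Longrightarrow> \<phi> i \<in> borel_measurable (F (\<tau> i))"
  using assms unfolding simple_integrand_def
  by (induction i) (auto simp: Suc_le_eq intro: order_trans)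

text \<open>The linear bound keeps the coefficients bounded. It is applied to clipping, to the
  remainder of clipping, and to doubling.\<close>

lemma simple_integrand_compose:
  assumes "simple_integrand M F n \<tau> \<phi>" and [measurable]: "h \<in> borel_measurable borel"
    and h: "\<And>x :: real. \<bar>h x\<bar> \<le> c * \<bar>x :: real\<bar>"
  shows "simple_integrand M F n \<tau> (\<lambda>i \<omega>. h (\<phi> i \<omega>))"
proof -
  have "bounded ((\<lambda>\<omega>. h (\<phi> i \<omega>)) ` space M)" if bnd: "bounded (\<phi> i ` space M)" for i
  proof -
    obtain b where b: "\<And>\<omega>. \<omega> \<in> space M \<Longrightarrow> \<bar>\<phi> i \<omega>\<bar> \<le> b"
      using bnd by (auto simp: bounded_iff)
    have "\<bar>h (\<phi> i \<omega>)\<bar> \<le> \<bar>c\<bar> * b" if "\<omega> \<in> space M" for \<omega>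
      using h[of "\<phi> i \<omega>"] b[OF that]
      by (meson abs_ge_self abs_ge_zero mult_mono order_trans)
    then show ?thesis by (auto simp: bounded_iff)
  qed
  then show ?thesis using assms(1) by (auto simp: simple_integrand_def)
qed

text \<open>The cells of the grid are half-open and disjoint, so at each time at most one summand is
  active and \<open>f\<close> passes through the sum once \<open>f 0 = 0\<close>.\<close>

lemma simple_process_compose:
  assumes "simple_integrand M F n \<tau> \<phi>" and "f 0 = (0::real)"
  shows "f (simple_process n \<tau> \<phi> s \<omega>) = simple_process n \<tau> (\<lambda>i \<omega>. f (\<phi> i \<omega>)) s \<omega>"
proof -
  \<comment> \<open>The induction also records that the partial process vanishes after
    \<open>\<tau> m\<close>; thus the next cell meets only zero.\<close>
  have "m \<le> n \<Longrightarrow> f (simple_process m \<tau> \<phi> s \<omega>) = simple_process m \<tau> (\<lambda>i \<omega>. f (\<phi> i \<omega>)) s \<omega> \<and>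
    (\<tau> m < s \<longrightarrow> simple_process m \<tau> \<phi> s \<omega> = 0)" for m
  proof (induction m)
    case 0 then show ?case using assms by (simp add: simple_process_def)
  next
    case (Suc m)
    then have "\<tau> m \<le> \<tau> (Suc m)" and *: "f (simple_process m \<tau> \<phi> s \<omega>) = simple_process m \<tau> (\<lambda>i \<omega>. f (\<phi> i \<omega>)) s \<omega>"
      "\<tau> m < s \<longrightarrow> simple_process m \<tau> \<phi> s \<omega> = 0"
      using simple_integrandD[OF assms(1)] by auto
    then show ?case using assms(2)
      by (cases "\<tau> m < s"; cases "s \<le> \<tau> (Suc m)") (auto simp: simple_process_def)
  qed
  from this[of n] show ?thesis by simp
qed

text \<open>The time integral of the squared simple process up to \<open>t\<close>, that is, the
  quadratic variation of \<open>elementary_integral\<close>.\<close>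

definition elementary_variation ::
  "nat \<Rightarrow> (nat \<Rightarrow> real) \<Rightarrow> (nat \<Rightarrow> 'a \<Rightarrow> real) \<Rightarrow> real \<Rightarrow> 'a \<Rightarrow> real" where
  "elementary_variation n \<tau> \<phi> t \<omega> =
     (\<Sum>i<n. (\<phi> i \<omega>)\<^sup>2 * (min t (\<tau> (Suc i)) - min t (\<tau> i)))"

lemma has_bochner_integral_simple_process:
  assumes "simple_integrand M F n \<tau> \<phi>" "0 \<le> t"
  shows "has_bochner_integral lborel (\<lambda>s. indicator {0..t} s * (simple_process n \<tau> \<phi> s \<omega>)\<^sup>2)
     (elementary_variation n \<tau> \<phi> t \<omega>)"
proof -
  have "has_bochner_integral lborel
    (\<lambda>s. \<Sum>i<n. (\<phi> i \<omega>)\<^sup>2 * indicator {min t (\<tau> i)<..min t (\<tau> (Suc i))} s)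
    (\<Sum>i<n. (\<phi> i \<omega>)\<^sup>2 * (min t (\<tau> (Suc i)) - min t (\<tau> i)))"
  proof (intro has_bochner_integral_sum has_bochner_integral_mult_right)
    fix i assume "i \<in> {..<n}"
    then have "min t (\<tau> i) \<le> min t (\<tau> (Suc i))"
      using simple_integrandD[OF assms(1)] by (auto simp: min_def intro: order_trans)
    then show "has_bochner_integral lborel (indicat_real {min t (\<tau> i)<..min t (\<tau> (Suc i))})
       (min t (\<tau> (Suc i)) - min t (\<tau> i))"
      using has_bochner_integral_real_indicator[of "{min t (\<tau> i)<..min t (\<tau> (Suc i))}" lborel] by simp
  qed
  moreover have "(\<Sum>i<n. (\<phi> i \<omega>)\<^sup>2 * indicator {min t (\<tau> i)<..min t (\<tau> (Suc i))} s) =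
    indicator {0..t} s * (simple_process n \<tau> \<phi> s \<omega>)\<^sup>2" for s
  proof -
    have "(simple_process n \<tau> \<phi> s \<omega>)\<^sup>2 = simple_process n \<tau> (\<lambda>i \<omega>. (\<phi> i \<omega>)\<^sup>2) s \<omega>"
      using simple_process_compose[OF assms(1), where f="\<lambda>x. x\<^sup>2"] by simp
    moreover have ind: "indicator {min t (\<tau> i)<..min t (\<tau> (Suc i))} s = indicator {0..t} s * (indicator {\<tau> i<..\<tau> (Suc i)} s :: real)"
      if "i < n" for i
      using simple_integrandD(1)[OF assms(1), of i] that by (auto simp: indicator_def min_def)
    ultimately show ?thesis
      by (simp only: simple_process_def sum_distrib_left)
         (intro sum.cong refl, simp only: ind lessThan_iff mult_ac)
  qed
  ultimately show ?thesis by (simp add: elementary_variation_def)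
qed

lemma nn_integral_simple_process:
  assumes "simple_integrand M F n \<tau> \<phi>" "0 \<le> t"
  shows "(\<integral>\<^sup>+s\<in>{0..t}. ennreal ((simple_process n \<tau> \<phi> s \<omega>)\<^sup>2) \<partial>lborel) =
    ennreal (elementary_variation n \<tau> \<phi> t \<omega>)"
proof -
  have "(\<integral>\<^sup>+s\<in>{0..t}. ennreal ((simple_process n \<tau> \<phi> s \<omega>)\<^sup>2) \<partial>lborel)
    = (\<integral>\<^sup>+s. ennreal (indicator {0..t} s * (simple_process n \<tau> \<phi> s \<omega>)\<^sup>2) \<partial>lborel)"
    by (intro nn_integral_cong) (auto simp: indicator_def)
  also have "\<dots> = ennreal (elementary_variation n \<tau> \<phi> t \<omega>)"
    using has_bochner_integral_simple_process[OF assms]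
    by (subst nn_integral_eq_integral) (auto simp: has_bochner_integral_iff)
  finally show ?thesis .
qed

lemma elementary_variation_le:
  assumes "simple_integrand M F n \<tau> \<phi>" "0 \<le> t" and le: "\<And>i. i < n \<Longrightarrow> \<bar>\<phi> i \<omega>\<bar> \<le> K"
  shows "elementary_variation n \<tau> \<phi> t \<omega> \<le> K\<^sup>2 * t"
proof -
  have "elementary_variation n \<tau> \<phi> t \<omega> \<le> (\<Sum>i<n. K\<^sup>2 * (min t (\<tau> (Suc i)) - min t (\<tau> i)))"
    unfolding elementary_variation_def
  proof (intro sum_mono mult_right_mono)
    fix i assume "i \<in> {..<n}"
    then show "(\<phi> i \<omega>)\<^sup>2 \<le> K\<^sup>2" using power_mono[OF le, of i 2] by simp
    show "0 \<le> min t (\<tau> (Suc i)) - min t (\<tau> i)"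
      using simple_integrandD(2)[OF assms(1)] \<open>i \<in> {..<n}\<close> by (auto simp: min_def intro: order_trans)
  qed
  also have "\<dots> = K\<^sup>2 * (min t (\<tau> n) - min t (\<tau> 0))"
    by (simp add: sum_distrib_left[symmetric] sum_lessThan_telescope[where f="\<lambda>i. min t (\<tau> i)"])
  also have "\<dots> \<le> K\<^sup>2 * t"
    using assms(2) simple_integrandD(1)[OF assms(1), of 0] by (intro mult_left_mono) auto
  finally show ?thesis .
qed

section \<open>Isometry and exponential martingale for simple integrands\<close>

context brownian_motion
begin

text \<open>A coefficient fixed later than \<open>t\<close> need not be known at \<open>t\<close>,
  but its cell, stopped at \<open>t\<close>, is then empty and the term is 0.\<close>

lemma elementary_integral_term_measurable:
  assumes "simple_integrand M F n \<tau> \<phi>" "i < n" "0 \<le> t"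
  shows "(\<lambda>\<omega>. \<phi> i \<omega> * (B (min t (\<tau> (Suc i))) \<omega> - B (min t (\<tau> i)) \<omega>)) \<in> borel_measurable (F t)"
    and "(\<lambda>\<omega>. (\<phi> i \<omega>)\<^sup>2 * (min t (\<tau> (Suc i)) - min t (\<tau> i))) \<in> borel_measurable (F t)"
proof -
  note D = simple_integrandD[OF assms(1)]
  have 0: "0 \<le> \<tau> i" "0 \<le> \<tau> (Suc i)" using assms D by auto
  have B: "B u \<in> borel_measurable (F t)" if "0 \<le> u" "u \<le> t" for u
    using measurable_F_mono[OF that(2) adapted[OF that(1)]] .
  have *: "\<phi> i \<in> borel_measurable (F t)" if "\<tau> i \<le> t"
    using measurable_F_mono[OF that D(3)] assms by simp
  have **: "\<tau> i \<le> \<tau> (Suc i)" using assms D by auto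
  show "(\<lambda>\<omega>. \<phi> i \<omega> * (B (min t (\<tau> (Suc i))) \<omega> - B (min t (\<tau> i)) \<omega>)) \<in> borel_measurable (F t)"
    using * ** 0 assms
    by (cases "\<tau> i \<le> t") (auto intro!: borel_measurable_times borel_measurable_diff B)
  show "(\<lambda>\<omega>. (\<phi> i \<omega>)\<^sup>2 * (min t (\<tau> (Suc i)) - min t (\<tau> i))) \<in> borel_measurable (F t)"
    using * ** by (cases "\<tau> i \<le> t") auto
qed

lemma elementary_integral_measurable:
  assumes "simple_integrand M F n \<tau> \<phi>" "0 \<le> t"
  shows "elementary_integral B n \<tau> \<phi> t \<in> borel_measurable (F t)"
    and "elementary_variation n \<tau> \<phi> t \<in> borel_measurable (F t)"
  unfolding elementary_integral_def elementary_variation_def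
  using elementary_integral_term_measurable[OF assms(1) _ assms(2)]
  by (auto intro!: borel_measurable_sum)

text \<open>Induction along the grid stopped at \<open>t\<close>, adding one orthogonal increment at
  a time by \<open>square_increment\<close>.\<close>

lemma Ito_isometry_elementary:
  assumes "simple_integrand M F n \<tau> \<phi>" "0 \<le> t"
  shows "(\<integral>\<^sup>+\<omega>. ennreal ((elementary_integral B n \<tau> \<phi> t \<omega>)\<^sup>2) \<partial>M) =
    (\<integral>\<^sup>+\<omega>. ennreal (elementary_variation n \<tau> \<phi> t \<omega>) \<partial>M)"
proof -
  note D = simple_integrandD[OF assms(1)]
  define u where "u i = min t (\<tau> i)" for i
  have u: "i \<le> n \<Longrightarrow> 0 \<le> u i" "i < n \<Longrightarrow> u i \<le> u (Suc i)" for i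
    using D assms(2) by (auto simp: u_def min_def intro: order_trans)
  have "m \<le> n \<Longrightarrow> (\<lambda>\<omega>. \<Sum>i<m. \<phi> i \<omega> * (B (u (Suc i)) \<omega> - B (u i) \<omega>)) \<in> borel_measurable (F (u m)) \<and>
    (\<integral>\<^sup>+\<omega>. ennreal ((\<Sum>i<m. \<phi> i \<omega> * (B (u (Suc i)) \<omega> - B (u i) \<omega>))\<^sup>2) \<partial>M) =
    (\<integral>\<^sup>+\<omega>. ennreal (\<Sum>i<m. (\<phi> i \<omega>)\<^sup>2 * (u (Suc i) - u i)) \<partial>M)" for m
  proof (induction m)
    case (Suc m)
    let ?S = "\<lambda>\<omega>. \<Sum>i<m. \<phi> i \<omega> * (B (u (Suc i)) \<omega> - B (u i) \<omega>)"
    let ?Q = "\<lambda>\<omega>. \<Sum>i<m. (\<phi> i \<omega>)\<^sup>2 * (u (Suc i) - u i)"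
    have S: "?S \<in> borel_measurable (F (u m))"
      and IH: "(\<integral>\<^sup>+\<omega>. ennreal ((?S \<omega>)\<^sup>2) \<partial>M) = (\<integral>\<^sup>+\<omega>. ennreal (?Q \<omega>) \<partial>M)"
      using Suc by auto
    have m: "m < n" using Suc by simp
    show ?case
    proof (cases "u m = u (Suc m)")
      case True then show ?thesis using S IH by simp
    next
      case False
      \<comment> \<open>A stopped cell that is not degenerate starts before \<open>t\<close>, so its
        left end is the true grid point and \<open>\<phi> m\<close> is already known there.\<close>
      then have "\<tau> m \<le> u m" using D(2)[OF m] by (auto simp: u_def min_def split: if_splits)
      then have \<phi>: "\<phi> m \<in> borel_measurable (F (u m))" using measurable_F_mono D(3)[OF m] by blast
      note meas [measurable] = measurable_F_mono[OF u(2)[OF m] S] measurable_F_mono[OF u(2)[OF m] \<phi>]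
        measurable_F_mono[OF u(2)[OF m] adapted] adapted[of "u (Suc m)"]
      have [measurable]: "\<And>i. i \<le> m \<Longrightarrow> \<phi> i \<in> borel_measurable M"
        using measurable_F_M[OF D(3)] m by simp
      have "(\<integral>\<^sup>+\<omega>. ennreal ((?S \<omega> + \<phi> m \<omega> * (B (u (Suc m)) \<omega> - B (u m) \<omega>))\<^sup>2) \<partial>M)
        = (\<integral>\<^sup>+\<omega>. ennreal (?Q \<omega>) \<partial>M) + (\<integral>\<^sup>+\<omega>. ennreal ((\<phi> m \<omega>)\<^sup>2 * (u (Suc m) - u m)) \<partial>M)"
        using square_increment[OF u(1) u(2) S \<phi>] m IH by simp
      also have "\<dots> = (\<integral>\<^sup>+\<omega>. ennreal (?Q \<omega>) + ennreal ((\<phi> m \<omega>)\<^sup>2 * (u (Suc m) - u m)) \<partial>M)"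
        by (intro nn_integral_add[symmetric]) measurable
      also have "\<dots> = (\<integral>\<^sup>+\<omega>. ennreal (?Q \<omega> + (\<phi> m \<omega>)\<^sup>2 * (u (Suc m) - u m)) \<partial>M)"
        using u(2) m by (intro nn_integral_cong ennreal_plus[symmetric] sum_nonneg) auto
      finally show ?thesis
        using meas u m by (auto intro!: borel_measurable_add borel_measurable_times borel_measurable_diff)
    qed
  qed simp
  from this[of n] show ?thesis
    by (simp add: elementary_integral_def elementary_variation_def u_def)
qed

definition elementary_exponential where
  "elementary_exponential n \<tau> \<phi> t \<omega> =
     exp (elementary_integral B n \<tau> \<phi> t \<omega> - elementary_variation n \<tau> \<phi> t \<omega> / 2)"

lemma elementary_exponential_measurable:
  assumes "simple_integrand M F n \<tau> \<phi>" "0 \<le> t"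
  shows "elementary_exponential n \<tau> \<phi> t \<in> borel_measurable (F t)"
  unfolding elementary_exponential_def using elementary_integral_measurable[OF assms] by measurable

text \<open>Between \<open>s\<close> and \<open>t\<close> the exponential gains one factor per cell,
  each of mean 1 given the past. The martingale property is expressed by testing against nonnegative
  weights known at \<open>s\<close>, in place of conditional expectations.\<close>

lemma elementary_exponential_martingale:
  assumes "simple_integrand M F n \<tau> \<phi>" "0 \<le> s" "s \<le> t" and X: "X \<in> borel_measurable (F s)"
  shows "(\<integral>\<^sup>+\<omega>. X \<omega> * ennreal (elementary_exponential n \<tau> \<phi> t \<omega>) \<partial>M)
    = (\<integral>\<^sup>+\<omega>. X \<omega> * ennreal (elementary_exponential n \<tau> \<phi> s \<omega>) \<partial>M)"
proof -
  note D = simple_integrandD[OF assms(1)]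
  \<comment> \<open>The grid is clamped to \<open>[s, t]\<close>; \<open>G i\<close> is the
    logarithm of the factor gained on the \<open>i\<close>-th clamped cell.\<close>
  define u where "u i = max s (min t (\<tau> i))" for i
  define G where "G i \<omega> = \<phi> i \<omega> * (B (u (Suc i)) \<omega> - B (u i) \<omega>) - (\<phi> i \<omega>)\<^sup>2 * (u (Suc i) - u i) / 2" for i \<omega>
  define E where "E = elementary_exponential n \<tau> \<phi> s"
  have u: "s \<le> u i" "0 \<le> u i" "i < n \<Longrightarrow> u i \<le> u (Suc i)" for i
    using D assms(2) by (auto simp: u_def min_def max_def intro: order_trans)
  have E: "E \<in> borel_measurable (F s)"
    unfolding E_def by (rule elementary_exponential_measurable[OF assms(1,2)])
  have "m \<le> n \<Longrightarrow> (\<lambda>\<omega>. \<Sum>i<m. G i \<omega>) \<in> borel_measurable (F (u m)) \<and>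
    (\<integral>\<^sup>+\<omega>. X \<omega> * ennreal (E \<omega>) * ennreal (exp (\<Sum>i<m. G i \<omega>)) \<partial>M) = (\<integral>\<^sup>+\<omega>. X \<omega> * ennreal (E \<omega>) \<partial>M)" for m
  proof (induction m)
    case (Suc m)
    let ?S = "\<lambda>\<omega>. \<Sum>i<m. G i \<omega>"
    have S [measurable]: "?S \<in> borel_measurable (F (u m))"
      and IH: "(\<integral>\<^sup>+\<omega>. X \<omega> * ennreal (E \<omega>) * ennreal (exp (?S \<omega>)) \<partial>M) = (\<integral>\<^sup>+\<omega>. X \<omega> * ennreal (E \<omega>) \<partial>M)"
      using Suc by auto
    have m: "m < n" using Suc by simp
    show ?case
    proof (cases "u m = u (Suc m)")
      case True then show ?thesis using S IH by (simp add: G_def)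
    next
      case False
      then have "\<tau> m \<le> u m" using D(2)[OF m] by (auto simp: u_def min_def max_def split: if_splits)
      then have \<phi>: "\<phi> m \<in> borel_measurable (F (u m))" using measurable_F_mono D(3)[OF m] by blast
      have W: "(\<lambda>\<omega>. X \<omega> * ennreal (E \<omega>) * ennreal (exp (?S \<omega>))) \<in> borel_measurable (F (u m))"
        using measurable_F_mono[OF u(1)[of m] E] measurable_F_mono[OF u(1)[of m] X] S by measurable
      have "(\<integral>\<^sup>+\<omega>. X \<omega> * ennreal (E \<omega>) * ennreal (exp (?S \<omega> + G m \<omega>)) \<partial>M) =
        (\<integral>\<^sup>+\<omega>. (X \<omega> * ennreal (E \<omega>) * ennreal (exp (?S \<omega>))) * ennreal (exp (G m \<omega>)) \<partial>M)"
        by (simp add: exp_add ennreal_mult' mult.assoc)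
      also have "\<dots> = (\<integral>\<^sup>+\<omega>. X \<omega> * ennreal (E \<omega>) * ennreal (exp (?S \<omega>)) \<partial>M)"
        using exponential_increment[OF u(2) u(3)[OF m] W \<phi>] by (simp add: G_def[of m])
      finally have "(\<integral>\<^sup>+\<omega>. X \<omega> * ennreal (E \<omega>) * ennreal (exp (\<Sum>i<Suc m. G i \<omega>)) \<partial>M) = (\<integral>\<^sup>+\<omega>. X \<omega> * ennreal (E \<omega>) \<partial>M)"
        using IH by simp
      moreover have "(\<lambda>\<omega>. \<Sum>i<Suc m. G i \<omega>) \<in> borel_measurable (F (u (Suc m)))"
        using measurable_F_mono[OF u(3)[OF m] S] measurable_F_mono[OF u(3)[OF m] \<phi>]
          measurable_F_mono[OF u(3)[OF m] adapted[OF u(2)]] adapted[OF u(2), of "Suc m"]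
        by (simp add: G_def)
      ultimately show ?thesis by blast
    qed
  qed simp
  then have "(\<integral>\<^sup>+\<omega>. X \<omega> * ennreal (E \<omega>) * ennreal (exp (\<Sum>i<n. G i \<omega>)) \<partial>M) = (\<integral>\<^sup>+\<omega>. X \<omega> * ennreal (E \<omega>) \<partial>M)"
    by blast
  \<comment> \<open>Each cell stopped at \<open>t\<close> splits at \<open>s\<close> into the same
    cell stopped at \<open>s\<close> and its clamped part, so the exponents add up.\<close>
  moreover have "elementary_exponential n \<tau> \<phi> t \<omega> = E \<omega> * exp (\<Sum>i<n. G i \<omega>)" for \<omega>
  proof -
    have "B (min t x) \<omega> - B (min s x) \<omega> = B (max s (min t x)) \<omega> - B s \<omega>" for x
      using assms(3) by (auto simp: min_def max_def)
    then have "B (min t x) \<omega> - B (min t y) \<omega> = (B (min s x) \<omega> - B (min s y) \<omega>) + (B (max s (min t x)) \<omega> - B (max s (min t y)) \<omega>)" for x y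
      by (smt (verit))
    moreover have "min t x - min t y = (min s x - min s y) + (max s (min t x) - max s (min t y))" for x y :: real
      using assms(3) by (auto simp: min_def max_def)
    ultimately have "elementary_integral B n \<tau> \<phi> t \<omega> - elementary_variation n \<tau> \<phi> t \<omega> / 2
      = elementary_integral B n \<tau> \<phi> s \<omega> - elementary_variation n \<tau> \<phi> s \<omega> / 2 + (\<Sum>i<n. G i \<omega>)"
      unfolding elementary_integral_def elementary_variation_def G_def u_def
      by (simp only: sum_divide_distrib sum_subtractf[symmetric] sum.distrib[symmetric])
         (intro sum.cong refl, simp add: algebra_simps add_divide_distrib diff_divide_distrib)
    then show ?thesis by (simp add: E_def elementary_exponential_def exp_add)
  qed
  ultimately show ?thesis by (simp add: E_def ennreal_mult' mult.assoc elementary_exponential_def)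
qed

lemma elementary_exponential_0:
  assumes "simple_integrand M F n \<tau> \<phi>"
  shows "elementary_exponential n \<tau> \<phi> 0 \<omega> = 1"
proof -
  have "i \<le> n \<Longrightarrow> min 0 (\<tau> i) = 0" for i using simple_integrandD(1)[OF assms] by simp
  then show ?thesis by (simp add: elementary_exponential_def elementary_integral_def elementary_variation_def)
qed

text \<open>Squaring doubles the integrand up to a factor: the square is the exponential for
  \<open>2 * \<phi>\<close> times \<open>exp\<close> of the variation. The former has mean 1 and the
  latter is at most \<open>exp (K\<^sup>2 * t)\<close>.\<close>

lemma elementary_exponential_square_le:
  assumes S: "simple_integrand M F n \<tau> \<phi>" "0 \<le> t" and le: "\<And>i \<omega>. i < n \<Longrightarrow> \<omega> \<in> space M \<Longrightarrow> \<bar>\<phi> i \<omega>\<bar> \<le> K"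
  shows "(\<integral>\<^sup>+\<omega>. ennreal ((elementary_exponential n \<tau> \<phi> t \<omega>)\<^sup>2) \<partial>M) \<le> ennreal (exp (K\<^sup>2 * t))"
proof -
  let ?\<phi> = "\<lambda>i \<omega>. 2 * \<phi> i \<omega>"
  have S2: "simple_integrand M F n \<tau> ?\<phi>"
    using simple_integrand_compose[OF S(1), where h="\<lambda>x. 2 * x" and c=2] by (simp add: abs_mult)
  have "(\<integral>\<^sup>+\<omega>. ennreal ((elementary_exponential n \<tau> \<phi> t \<omega>)\<^sup>2) \<partial>M)
    \<le> (\<integral>\<^sup>+\<omega>. ennreal (exp (K\<^sup>2 * t)) * ennreal (elementary_exponential n \<tau> ?\<phi> t \<omega>) \<partial>M)"
  proof (intro nn_integral_mono)
    fix \<omega> assume "\<omega> \<in> space M"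
    have "elementary_integral B n \<tau> ?\<phi> t \<omega> = 2 * elementary_integral B n \<tau> \<phi> t \<omega>"
      "elementary_variation n \<tau> ?\<phi> t \<omega> = 4 * elementary_variation n \<tau> \<phi> t \<omega>"
      unfolding elementary_integral_def elementary_variation_def sum_distrib_left
      by (auto intro!: sum.cong simp: power_mult_distrib)
    then have "(elementary_exponential n \<tau> \<phi> t \<omega>)\<^sup>2 = exp (elementary_variation n \<tau> \<phi> t \<omega>) * elementary_exponential n \<tau> ?\<phi> t \<omega>"
      by (simp add: elementary_exponential_def exp_double[symmetric] exp_add[symmetric] right_diff_distrib)
    also have "\<dots> \<le> exp (K\<^sup>2 * t) * elementary_exponential n \<tau> ?\<phi> t \<omega>"
      using elementary_variation_le[OF S, of \<omega> K] le \<open>\<omega> \<in> space M\<close>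
      by (intro mult_right_mono) (auto simp: elementary_exponential_def)
    finally show "ennreal ((elementary_exponential n \<tau> \<phi> t \<omega>)\<^sup>2) \<le> ennreal (exp (K\<^sup>2 * t)) * ennreal (elementary_exponential n \<tau> ?\<phi> t \<omega>)"
      by (subst ennreal_mult'[symmetric]) (auto intro: ennreal_leI)
  qed
  also have "\<dots> = ennreal (exp (K\<^sup>2 * t))"
    using elementary_exponential_martingale[OF S2 order_refl S(2), of "\<lambda>_. 1"]
      measurable_F_M[OF elementary_exponential_measurable[OF S2 S(2)]]
    by (subst nn_integral_cmult) (auto simp: elementary_exponential_0[OF S2] emeasure_space_1)
  finally show ?thesis .
qed

end

subsection \<open>Density martingales\<close>

text \<open>Individual members of the sequence may have infinite integral, so the L1 subsequence
  theorem is applied to \<open>min 1 (u k)\<close>; where that tends to 0, so does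
  \<open>u k\<close>.\<close>

lemma (in prob_space) nn_integral_tendsto_0_AE_subseq:
  fixes u :: "nat \<Rightarrow> 'a \<Rightarrow> real"
  assumes [measurable]: "\<And>k. u k \<in> borel_measurable M" and pos: "\<And>k \<omega>. 0 \<le> u k \<omega>"
    and lim: "(\<lambda>k. \<integral>\<^sup>+\<omega>. ennreal (u k \<omega>) \<partial>M) \<longlonglongrightarrow> 0"
  obtains \<rho> where "strict_mono \<rho>" "AE \<omega> in M. (\<lambda>k. u (\<rho> k) \<omega>) \<longlonglongrightarrow> 0"
proof -
  let ?v = "\<lambda>k \<omega>. min 1 (u k \<omega>)"
  have int: "integrable M (?v k)" for k
    using pos by (intro integrable_const_bound[where B=1]) (auto simp: min_def)
  have "(\<lambda>k. ennreal (\<integral>\<omega>. norm (?v k \<omega>) \<partial>M)) \<longlonglongrightarrow> 0"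
  proof (rule tendsto_sandwich[OF _ _ tendsto_const lim])
    show "\<forall>\<^sub>F k in sequentially. ennreal (\<integral>\<omega>. norm (?v k \<omega>) \<partial>M) \<le> (\<integral>\<^sup>+\<omega>. ennreal (u k \<omega>) \<partial>M)"
    proof (intro always_eventually allI)
      fix k
      have "ennreal (\<integral>\<omega>. norm (?v k \<omega>) \<partial>M) = (\<integral>\<^sup>+\<omega>. ennreal (norm (?v k \<omega>)) \<partial>M)"
        using int by (intro nn_integral_eq_integral[symmetric]) auto
      also have "\<dots> \<le> (\<integral>\<^sup>+\<omega>. ennreal (u k \<omega>) \<partial>M)"
        using pos by (intro nn_integral_mono ennreal_leI) (auto simp: min_def)
      finally show "ennreal (\<integral>\<omega>. norm (?v k \<omega>) \<partial>M) \<le> (\<integral>\<^sup>+\<omega>. ennreal (u k \<omega>) \<partial>M)" .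
    qed
  qed auto
  then have "(\<lambda>k. \<integral>\<omega>. norm (?v k \<omega>) \<partial>M) \<longlonglongrightarrow> 0"
    by (subst (asm) ennreal_tendsto_0_iff) auto
  from tendsto_L1_AE_subseq[OF int this] obtain \<rho> where
    \<rho>: "strict_mono \<rho>" "AE \<omega> in M. (\<lambda>k. ?v (\<rho> k) \<omega>) \<longlonglongrightarrow> 0" by auto
  have "AE \<omega> in M. (\<lambda>k. u (\<rho> k) \<omega>) \<longlonglongrightarrow> 0"
    using \<rho>(2)
  proof eventually_elim
    case (elim \<omega>)
    then have "\<forall>\<^sub>F k in sequentially. ?v (\<rho> k) \<omega> < 1" by (rule order_tendstoD) simp
    then have "\<forall>\<^sub>F k in sequentially. ?v (\<rho> k) \<omega> = u (\<rho> k) \<omega>"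
      by eventually_elim (auto simp: min_def split: if_splits)
    then show ?case using elim by (rule Lim_transform_eventually[rotated])
  qed
  with \<rho>(1) show thesis by (rule that)
qed

lemma truncation_le:
  fixes x h :: real
  assumes "0 \<le> x" "0 < h"
  shows "x \<le> min x h + x\<^sup>2 / h"
proof (cases "x \<le> h")
  case False
  then have "x \<le> x\<^sup>2 / h" using assms by (auto simp: field_simps power2_eq_square intro!: mult_left_mono)
  then show ?thesis using False assms by (auto simp: min_def)
qed (use assms in \<open>auto simp: min_def\<close>)

text \<open>Fatou handles the left side. On the right the L2 bound gives uniform integrability:
  truncating \<open>f' k\<close> at height \<open>h\<close> loses at most \<open>c * A / h\<close>
  for all \<open>k\<close> at once, and the truncated part converges by dominated
  convergence.\<close>

lemma (in prob_space) nn_integral_limit_le_L2_bounded: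
  fixes f f' :: "nat \<Rightarrow> 'a \<Rightarrow> real"
  assumes [measurable]: "\<And>k. f k \<in> borel_measurable M" "\<And>k. f' k \<in> borel_measurable M"
      "g' \<in> borel_measurable M" "X \<in> borel_measurable M"
    and pos: "\<And>k \<omega>. 0 \<le> f' k \<omega>"
    and X: "\<And>\<omega>. \<omega> \<in> space M \<Longrightarrow> X \<omega> \<le> ennreal c" and "0 \<le> c" "0 \<le> A"
    and lim: "AE \<omega> in M. (\<lambda>k. f k \<omega>) \<longlonglongrightarrow> g \<omega>" "AE \<omega> in M. (\<lambda>k. f' k \<omega>) \<longlonglongrightarrow> g' \<omega>"
    and le: "\<And>k. (\<integral>\<^sup>+\<omega>. X \<omega> * ennreal (f k \<omega>) \<partial>M) \<le> (\<integral>\<^sup>+\<omega>. X \<omega> * ennreal (f' k \<omega>) \<partial>M)"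
    and bound: "\<And>k. (\<integral>\<^sup>+\<omega>. ennreal ((f' k \<omega>)\<^sup>2) \<partial>M) \<le> ennreal A"
  shows "(\<integral>\<^sup>+\<omega>. X \<omega> * ennreal (g \<omega>) \<partial>M) \<le> (\<integral>\<^sup>+\<omega>. X \<omega> * ennreal (g' \<omega>) \<partial>M)"
proof (rule ennreal_le_epsilon)
  fix e :: real assume "0 < e"
  \<comment> \<open>Solves \<open>c * A / h \<le> e\<close>; adding 1 keeps \<open>h\<close>
    positive when \<open>c * A\<close> is 0.\<close>
  define h where "h = c * A / e + 1"
  have h: "0 < h" using \<open>0 < e\<close> \<open>0 \<le> c\<close> \<open>0 \<le> A\<close> by (auto simp: h_def intro!: add_nonneg_pos)
  have he: "c * (A / h) \<le> e" using \<open>0 < e\<close> h by (auto simp: h_def field_simps)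
  have limX: "AE \<omega> in M. (\<lambda>k. X \<omega> * ennreal (u k \<omega>)) \<longlonglongrightarrow> X \<omega> * ennreal (v \<omega>)"
    if "AE \<omega> in M. (\<lambda>k. u k \<omega>) \<longlonglongrightarrow> v \<omega>" for u v
    using that AE_space
  proof eventually_elim
    case (elim \<omega>)
    then show ?case using X[OF elim(2)]
      by (intro ennreal_tendsto_cmult tendsto_ennrealI) (auto simp: less_top[symmetric] top_unique)
  qed
  let ?m = "\<lambda>k. \<integral>\<^sup>+\<omega>. X \<omega> * ennreal (min (f' k \<omega>) h) \<partial>M"
  have "?m \<longlonglongrightarrow> (\<integral>\<^sup>+\<omega>. X \<omega> * ennreal (min (g' \<omega>) h) \<partial>M)"
  proof (rule nn_integral_dominated_convergence[where w="\<lambda>_. ennreal (c * h)"])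
    show "AE \<omega> in M. X \<omega> * ennreal (min (f' k \<omega>) h) \<le> ennreal (c * h)" for k
      using X \<open>0 \<le> c\<close> h pos by (intro AE_I2) (auto simp: ennreal_mult intro!: mult_mono ennreal_leI)
    show "AE \<omega> in M. (\<lambda>k. X \<omega> * ennreal (min (f' k \<omega>) h)) \<longlonglongrightarrow> X \<omega> * ennreal (min (g' \<omega>) h)"
      using lim(2) by (intro limX) (auto elim!: eventually_mono intro!: tendsto_intros)
  qed (simp_all add: emeasure_space_1)
  then have m: "liminf (\<lambda>k. ?m k + ennreal e) = (\<integral>\<^sup>+\<omega>. X \<omega> * ennreal (min (g' \<omega>) h) \<partial>M) + ennreal e"
    by (intro lim_imp_Liminf tendsto_add tendsto_const) auto
  have trunc: "(\<integral>\<^sup>+\<omega>. X \<omega> * ennreal (f' k \<omega>) \<partial>M) \<le> ?m k + ennreal e" for k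
  proof -
    have "(\<integral>\<^sup>+\<omega>. X \<omega> * ennreal (f' k \<omega>) \<partial>M) \<le> (\<integral>\<^sup>+\<omega>. X \<omega> * ennreal (min (f' k \<omega>) h) + ennreal (c / h) * ennreal ((f' k \<omega>)\<^sup>2) \<partial>M)"
    proof (intro nn_integral_mono)
      fix \<omega> assume \<omega>: "\<omega> \<in> space M"
      have "X \<omega> * ennreal (f' k \<omega>) \<le> X \<omega> * (ennreal (min (f' k \<omega>) h) + ennreal ((f' k \<omega>)\<^sup>2 / h))"
        using truncation_le[OF pos h, of k \<omega>] pos h
        by (subst ennreal_plus[symmetric]) (auto simp del: ennreal_plus intro!: mult_left_mono ennreal_leI)
      also have "\<dots> \<le> X \<omega> * ennreal (min (f' k \<omega>) h) + ennreal c * ennreal ((f' k \<omega>)\<^sup>2 / h)"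
        unfolding distrib_left using X[OF \<omega>] by (intro add_left_mono mult_right_mono) auto
      also have "ennreal c * ennreal ((f' k \<omega>)\<^sup>2 / h) = ennreal (c / h) * ennreal ((f' k \<omega>)\<^sup>2)"
        using \<open>0 \<le> c\<close> h by (simp add: ennreal_mult[symmetric])
      finally show "X \<omega> * ennreal (f' k \<omega>) \<le> X \<omega> * ennreal (min (f' k \<omega>) h) + ennreal (c / h) * ennreal ((f' k \<omega>)\<^sup>2)" .
    qed
    also have "\<dots> = ?m k + ennreal (c / h) * (\<integral>\<^sup>+\<omega>. ennreal ((f' k \<omega>)\<^sup>2) \<partial>M)"
      by (subst nn_integral_add) (auto simp: nn_integral_cmult)
    also have "\<dots> \<le> ?m k + ennreal (c / h) * ennreal A"
      by (intro add_left_mono mult_left_mono bound) auto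
    also have "ennreal (c / h) * ennreal A \<le> ennreal e"
      using he \<open>0 \<le> c\<close> \<open>0 \<le> A\<close> h by (auto simp: ennreal_mult[symmetric] intro!: ennreal_leI)
    finally show ?thesis by (simp add: add_left_mono)
  qed
  have "(\<integral>\<^sup>+\<omega>. X \<omega> * ennreal (g \<omega>) \<partial>M) = (\<integral>\<^sup>+\<omega>. liminf (\<lambda>k. X \<omega> * ennreal (f k \<omega>)) \<partial>M)"
    using limX[OF lim(1)] by (intro nn_integral_cong_AE) (auto elim!: eventually_mono simp: lim_imp_Liminf)
  also have "\<dots> \<le> liminf (\<lambda>k. \<integral>\<^sup>+\<omega>. X \<omega> * ennreal (f k \<omega>) \<partial>M)"
    by (intro nn_integral_liminf) measurable
  also have "\<dots> \<le> liminf (\<lambda>k. ?m k + ennreal e)"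
    by (intro Liminf_mono always_eventually allI order_trans[OF le trunc])
  also have "\<dots> \<le> (\<integral>\<^sup>+\<omega>. X \<omega> * ennreal (g' \<omega>) \<partial>M) + ennreal e"
    unfolding m by (intro add_right_mono nn_integral_mono mult_left_mono ennreal_leI) auto
  finally show "(\<integral>\<^sup>+\<omega>. X \<omega> * ennreal (g \<omega>) \<partial>M) \<le> (\<integral>\<^sup>+\<omega>. X \<omega> * ennreal (g' \<omega>) \<partial>M) + ennreal e" .
qed

text \<open>What the rest of the proof uses of a prior. The martingale property is tested against
  bounded nonnegative weights. Adaptedness is asked only up to null sets, because the version of the
  Ito integral behind \<open>Z\<close> is measurable merely with respect to
  \<open>M\<close>.\<close>

locale martingale_density = prob_space M + filtration "space M" F
  for M :: "'a measure" and F :: "real \<Rightarrow> 'a measure" +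
  fixes Z :: "real \<Rightarrow> 'a \<Rightarrow> real"
  assumes subalgebra: "\<And>t. subalgebra M (F t)"
    and measurable_density: "\<And>t. 0 \<le> t \<Longrightarrow> Z t \<in> borel_measurable M"
    and density_pos: "\<And>t \<omega>. 0 \<le> t \<Longrightarrow> \<omega> \<in> space M \<Longrightarrow> 0 < Z t \<omega>"
    and continuous_density: "\<And>\<omega>. \<omega> \<in> space M \<Longrightarrow> continuous_on {0..} (\<lambda>t. Z t \<omega>)"
    and martingale: "\<And>s t X c. 0 \<le> s \<Longrightarrow> s \<le> t \<Longrightarrow> X \<in> borel_measurable (F s) \<Longrightarrow>
      (\<And>\<omega>. \<omega> \<in> space M \<Longrightarrow> X \<omega> \<le> ennreal c) \<Longrightarrow>
      (\<integral>\<^sup>+\<omega>. X \<omega> * ennreal (Z t \<omega>) \<partial>M) = (\<integral>\<^sup>+\<omega>. X \<omega> * ennreal (Z s \<omega>) \<partial>M)"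
    and normalized: "\<And>t. 0 \<le> t \<Longrightarrow> (\<integral>\<^sup>+\<omega>. ennreal (Z t \<omega>) \<partial>M) = 1"
    and adapted_version: "\<And>t. 0 \<le> t \<Longrightarrow> \<exists>Y\<in>borel_measurable (F t). AE \<omega> in M. Y \<omega> = Z t \<omega>"
begin

lemma measurable_F_M: "f \<in> measurable (F t) N \<Longrightarrow> f \<in> measurable M N"
  using measurable_from_subalg[OF subalgebra] .

lemma measurable_F_mono: "s \<le> t \<Longrightarrow> f \<in> measurable (F s) N \<Longrightarrow> f \<in> measurable (F t) N"
  using sets_F_mono[of s t] space_F by (auto simp: measurable_def)

text \<open>Where \<open>Z s\<close> is below \<open>k\<close>, bound the minimum at time
  \<open>t\<close> by \<open>Z t\<close> and use the martingale property; elsewhere bound it by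
  \<open>k\<close>, which is the value at time \<open>s\<close>. The adapted version
  \<open>Y\<close> makes this case distinction known at time \<open>s\<close>.\<close>

lemma truncated_supermartingale:
  assumes "0 \<le> s" "s \<le> t" and X: "X \<in> borel_measurable (F s)" "\<And>\<omega>. \<omega> \<in> space M \<Longrightarrow> X \<omega> \<le> ennreal c" and "0 \<le> k"
  shows "(\<integral>\<^sup>+\<omega>. X \<omega> * ennreal (min (Z t \<omega>) k) \<partial>M) \<le> (\<integral>\<^sup>+\<omega>. X \<omega> * ennreal (min (Z s \<omega>) k) \<partial>M)"
proof -
  obtain Y where Y: "Y \<in> borel_measurable (F s)" "AE \<omega> in M. Y \<omega> = Z s \<omega>" using adapted_version[OF assms(1)] by auto
  let ?L = "\<lambda>\<omega>. X \<omega> * (if Y \<omega> < k then 1 else 0)" and ?G = "\<lambda>\<omega>. X \<omega> * (if Y \<omega> < k then 0 else ennreal k)"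
  have L: "?L \<in> borel_measurable (F s)" and G: "?G \<in> borel_measurable (F s)" using X(1) Y(1) by measurable
  have sum: "(\<integral>\<^sup>+\<omega>. ?L \<omega> * ennreal (Z u \<omega>) + ?G \<omega> \<partial>M) = (\<integral>\<^sup>+\<omega>. ?L \<omega> * ennreal (Z u \<omega>) \<partial>M) + (\<integral>\<^sup>+\<omega>. ?G \<omega> \<partial>M)"
    if "0 \<le> u" for u
  proof (rule nn_integral_add)
    note [measurable] = measurable_F_M[OF X(1)] measurable_F_M[OF Y(1)] measurable_density[OF that]
    show "(\<lambda>\<omega>. ?L \<omega> * ennreal (Z u \<omega>)) \<in> borel_measurable M" "?G \<in> borel_measurable M" by measurable
  qed
  have "(\<integral>\<^sup>+\<omega>. X \<omega> * ennreal (min (Z t \<omega>) k) \<partial>M) \<le> (\<integral>\<^sup>+\<omega>. ?L \<omega> * ennreal (Z t \<omega>) + ?G \<omega> \<partial>M)"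
    by (intro nn_integral_mono) (auto intro!: mult_left_mono ennreal_leI)
  also have "\<dots> = (\<integral>\<^sup>+\<omega>. ?L \<omega> * ennreal (Z s \<omega>) + ?G \<omega> \<partial>M)"
    using sum assms(1,2) martingale[OF assms(1,2) L, of c] X(2) by simp
  also have "\<dots> = (\<integral>\<^sup>+\<omega>. X \<omega> * ennreal (min (Z s \<omega>) k) \<partial>M)"
    using Y(2) by (intro nn_integral_cong_AE) (auto elim!: eventually_mono simp: min_def)
  finally show ?thesis .
qed

end

subsection \<open>Stochastic exponentials of bounded drifts\<close>

lemma set_integrable_bounded_Icc:
  fixes f :: "real \<Rightarrow> real"
  assumes "set_borel_measurable borel {0..T} f" and "\<And>s. s \<in> {0..T} \<Longrightarrow> \<bar>f s\<bar> \<le> c"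
  shows "set_integrable lborel {0..T} f"
  unfolding set_integrable_def
proof (rule Bochner_Integration.integrable_bound)
  show "integrable lborel (\<lambda>s. c * indicator {0..T} s)"
    by (intro integrable_mult_right) (auto simp: integrable_indicator_iff emeasure_lborel_Icc_eq)
  show "(\<lambda>s. indicator {0..T} s *\<^sub>R f s) \<in> borel_measurable lborel"
    using assms(1) by (simp add: set_borel_measurable_def)
  show "AE s in lborel. norm (indicator {0..T} s *\<^sub>R f s) \<le> norm (c * indicator {0..T} s)"
    using assms(2) by (intro AE_I2) (force simp: indicator_def)
qed

lemma nn_set_integral_bounded_Icc:
  fixes f :: "real \<Rightarrow> real"
  assumes "set_borel_measurable borel {0..T} f" and "\<And>s. s \<in> {0..T} \<Longrightarrow> \<bar>f s\<bar> \<le> c" and "\<And>s. 0 \<le> f s"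
  shows "(\<integral>\<^sup>+s\<in>{0..T}. ennreal (f s) \<partial>lborel) = ennreal (LINT s:{0..T}|lborel. f s)"
proof -
  have "(\<integral>\<^sup>+s\<in>{0..T}. ennreal (f s) \<partial>lborel) = (\<integral>\<^sup>+s. ennreal (indicator {0..T} s *\<^sub>R f s) \<partial>lborel)"
    by (intro nn_integral_cong) (auto simp: indicator_def)
  also have "\<dots> = ennreal (LINT s:{0..T}|lborel. f s)"
    using set_integrable_bounded_Icc[OF assms(1,2)] assms(3) unfolding set_integrable_def set_lebesgue_integral_def
    by (intro nn_integral_eq_integral) (auto simp: mult_nonneg_nonneg)
  finally show ?thesis .
qed

text \<open>With \<open>d = p - x\<close> the difference of squares is at most \<bar>d\<bar> squared
  plus 2 K \<bar>d\<bar>, and 2 \<bar>d\<bar> is at most \<bar>d\<bar> squared over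
  \<open>h\<close>, plus \<open>h\<close>. The free \<open>h\<close> is later chosen to match the
  size of the error.\<close>

lemma square_integral_diff_le:
  fixes p x :: "real \<Rightarrow> real"
  assumes meas: "set_borel_measurable borel {0..T} p" "set_borel_measurable borel {0..T} x"
    and bounds: "\<And>s. s \<in> {0..T} \<Longrightarrow> \<bar>p s\<bar> \<le> K" "\<And>s. s \<in> {0..T} \<Longrightarrow> \<bar>x s\<bar> \<le> K"
    and "0 < h" "0 \<le> K" "0 \<le> T"
  shows "\<bar>(LINT s:{0..T}|lborel. (p s)\<^sup>2) - (LINT s:{0..T}|lborel. (x s)\<^sup>2)\<bar>
    \<le> (1 + K / h) * (LINT s:{0..T}|lborel. (p s - x s)\<^sup>2) + K * h * T"
proof -
  have meas2: "set_borel_measurable borel {0..T} (\<lambda>s. (f s - g s)\<^sup>2)"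
    if "set_borel_measurable borel {0..T} f" "set_borel_measurable borel {0..T} g" for f g :: "real \<Rightarrow> real"
  proof -
    have "(\<lambda>s. indicator {0..T} s *\<^sub>R (f s - g s)\<^sup>2) = (\<lambda>s. (indicator {0..T} s *\<^sub>R f s - indicator {0..T} s *\<^sub>R g s)\<^sup>2)"
      by (auto simp: indicator_def fun_eq_iff)
    then show ?thesis using that unfolding set_borel_measurable_def by simp
  qed
  have b: "(f s)\<^sup>2 \<le> (2 * K)\<^sup>2" if "\<bar>f s\<bar> \<le> 2 * K" for f :: "real \<Rightarrow> real" and s
    using power_mono[OF that, of 2] by simp
  have b1: "\<bar>p s\<bar> \<le> 2 * K" "\<bar>x s\<bar> \<le> 2 * K" "\<bar>p s - x s\<bar> \<le> 2 * K" if "s \<in> {0..T}" for s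
    using bounds[OF that] by auto
  have i: "set_integrable lborel {0..T} (\<lambda>s. (p s)\<^sup>2)" "set_integrable lborel {0..T} (\<lambda>s. (x s)\<^sup>2)"
    "set_integrable lborel {0..T} (\<lambda>s. (p s - x s)\<^sup>2)"
    using meas2[OF meas(1), of "\<lambda>_. 0"] meas2[OF meas(2), of "\<lambda>_. 0"] meas2[OF meas] b1 b
    by (auto intro!: set_integrable_bounded_Icc[where c="(2 * K)\<^sup>2"] simp: set_borel_measurable_def)
  have ic: "set_integrable lborel {0..T} (\<lambda>s. K * h)"
    by (intro set_integrable_bounded_Icc[where c="\<bar>K * h\<bar>"]) (auto simp: set_borel_measurable_def)
  have "\<bar>(LINT s:{0..T}|lborel. (p s)\<^sup>2) - (LINT s:{0..T}|lborel. (x s)\<^sup>2)\<bar> = \<bar>LINT s:{0..T}|lborel. (p s)\<^sup>2 - (x s)\<^sup>2\<bar>"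
    using i by (simp add: set_integral_diff)
  also have "\<dots> \<le> (LINT s:{0..T}|lborel. \<bar>(p s)\<^sup>2 - (x s)\<^sup>2\<bar>)"
    using set_integral_norm_bound[OF set_integral_diff(1)[OF i(1,2)]] by simp
  also have "\<dots> \<le> (LINT s:{0..T}|lborel. (1 + K / h) * (p s - x s)\<^sup>2 + K * h)"
  proof (intro set_integral_mono)
    show "set_integrable lborel {0..T} (\<lambda>s. \<bar>(p s)\<^sup>2 - (x s)\<^sup>2\<bar>)"
      using set_integrable_norm[OF set_integral_diff(1)[OF i(1,2)]] by simp
    show "set_integrable lborel {0..T} (\<lambda>s. (1 + K / h) * (p s - x s)\<^sup>2 + K * h)"
      by (intro set_integral_add set_integrable_mult_right i ic)
    fix s assume s: "s \<in> {0..T}"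
    let ?d = "p s - x s"
    have "(p s)\<^sup>2 - (x s)\<^sup>2 = ?d\<^sup>2 + 2 * x s * ?d" by (simp add: power2_eq_square algebra_simps)
    also have "\<bar>\<dots>\<bar> \<le> ?d\<^sup>2 + 2 * K * \<bar>?d\<bar>"
      using mult_right_mono[OF bounds(2)[OF s], of "2 * \<bar>?d\<bar>"]
      by (intro order.trans[OF abs_triangle_ineq]) (simp add: abs_mult)
    also have "2 * \<bar>?d\<bar> \<le> ?d\<^sup>2 / h + h"
    proof -
      have "0 \<le> (\<bar>?d\<bar> - h)\<^sup>2 / h" using \<open>0 < h\<close> by simp
      also have "\<dots> = ?d\<^sup>2 / h + h - 2 * \<bar>?d\<bar>" using \<open>0 < h\<close> by (simp add: power2_diff field_simps power2_eq_square)
      finally show ?thesis by simp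
    qed
    then have "2 * K * \<bar>?d\<bar> \<le> K * (?d\<^sup>2 / h + h)" using mult_left_mono[OF _ \<open>0 \<le> K\<close>] by fastforce
    finally show "\<bar>(p s)\<^sup>2 - (x s)\<^sup>2\<bar> \<le> (1 + K / h) * (p s - x s)\<^sup>2 + K * h"
      by (simp add: algebra_simps)
  qed
  also have "\<dots> = (1 + K / h) * (LINT s:{0..T}|lborel. (p s - x s)\<^sup>2) + K * h * T"
    using \<open>0 \<le> T\<close> set_integral_add(2)[OF set_integrable_mult_right[OF i(3), of "1 + K / h"] ic]
      set_integral_const[of "{0..T}" lborel "K * h"] by (simp add: mult.commute)
  finally show ?thesis .
qed

text \<open>Clamping time to \<open>[0, T]\<close> turns progressive measurability, which lives on a
  restricted product with \<open>F T\<close>, into measurability on the full product with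
  \<open>M\<close>.\<close>

lemma (in brownian_motion) borel_measurable_progressive:
  assumes "progressive F \<xi>" "0 \<le> T"
  shows "(\<lambda>(s, \<omega>). \<xi> (max 0 (min T s)) \<omega>) \<in> borel_measurable (borel \<Otimes>\<^sub>M M)"
proof -
  have "(\<lambda>s. max 0 (min T s)) \<in> measurable borel (restrict_space borel {0..T})"
    using \<open>0 \<le> T\<close> by (intro measurable_restrict_space2) auto
  then have 1: "(\<lambda>z. (max 0 (min T (fst z)), snd z)) \<in> measurable (borel \<Otimes>\<^sub>M M) (restrict_space borel {0..T} \<Otimes>\<^sub>M F T)"
    using measurable_from_subalg[OF subalgebra_F measurable_ident_sets[OF refl]]
    by (intro measurable_Pair measurable_compose[OF measurable_fst] measurable_compose[OF measurable_snd])
  have 2: "(\<lambda>(s, \<omega>). \<xi> s \<omega>) \<in> borel_measurable (restrict_space borel {0..T} \<Otimes>\<^sub>M F T)"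
    using assms unfolding progressive_def by auto
  show ?thesis
    using measurable_compose[OF 1 2] by (simp only: case_prod_beta' fst_conv snd_conv)
qed

text \<open>The witnesses hidden in \<open>ito_integral\<close> and
  \<open>stochastic_exponential\<close> become parameters, so that the approximating sequence can be
  modified and followed through the limits.\<close>

locale bounded_ito_integral = brownian_motion M F B
  for M :: "'a measure" and F :: "real \<Rightarrow> 'a measure" and B :: "real \<Rightarrow> 'a \<Rightarrow> real" +
  fixes \<xi> I Z :: "real \<Rightarrow> 'a \<Rightarrow> real" and K :: real
    and n :: "nat \<Rightarrow> nat" and \<tau> :: "nat \<Rightarrow> nat \<Rightarrow> real" and \<phi> :: "nat \<Rightarrow> nat \<Rightarrow> 'a \<Rightarrow> real"
  assumes progressive: "progressive F \<xi>"
    and \<xi>_le: "\<And>s \<omega>. 0 \<le> s \<Longrightarrow> \<omega> \<in> space M \<Longrightarrow> \<bar>\<xi> s \<omega>\<bar> \<le> K"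
    and K_nonneg: "0 \<le> K"
    and I_measurable: "\<And>t. 0 \<le> t \<Longrightarrow> I t \<in> borel_measurable M"
    and I_continuous: "\<And>\<omega>. \<omega> \<in> space M \<Longrightarrow> continuous_on {0..} (\<lambda>t. I t \<omega>)"
    and Z_eq: "\<And>t \<omega>. 0 \<le> t \<Longrightarrow> \<omega> \<in> space M \<Longrightarrow> Z t \<omega> = exp (I t \<omega> - (1/2) * (LINT s:{0..t}|lborel. (\<xi> s \<omega>)\<^sup>2))"
    and simple: "\<And>k. simple_integrand M F (n k) (\<tau> k) (\<phi> k)"
    and integrand_lim: "\<And>T. 0 \<le> T \<Longrightarrow> (\<lambda>k. \<integral>\<^sup>+\<omega>. (\<integral>\<^sup>+s\<in>{0..T}.
            ennreal ((simple_process (n k) (\<tau> k) (\<phi> k) s \<omega> - \<xi> s \<omega>)\<^sup>2) \<partial>lborel) \<partial>M) \<longlonglongrightarrow> 0"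
    and integral_lim: "\<And>t. 0 \<le> t \<Longrightarrow> (\<lambda>k. \<integral>\<^sup>+\<omega>.
            ennreal ((elementary_integral B (n k) (\<tau> k) (\<phi> k) t \<omega> - I t \<omega>)\<^sup>2) \<partial>M) \<longlonglongrightarrow> 0"
begin

text \<open>The projection onto \<open>[-K, K]\<close>, where the drift takes its values: it brings
  no approximant farther from the drift and gives all approximants one common bound.\<close>

definition clip :: "real \<Rightarrow> real" where "clip x = max (- K) (min K x)"

abbreviation "S k \<equiv> simple_process (n k) (\<tau> k) (\<phi> k)"
abbreviation "\<psi> k i \<omega> \<equiv> clip (\<phi> k i \<omega>)"
abbreviation "P k \<equiv> simple_process (n k) (\<tau> k) (\<psi> k)"
abbreviation "J k \<equiv> elementary_integral B (n k) (\<tau> k) (\<psi> k)"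
abbreviation "V t \<omega> \<equiv> LINT s:{0..t}|lborel. (\<xi> s \<omega>)\<^sup>2"
abbreviation "Q k \<equiv> elementary_variation (n k) (\<tau> k) (\<psi> k)"
abbreviation "D k t \<omega> \<equiv> LINT s:{0..t}|lborel. (P k s \<omega> - \<xi> s \<omega>)\<^sup>2"
abbreviation "\<E> k \<equiv> elementary_exponential (n k) (\<tau> k) (\<psi> k)"

lemma borel_measurable_clip [measurable]: "clip \<in> borel_measurable borel"
  unfolding clip_def by measurable

lemma clip: "\<bar>clip x\<bar> \<le> K" "\<bar>clip x\<bar> \<le> 1 * \<bar>x\<bar>" "\<bar>x - clip x\<bar> \<le> 1 * \<bar>x\<bar>" "clip 0 = 0"
  "\<bar>y\<bar> \<le> K \<Longrightarrow> \<bar>clip x - y\<bar> \<le> \<bar>x - y\<bar>" "\<bar>y\<bar> \<le> K \<Longrightarrow> \<bar>x - clip x\<bar> \<le> \<bar>x - y\<bar>"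
  using K_nonneg by (auto simp: clip_def max_def min_def)

lemma simple_clip: "simple_integrand M F (n k) (\<tau> k) (\<psi> k)"
  "simple_integrand M F (n k) (\<tau> k) (\<lambda>i \<omega>. \<phi> k i \<omega> - \<psi> k i \<omega>)"
  using simple_integrand_compose[OF simple, where h=clip, OF _ clip(2)]
    simple_integrand_compose[OF simple, where h="\<lambda>x. x - clip x", OF _ clip(3)] by auto

lemma P_eq: "P k s \<omega> = clip (S k s \<omega>)"
  using simple_process_compose[OF simple, where f=clip] clip(4) by simp

lemma S_minus_P: "simple_process (n k) (\<tau> k) (\<lambda>i \<omega>. \<phi> k i \<omega> - \<psi> k i \<omega>) s \<omega> = S k s \<omega> - P k s \<omega>"
  by (simp add: simple_process_def sum_subtractf left_diff_distrib)

lemma simple_process_measurable: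
  assumes "simple_integrand M F m \<sigma> \<theta>"
  shows "(\<lambda>(s, \<omega>). simple_process m \<sigma> \<theta> s \<omega>) \<in> borel_measurable (borel \<Otimes>\<^sub>M M)"
proof -
  have [measurable]: "i < m \<Longrightarrow> \<theta> i \<in> borel_measurable M" for i
    using measurable_F_M[OF simple_integrandD(3)[OF assms]] .
  show ?thesis unfolding simple_process_def by measurable
qed

lemma D_measurable: assumes "0 \<le> T" shows "D k T \<in> borel_measurable M"
proof -
  note [measurable] = borel_measurable_progressive[OF progressive assms] simple_process_measurable[OF simple_clip(1), of k]
  have "D k T = (\<lambda>\<omega>. \<integral>s. indicator {0..T} s *\<^sub>R (P k s \<omega> - \<xi> (max 0 (min T s)) \<omega>)\<^sup>2 \<partial>lborel)"
    unfolding set_lebesgue_integral_def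
    by (intro ext Bochner_Integration.integral_cong refl) (auto simp: indicator_def)
  also have "\<dots> \<in> borel_measurable M" by measurable
  finally show ?thesis .
qed

lemma V_measurable: assumes "0 \<le> T" shows "V T \<in> borel_measurable M"
proof -
  note [measurable] = borel_measurable_progressive[OF progressive assms]
  have "V T = (\<lambda>\<omega>. \<integral>s. indicator {0..T} s *\<^sub>R (\<xi> (max 0 (min T s)) \<omega>)\<^sup>2 \<partial>lborel)"
    unfolding set_lebesgue_integral_def
    by (intro ext Bochner_Integration.integral_cong refl) (auto simp: indicator_def)
  also have "\<dots> \<in> borel_measurable M" by measurable
  finally show ?thesis .
qed

lemma section_measurable:
  assumes "0 \<le> T" and [simp]: "\<omega> \<in> space M"
  shows "set_borel_measurable borel {0..T} (\<lambda>s. \<xi> s \<omega>)" "set_borel_measurable borel {0..T} (\<lambda>s. P k s \<omega>)"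
    "set_borel_measurable borel {0..T} (\<lambda>s. (P k s \<omega> - \<xi> s \<omega>)\<^sup>2)" "set_borel_measurable borel {0..T} (\<lambda>s. (\<xi> s \<omega>)\<^sup>2)"
proof -
  note [measurable] = borel_measurable_progressive[OF progressive assms(1)] simple_process_measurable[OF simple_clip(1), of k]
  have *: "indicator {0..T} s *\<^sub>R \<xi> s \<omega> = indicator {0..T} s * \<xi> (max 0 (min T s)) \<omega>"
    "indicator {0..T} s *\<^sub>R (P k s \<omega> - \<xi> s \<omega>)\<^sup>2 = indicator {0..T} s * (P k s \<omega> - \<xi> (max 0 (min T s)) \<omega>)\<^sup>2"
    "indicator {0..T} s *\<^sub>R (\<xi> s \<omega>)\<^sup>2 = indicator {0..T} s * (\<xi> (max 0 (min T s)) \<omega>)\<^sup>2" for s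
    by (auto simp: indicator_def)
  have [measurable]: "(\<lambda>s. \<xi> (max 0 (min T s)) \<omega>) \<in> borel_measurable borel"
    using measurable_compose[OF measurable_Pair2'[OF assms(2)] borel_measurable_progressive[OF progressive assms(1)]] by simp
  have [measurable]: "(\<lambda>s. P k s \<omega>) \<in> borel_measurable borel"
    unfolding simple_process_def by measurable
  show "set_borel_measurable borel {0..T} (\<lambda>s. \<xi> s \<omega>)" "set_borel_measurable borel {0..T} (\<lambda>s. P k s \<omega>)"
    "set_borel_measurable borel {0..T} (\<lambda>s. (P k s \<omega> - \<xi> s \<omega>)\<^sup>2)" "set_borel_measurable borel {0..T} (\<lambda>s. (\<xi> s \<omega>)\<^sup>2)"
    unfolding set_borel_measurable_def * by measurable
qed

lemma bounds:
  assumes "0 \<le> s" "\<omega> \<in> space M"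
  shows "\<bar>P k s \<omega>\<bar> \<le> K" "\<bar>\<xi> s \<omega>\<bar> \<le> K" "\<bar>(P k s \<omega> - \<xi> s \<omega>)\<^sup>2\<bar> \<le> (2 * K)\<^sup>2" "\<bar>(\<xi> s \<omega>)\<^sup>2\<bar> \<le> K\<^sup>2"
proof -
  show P: "\<bar>P k s \<omega>\<bar> \<le> K" and x: "\<bar>\<xi> s \<omega>\<bar> \<le> K" using clip(1) \<xi>_le[OF assms] by (auto simp: P_eq)
  have "\<bar>P k s \<omega> - \<xi> s \<omega>\<bar> \<le> 2 * K" using P x by linarith
  from power_mono[OF this, of 2] show "\<bar>(P k s \<omega> - \<xi> s \<omega>)\<^sup>2\<bar> \<le> (2 * K)\<^sup>2" by simp
  from power_mono[OF x, of 2] show "\<bar>(\<xi> s \<omega>)\<^sup>2\<bar> \<le> K\<^sup>2" by simp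
qed

lemma D_nonneg: "0 \<le> D k T \<omega>"
  unfolding set_lebesgue_integral_def by (intro Bochner_Integration.integral_nonneg) auto

lemma D_lim:
  assumes "0 \<le> T"
  shows "(\<lambda>k. \<integral>\<^sup>+\<omega>. ennreal (D k T \<omega>) \<partial>M) \<longlonglongrightarrow> 0"
proof (rule tendsto_sandwich[OF _ _ tendsto_const integrand_lim[OF assms]])
  show "\<forall>\<^sub>F k in sequentially. (\<integral>\<^sup>+\<omega>. ennreal (D k T \<omega>) \<partial>M)
      \<le> (\<integral>\<^sup>+\<omega>. (\<integral>\<^sup>+s\<in>{0..T}. ennreal ((S k s \<omega> - \<xi> s \<omega>)\<^sup>2) \<partial>lborel) \<partial>M)"
  proof (intro always_eventually allI nn_integral_mono)
    fix k \<omega> assume \<omega>: "\<omega> \<in> space M"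
    have "ennreal (D k T \<omega>) = (\<integral>\<^sup>+s\<in>{0..T}. ennreal ((P k s \<omega> - \<xi> s \<omega>)\<^sup>2) \<partial>lborel)"
      using section_measurable(3)[OF assms \<omega>] bounds(3)[OF _ \<omega>]
      by (intro nn_set_integral_bounded_Icc[symmetric]) auto
    also have "\<dots> \<le> (\<integral>\<^sup>+s\<in>{0..T}. ennreal ((S k s \<omega> - \<xi> s \<omega>)\<^sup>2) \<partial>lborel)"
      using power_mono[OF clip(5)[OF \<xi>_le[OF _ \<omega>]], of _ _ 2]
      by (intro nn_integral_mono) (auto simp: indicator_def P_eq intro!: ennreal_leI)
    finally show "ennreal (D k T \<omega>) \<le> (\<integral>\<^sup>+s\<in>{0..T}. ennreal ((S k s \<omega> - \<xi> s \<omega>)\<^sup>2) \<partial>lborel)" .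
  qed
qed auto

text \<open>Clipping removes at most the distance to the drift, so by the isometry the clipped and
  the original elementary integrals differ in L2 by no more than the error of the
  integrands.\<close>

lemma J_lim:
  assumes "0 \<le> T"
  shows "(\<lambda>k. \<integral>\<^sup>+\<omega>. ennreal ((J k T \<omega> - I T \<omega>)\<^sup>2) \<partial>M) \<longlonglongrightarrow> 0"
proof -
  let ?H = "\<lambda>k. elementary_integral B (n k) (\<tau> k) (\<phi> k)"
  let ?a = "\<lambda>k. \<integral>\<^sup>+\<omega>. (\<integral>\<^sup>+s\<in>{0..T}. ennreal ((S k s \<omega> - \<xi> s \<omega>)\<^sup>2) \<partial>lborel) \<partial>M"
  let ?b = "\<lambda>k. \<integral>\<^sup>+\<omega>. ennreal ((?H k T \<omega> - I T \<omega>)\<^sup>2) \<partial>M"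
  note [measurable] = I_measurable[OF assms] measurable_F_M[OF elementary_integral_measurable(1)[OF simple assms]]
    measurable_F_M[OF elementary_integral_measurable(1)[OF simple_clip(1) assms]]
  have diff: "(\<integral>\<^sup>+\<omega>. ennreal ((?H k T \<omega> - J k T \<omega>)\<^sup>2) \<partial>M) \<le> ?a k" for k
  proof -
    have "?H k T \<omega> - J k T \<omega> = elementary_integral B (n k) (\<tau> k) (\<lambda>i \<omega>. \<phi> k i \<omega> - \<psi> k i \<omega>) T \<omega>" for \<omega>
      by (simp add: elementary_integral_def sum_subtractf left_diff_distrib)
    then have "(\<integral>\<^sup>+\<omega>. ennreal ((?H k T \<omega> - J k T \<omega>)\<^sup>2) \<partial>M)
      = (\<integral>\<^sup>+\<omega>. (\<integral>\<^sup>+s\<in>{0..T}. ennreal ((S k s \<omega> - P k s \<omega>)\<^sup>2) \<partial>lborel) \<partial>M)"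
      using Ito_isometry_elementary[OF simple_clip(2) assms, of k] nn_integral_simple_process[OF simple_clip(2) assms, of k]
      by (simp add: S_minus_P)
    also have "\<dots> \<le> ?a k"
      using power_mono[OF clip(6)[OF \<xi>_le], of _ _ _ 2]
      by (intro nn_integral_mono) (auto simp: indicator_def P_eq intro!: ennreal_leI)
    finally show ?thesis .
  qed
  have "(\<lambda>k. 2 * ?a k + 2 * ?b k) \<longlonglongrightarrow> 2 * 0 + 2 * 0"
    by (intro tendsto_add ennreal_tendsto_cmult integrand_lim integral_lim assms) auto
  then have lim: "(\<lambda>k. 2 * ?a k + 2 * ?b k) \<longlonglongrightarrow> 0" by simp
  show ?thesis
  proof (rule tendsto_sandwich[OF _ _ tendsto_const lim])
    show "\<forall>\<^sub>F k in sequentially. (\<integral>\<^sup>+\<omega>. ennreal ((J k T \<omega> - I T \<omega>)\<^sup>2) \<partial>M) \<le> 2 * ?a k + 2 * ?b k"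
    proof (intro always_eventually allI)
      fix k
      have "(\<integral>\<^sup>+\<omega>. ennreal ((J k T \<omega> - I T \<omega>)\<^sup>2) \<partial>M)
        \<le> (\<integral>\<^sup>+\<omega>. 2 * ennreal ((?H k T \<omega> - J k T \<omega>)\<^sup>2) + 2 * ennreal ((?H k T \<omega> - I T \<omega>)\<^sup>2) \<partial>M)"
      proof (intro nn_integral_mono)
        fix \<omega>
        have "(x - z)\<^sup>2 \<le> 2 * (y - x)\<^sup>2 + 2 * (y - z)\<^sup>2" for x y z :: real
          using sum_squares_ge_zero[of "(y - x) + (y - z)" 0] by (simp add: power2_eq_square algebra_simps)
        then have "ennreal ((J k T \<omega> - I T \<omega>)\<^sup>2) \<le> ennreal (2 * (?H k T \<omega> - J k T \<omega>)\<^sup>2 + 2 * (?H k T \<omega> - I T \<omega>)\<^sup>2)"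
          by (intro ennreal_leI) blast
        also have "\<dots> = 2 * ennreal ((?H k T \<omega> - J k T \<omega>)\<^sup>2) + 2 * ennreal ((?H k T \<omega> - I T \<omega>)\<^sup>2)"
          by (subst ennreal_plus) (auto simp: ennreal_mult')
        finally show "ennreal ((J k T \<omega> - I T \<omega>)\<^sup>2) \<le> 2 * ennreal ((?H k T \<omega> - J k T \<omega>)\<^sup>2) + 2 * ennreal ((?H k T \<omega> - I T \<omega>)\<^sup>2)" .
      qed
      also have "\<dots> = 2 * (\<integral>\<^sup>+\<omega>. ennreal ((?H k T \<omega> - J k T \<omega>)\<^sup>2) \<partial>M) + 2 * ?b k"
        by (subst nn_integral_add) (auto simp: nn_integral_cmult)
      also have "\<dots> \<le> 2 * ?a k + 2 * ?b k"
        by (intro add_right_mono mult_left_mono diff) auto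
      finally show "(\<integral>\<^sup>+\<omega>. ennreal ((J k T \<omega> - I T \<omega>)\<^sup>2) \<partial>M) \<le> 2 * ?a k + 2 * ?b k" .
    qed
  qed auto
qed

lemma Q_eq: "0 \<le> t \<Longrightarrow> Q k t \<omega> = (LINT s:{0..t}|lborel. (P k s \<omega>)\<^sup>2)"
  using has_bochner_integral_integral_eq[OF has_bochner_integral_simple_process[OF simple_clip(1), of t k \<omega>]]
  by (simp add: set_lebesgue_integral_def)

lemma Q_tendsto:
  assumes "0 \<le> t" "\<omega> \<in> space M" and D: "(\<lambda>k. D (\<rho> k) t \<omega>) \<longlonglongrightarrow> 0"
  shows "(\<lambda>k. Q (\<rho> k) t \<omega>) \<longlonglongrightarrow> V t \<omega>"
proof (rule LIM_zero_cancel, rule tendsto_sandwich[of "\<lambda>k. - (D (\<rho> k) t \<omega> + K * sqrt (D (\<rho> k) t \<omega>) + K * (sqrt (D (\<rho> k) t \<omega>) + 1 / real (Suc k)) * t)"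
      _ _ "\<lambda>k. D (\<rho> k) t \<omega> + K * sqrt (D (\<rho> k) t \<omega>) + K * (sqrt (D (\<rho> k) t \<omega>) + 1 / real (Suc k)) * t"])
  \<comment> \<open>The parameter of \<open>square_integral_diff_le\<close> is taken as the root of
    the error, which balances its two terms; the summand \<open>1 / real (Suc k)\<close> keeps it
    positive when the error is 0.\<close>
  let ?d = "\<lambda>k. D (\<rho> k) t \<omega>" and ?h = "\<lambda>k. sqrt (D (\<rho> k) t \<omega>) + 1 / real (Suc k)"
  have le: "\<bar>Q (\<rho> k) t \<omega> - V t \<omega>\<bar> \<le> ?d k + K * sqrt (?d k) + K * ?h k * t" for k
  proof -
    have h: "0 < ?h k" using D_nonneg by (intro add_nonneg_pos) auto
    have "?d k / ?h k \<le> sqrt (?d k)"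
    proof -
      have "?d k = sqrt (?d k) * sqrt (?d k)" using D_nonneg by simp
      also have "\<dots> \<le> sqrt (?d k) * ?h k" using D_nonneg by (intro mult_left_mono) auto
      finally show ?thesis using h by (simp add: pos_divide_le_eq)
    qed
    then have "K / ?h k * ?d k \<le> K * sqrt (?d k)" using K_nonneg by (simp add: mult_left_mono flip: times_divide_eq_right)
    moreover have "\<bar>Q (\<rho> k) t \<omega> - V t \<omega>\<bar> \<le> (1 + K / ?h k) * ?d k + K * ?h k * t"
      unfolding Q_eq[OF assms(1)]
      by (intro square_integral_diff_le section_measurable assms K_nonneg h) (use bounds[OF _ assms(2)] in auto)
    ultimately show ?thesis by (simp add: algebra_simps)
  qed
  show "\<forall>\<^sub>F k in sequentially. - (?d k + K * sqrt (?d k) + K * ?h k * t) \<le> Q (\<rho> k) t \<omega> - V t \<omega>"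
    "\<forall>\<^sub>F k in sequentially. Q (\<rho> k) t \<omega> - V t \<omega> \<le> ?d k + K * sqrt (?d k) + K * ?h k * t"
    using abs_le_D2[OF le] abs_le_D1[OF le] by (intro always_eventually allI, simp only: minus_le_iff)+
  have "(\<lambda>k. ?d k + K * sqrt (?d k) + K * ?h k * t) \<longlonglongrightarrow> 0 + K * sqrt 0 + K * (sqrt 0 + 0) * t"
    using D LIMSEQ_inverse_real_of_nat[unfolded inverse_eq_divide] by (intro tendsto_intros) auto
  then show "(\<lambda>k. ?d k + K * sqrt (?d k) + K * ?h k * t) \<longlonglongrightarrow> 0" by simp
  from tendsto_minus[OF this] show "(\<lambda>k. - (?d k + K * sqrt (?d k) + K * ?h k * t)) \<longlonglongrightarrow> 0" by simp
qed

text \<open>A single subsequence must serve both times, so it is extracted for the sum of all four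
  errors.\<close>

lemma exponential_subseq:
  assumes "0 \<le> s" "s \<le> t"
  obtains \<rho> where "strict_mono \<rho>" "AE \<omega> in M. (\<lambda>k. \<E> (\<rho> k) s \<omega>) \<longlonglongrightarrow> Z s \<omega> \<and> (\<lambda>k. \<E> (\<rho> k) t \<omega>) \<longlonglongrightarrow> Z t \<omega>"
proof -
  have t: "0 \<le> t" using assms by simp
  let ?u = "\<lambda>k \<omega>. ((J k s \<omega> - I s \<omega>)\<^sup>2 + (J k t \<omega> - I t \<omega>)\<^sup>2) + (D k s \<omega> + D k t \<omega>)"
  note [measurable] = I_measurable[OF assms(1)] I_measurable[OF t] D_measurable[OF assms(1)] D_measurable[OF t]
    measurable_F_M[OF elementary_integral_measurable(1)[OF simple_clip(1) t]]
    measurable_F_M[OF elementary_integral_measurable(1)[OF simple_clip(1) assms(1)]]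
  have "(\<integral>\<^sup>+\<omega>. ennreal (?u k \<omega>) \<partial>M) = ((\<integral>\<^sup>+\<omega>. ennreal ((J k s \<omega> - I s \<omega>)\<^sup>2) \<partial>M) + (\<integral>\<^sup>+\<omega>. ennreal ((J k t \<omega> - I t \<omega>)\<^sup>2) \<partial>M))
     + ((\<integral>\<^sup>+\<omega>. ennreal (D k s \<omega>) \<partial>M) + (\<integral>\<^sup>+\<omega>. ennreal (D k t \<omega>) \<partial>M))" for k
    using D_nonneg by (simp add: nn_integral_add)
  moreover have "(\<lambda>k. ((\<integral>\<^sup>+\<omega>. ennreal ((J k s \<omega> - I s \<omega>)\<^sup>2) \<partial>M) + (\<integral>\<^sup>+\<omega>. ennreal ((J k t \<omega> - I t \<omega>)\<^sup>2) \<partial>M))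
     + ((\<integral>\<^sup>+\<omega>. ennreal (D k s \<omega>) \<partial>M) + (\<integral>\<^sup>+\<omega>. ennreal (D k t \<omega>) \<partial>M))) \<longlonglongrightarrow> (0 + 0) + (0 + 0)"
    by (intro tendsto_add J_lim D_lim assms t)
  ultimately have lim: "(\<lambda>k. \<integral>\<^sup>+\<omega>. ennreal (?u k \<omega>) \<partial>M) \<longlonglongrightarrow> 0" by simp
  obtain \<rho> where \<rho>: "strict_mono \<rho>" "AE \<omega> in M. (\<lambda>k. ?u (\<rho> k) \<omega>) \<longlonglongrightarrow> 0"
    by (rule nn_integral_tendsto_0_AE_subseq[of ?u, OF _ _ lim]) (auto simp: D_nonneg)
  have "AE \<omega> in M. (\<lambda>k. \<E> (\<rho> k) s \<omega>) \<longlonglongrightarrow> Z s \<omega> \<and> (\<lambda>k. \<E> (\<rho> k) t \<omega>) \<longlonglongrightarrow> Z t \<omega>"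
    using \<rho>(2) AE_space
  proof eventually_elim
    case (elim \<omega>)
    have 0: "f \<longlonglongrightarrow> 0" if "\<And>k. 0 \<le> f k" "\<And>k. f k \<le> ?u (\<rho> k) \<omega>" for f :: "nat \<Rightarrow> real"
      using that by (intro tendsto_sandwich[OF _ _ tendsto_const elim(1)]) auto
    have "(\<lambda>k. \<E> (\<rho> k) v \<omega>) \<longlonglongrightarrow> Z v \<omega>" if v: "v = s \<or> v = t" for v
    proof -
      have "0 \<le> v" using v assms by auto
      have "(\<lambda>k. (J (\<rho> k) v \<omega> - I v \<omega>)\<^sup>2) \<longlonglongrightarrow> 0" "(\<lambda>k. D (\<rho> k) v \<omega>) \<longlonglongrightarrow> 0"
        using v D_nonneg[where T=s and \<omega>=\<omega>] D_nonneg[where T=t and \<omega>=\<omega>] by - (rule 0, auto)+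
      then have "(\<lambda>k. J (\<rho> k) v \<omega>) \<longlonglongrightarrow> I v \<omega>" "(\<lambda>k. Q (\<rho> k) v \<omega>) \<longlonglongrightarrow> V v \<omega>"
        using Q_tendsto[OF \<open>0 \<le> v\<close> elim(2)] by (auto intro: LIM_zero_cancel)
      then show ?thesis unfolding elementary_exponential_def Z_eq[OF \<open>0 \<le> v\<close> elim(2)]
        by (intro tendsto_intros) (auto intro!: tendsto_eq_intros)
    qed
    then show ?case by auto
  qed
  with \<rho>(1) show thesis by (rule that)
qed

section \<open>The limit density is a continuous martingale\<close>

lemma Z_pos: "0 \<le> t \<Longrightarrow> \<omega> \<in> space M \<Longrightarrow> 0 < Z t \<omega>"
  by (simp add: Z_eq)

lemma Z_measurable: "0 \<le> t \<Longrightarrow> Z t \<in> borel_measurable M"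
  using I_measurable V_measurable by (subst measurable_cong[OF Z_eq]) auto

lemma \<E>_measurable: "0 \<le> t \<Longrightarrow> \<E> k t \<in> borel_measurable (F t)" "0 \<le> t \<Longrightarrow> \<E> k t \<in> borel_measurable M"
  using elementary_exponential_measurable[OF simple_clip(1)] measurable_F_M by blast+

lemma \<E>_square_le: "0 \<le> t \<Longrightarrow> (\<integral>\<^sup>+\<omega>. ennreal ((\<E> k t \<omega>)\<^sup>2) \<partial>M) \<le> ennreal (exp (K\<^sup>2 * t))"
  using elementary_exponential_square_le[OF simple_clip(1)] clip(1) by blast

lemma Z_martingale:
  assumes "0 \<le> s" "s \<le> t" and X: "X \<in> borel_measurable (F s)" "\<And>\<omega>. \<omega> \<in> space M \<Longrightarrow> X \<omega> \<le> ennreal c"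
  shows "(\<integral>\<^sup>+\<omega>. X \<omega> * ennreal (Z t \<omega>) \<partial>M) = (\<integral>\<^sup>+\<omega>. X \<omega> * ennreal (Z s \<omega>) \<partial>M)"
proof -
  have t: "0 \<le> t" using assms by simp
  obtain \<rho> where \<rho>: "AE \<omega> in M. (\<lambda>k. \<E> (\<rho> k) s \<omega>) \<longlonglongrightarrow> Z s \<omega> \<and> (\<lambda>k. \<E> (\<rho> k) t \<omega>) \<longlonglongrightarrow> Z t \<omega>"
    using exponential_subseq[OF assms(1,2)] by blast
  have X': "X \<omega> \<le> ennreal (max c 0)" if "\<omega> \<in> space M" for \<omega>
    using X(2)[OF that] by (rule order_trans) (auto intro: ennreal_leI)
  \<comment> \<open>The limit lemma gives only an inequality, but for the approximants the two sides
    are equal; so it may be applied in both directions.\<close>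
  have le: "(\<integral>\<^sup>+\<omega>. X \<omega> * ennreal (Z u \<omega>) \<partial>M) \<le> (\<integral>\<^sup>+\<omega>. X \<omega> * ennreal (Z v \<omega>) \<partial>M)"
    if uv: "u \<in> {s, t}" "v \<in> {s, t}" for u v
  proof (rule nn_integral_limit_le_L2_bounded[OF \<E>_measurable(2) \<E>_measurable(2) Z_measurable measurable_F_M[OF X(1)] _ X'])
    show "AE \<omega> in M. (\<lambda>k. \<E> (\<rho> k) u \<omega>) \<longlonglongrightarrow> Z u \<omega>" "AE \<omega> in M. (\<lambda>k. \<E> (\<rho> k) v \<omega>) \<longlonglongrightarrow> Z v \<omega>"
      using \<rho> uv by auto
    show "(\<integral>\<^sup>+\<omega>. X \<omega> * ennreal (\<E> (\<rho> k) u \<omega>) \<partial>M) \<le> (\<integral>\<^sup>+\<omega>. X \<omega> * ennreal (\<E> (\<rho> k) v \<omega>) \<partial>M)" for k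
      using uv elementary_exponential_martingale[OF simple_clip(1) assms(1,2) X(1), of "\<rho> k"] by auto
    show "(\<integral>\<^sup>+\<omega>. ennreal ((\<E> (\<rho> k) v \<omega>)\<^sup>2) \<partial>M) \<le> ennreal (exp (K\<^sup>2 * v))" for k
      using uv assms(1) t by (intro \<E>_square_le) auto
  qed (use uv assms(1) t in \<open>auto simp: elementary_exponential_def\<close>)
  show ?thesis by (intro antisym le) auto
qed

lemma V_continuous:
  assumes \<omega>: "\<omega> \<in> space M"
  shows "continuous_on {0..} (\<lambda>t. V t \<omega>)"
proof -
  have lip: "\<bar>V t \<omega> - V s \<omega>\<bar> \<le> K\<^sup>2 * \<bar>t - s\<bar>" if "0 \<le> s" "s \<le> t" for s t
  proof -
    have i: "set_integrable lborel {0..t} (\<lambda>s. (\<xi> s \<omega>)\<^sup>2)"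
      using that by (intro set_integrable_bounded_Icc[where c="K\<^sup>2"] section_measurable(4) \<omega> bounds(4)) auto
    have i': "set_integrable lborel {0..s} (\<lambda>s. (\<xi> s \<omega>)\<^sup>2)" "set_integrable lborel {s<..t} (\<lambda>s. (\<xi> s \<omega>)\<^sup>2)"
      using that by (auto intro: set_integrable_subset[OF i])
    have "{0..t} = {0..s} \<union> {s<..t}" using that by auto
    then have "V t \<omega> = V s \<omega> + (LINT s:{s<..t}|lborel. (\<xi> s \<omega>)\<^sup>2)"
      using set_integral_Un[OF _ i'] by (simp add: Int_def)
    moreover have "0 \<le> (LINT s:{s<..t}|lborel. (\<xi> s \<omega>)\<^sup>2)"
      unfolding set_lebesgue_integral_def by (intro Bochner_Integration.integral_nonneg) auto
    moreover have "(LINT s:{s<..t}|lborel. (\<xi> s \<omega>)\<^sup>2) \<le> (LINT s:{s<..t}|lborel. K\<^sup>2)"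
    proof (intro set_integral_mono i')
      show "set_integrable lborel {s<..t} (\<lambda>s. K\<^sup>2)"
        using that by (auto simp: set_integrable_def integrable_indicator_iff)
      show "(\<xi> v \<omega>)\<^sup>2 \<le> K\<^sup>2" if "v \<in> {s<..t}" for v
        using bounds(4)[of v \<omega>] \<omega> that \<open>0 \<le> s\<close> by auto
    qed
    moreover have "(LINT s:{s<..t}|lborel. K\<^sup>2) = K\<^sup>2 * (t - s)"
      using that set_integral_const[of "{s<..t}" lborel "K\<^sup>2"] by simp
    ultimately show ?thesis using that by simp
  qed
  have "(K\<^sup>2)-lipschitz_on {0..} (\<lambda>t. V t \<omega>)"
  proof (rule lipschitz_onI)
    fix s t :: real assume "s \<in> {0..}" "t \<in> {0..}"
    then show "dist (V s \<omega>) (V t \<omega>) \<le> K\<^sup>2 * dist s t"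
      using lip[of s t] lip[of t s] by (cases "s \<le> t") (auto simp: dist_real_def abs_minus_commute)
  qed simp
  then show ?thesis by (rule lipschitz_on_continuous_on)
qed

lemma Z_0: "AE \<omega> in M. Z 0 \<omega> = 1"
proof -
  obtain \<rho> where \<rho>: "AE \<omega> in M. (\<lambda>k. \<E> (\<rho> k) 0 \<omega>) \<longlonglongrightarrow> Z 0 \<omega> \<and> (\<lambda>k. \<E> (\<rho> k) 0 \<omega>) \<longlonglongrightarrow> Z 0 \<omega>"
    using exponential_subseq[of 0 0] by blast
  then show ?thesis
    by eventually_elim (auto simp: elementary_exponential_0[OF simple_clip(1)] LIMSEQ_const_iff)
qed

lemma martingale_density_Z: "martingale_density M F Z"
proof unfold_locales
  fix t :: real assume t: "0 \<le> t"
  show "Z t \<in> borel_measurable M" by (rule Z_measurable[OF t])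
  have "(\<integral>\<^sup>+\<omega>. ennreal (Z t \<omega>) \<partial>M) = (\<integral>\<^sup>+\<omega>. ennreal (Z 0 \<omega>) \<partial>M)"
    using Z_martingale[OF order_refl t, of "\<lambda>_. 1" 1] by simp
  also have "\<dots> = (\<integral>\<^sup>+\<omega>. 1 \<partial>M)" using Z_0 by (intro nn_integral_cong_AE) auto
  finally show "(\<integral>\<^sup>+\<omega>. ennreal (Z t \<omega>) \<partial>M) = 1" by (simp add: emeasure_space_1)
  obtain \<rho> where "AE \<omega> in M. (\<lambda>k. \<E> (\<rho> k) t \<omega>) \<longlonglongrightarrow> Z t \<omega> \<and> (\<lambda>k. \<E> (\<rho> k) t \<omega>) \<longlonglongrightarrow> Z t \<omega>"
    using exponential_subseq[OF t order_refl] by blast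
  then have \<rho>: "AE \<omega> in M. (\<lambda>k. \<E> (\<rho> k) t \<omega>) \<longlonglongrightarrow> Z t \<omega>" by auto
  note [measurable] = \<E>_measurable(1)[OF t]
  show "\<exists>Y\<in>borel_measurable (F t). AE \<omega> in M. Y \<omega> = Z t \<omega>"
  proof (intro bexI)
    \<comment> \<open>The pointwise \<open>lim\<close> of adapted approximants is measurable
      whatever value it takes on the null set where they diverge.\<close>
    show "(\<lambda>\<omega>. lim (\<lambda>k. \<E> (\<rho> k) t \<omega>)) \<in> borel_measurable (F t)" by measurable
    show "AE \<omega> in M. lim (\<lambda>k. \<E> (\<rho> k) t \<omega>) = Z t \<omega>" using \<rho> by eventually_elim (rule limI)
  qed
next
  fix \<omega> assume \<omega>: "\<omega> \<in> space M"
  have "continuous_on {0..} (\<lambda>t. exp (I t \<omega> - (1/2) * V t \<omega>))"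
    by (intro continuous_intros I_continuous V_continuous \<omega>)
  then show "continuous_on {0..} (\<lambda>t. Z t \<omega>)"
    using Z_eq[OF _ \<omega>] by (subst continuous_on_cong[OF refl]) auto
qed (rule subalgebra_F Z_pos Z_martingale | assumption)+

end

lemma (in brownian_motion) martingale_density_stochastic_exponential:
  assumes "drift M F l u \<xi>" "stochastic_exponential M F B \<xi> \<epsilon>"
  shows "martingale_density M F \<epsilon>"
proof -
  obtain I where I: "ito_integral M F B \<xi> I"
    and \<epsilon>: "\<And>t \<omega>. 0 \<le> t \<Longrightarrow> \<omega> \<in> space M \<Longrightarrow> \<epsilon> t \<omega> = exp (I t \<omega> - (1/2) * (LINT s:{0..t}|lborel. (\<xi> s \<omega>)\<^sup>2))"
    using assms(2) unfolding stochastic_exponential_def by auto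
  then obtain n \<tau> \<phi> where approx: "\<And>k. simple_integrand M F (n k) (\<tau> k) (\<phi> k)"
    "\<And>T. 0 \<le> T \<Longrightarrow> (\<lambda>k. \<integral>\<^sup>+\<omega>. (\<integral>\<^sup>+s\<in>{0..T}. ennreal ((simple_process (n k) (\<tau> k) (\<phi> k) s \<omega> - \<xi> s \<omega>)\<^sup>2) \<partial>lborel) \<partial>M) \<longlonglongrightarrow> 0"
    "\<And>t. 0 \<le> t \<Longrightarrow> (\<lambda>k. \<integral>\<^sup>+\<omega>. ennreal ((elementary_integral B (n k) (\<tau> k) (\<phi> k) t \<omega> - I t \<omega>)\<^sup>2) \<partial>M) \<longlonglongrightarrow> 0"
    unfolding ito_integral_def by blast
  \<comment> \<open>A drift in \<open>[l, u]\<close> is bounded in absolute value by the larger of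
    the two end points.\<close>
  interpret bounded_ito_integral M F B \<xi> I \<epsilon> "max \<bar>l\<bar> \<bar>u\<bar>" n \<tau> \<phi>
  proof (unfold_locales, goal_cases)
    case (2 s \<omega>)
    then have "\<xi> s \<omega> \<in> {l..u}" using assms(1) by (auto simp: drift_def)
    then show ?case by auto
  qed (use assms(1) I \<epsilon> approx in \<open>auto simp: drift_def ito_integral_def\<close>)
  show ?thesis by (rule martingale_density_Z)
qed

subsection \<open>Stieltjes integrals along consumption paths\<close>

text \<open>The pathwise part of \<open>consumption_plans\<close>; Stieltjes integrals are studied
  for one such path at a time.\<close>

definition distribution_path :: "(real \<Rightarrow> real) \<Rightarrow> bool" where
  "distribution_path c \<longleftrightarrow> mono c \<and> (\<forall>t. continuous (at_right t) c) \<and> (\<forall>t<0. c t = 0)"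

lemma distribution_pathD:
  assumes "distribution_path c"
  shows "s \<le> t \<Longrightarrow> c s \<le> c t" "continuous (at_right t) c" "t < 0 \<Longrightarrow> c t = 0" "0 \<le> c t"
proof -
  show "s \<le> t \<Longrightarrow> c s \<le> c t" "continuous (at_right t) c" "t < 0 \<Longrightarrow> c t = 0"
    using assms by (auto simp: distribution_path_def mono_def)
  have "c (min t (-1)) \<le> c t" by (rule monoD) (use assms in \<open>auto simp: distribution_path_def\<close>)
  moreover have "min t (-1) < 0" by simp
  then have "c (min t (-1)) = 0" using assms unfolding distribution_path_def by blast
  ultimately show "0 \<le> c t" by simp
qed

lemma consumption_plan_path: "C \<in> consumption_plans M F \<Longrightarrow> \<omega> \<in> space M \<Longrightarrow> distribution_path (\<lambda>t. C t \<omega>)"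
  by (auto simp: consumption_plans_def distribution_path_def)

context
  fixes c :: "real \<Rightarrow> real"
  assumes c: "distribution_path c"
begin

lemma emeasure_path_Ioc: "a \<le> b \<Longrightarrow> emeasure (interval_measure c) {a<..b} = ennreal (c b - c a)"
  using distribution_pathD[OF c] by (intro emeasure_interval_measure_Ioc) auto

lemma AE_path_nonneg: "AE s in interval_measure c. 0 \<le> s"
proof -
  \<comment> \<open>The measure is known on half-open intervals. Those in this cover have both ends
    negative, where the path is 0, so each of them is null.\<close>
  have "{..<0::real} \<subseteq> (\<Union>n. {- real n - 1<..- 1 / real (Suc n)})"
  proof
    fix x :: real assume "x \<in> {..<0}"
    then have x: "x < 0" by simp
    obtain n1 n2 where n: "inverse (real (Suc n1)) < - x" "- x < real n2"
      using reals_Archimedean[of "- x"] reals_Archimedean2[of "- x"] x by auto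
    have "inverse (real (Suc (n1 + n2))) \<le> inverse (real (Suc n1))" by (intro le_imp_inverse_le) auto
    then show "x \<in> (\<Union>n. {- real n - 1<..- 1 / real (Suc n)})"
      using n by (intro UN_I[of "n1 + n2"]) (auto simp: inverse_eq_divide)
  qed
  moreover have "(\<Union>n. {- real n - 1<..- 1 / real (Suc n)}) \<in> null_sets (interval_measure c)"
  proof (intro null_sets_UN' null_setsI)
    fix n :: nat
    have "- real n - 1 \<le> - 1 / real (Suc n)" by (simp add: field_simps)
    then show "emeasure (interval_measure c) {- real n - 1<..- 1 / real (Suc n)} = 0"
      using distribution_pathD(3)[OF c, of "- real n - 1"] distribution_pathD(3)[OF c, of "- 1 / real (Suc n)"]
      by (subst emeasure_path_Ioc) auto
  qed auto
  ultimately show ?thesis by (intro AE_I') (auto simp: not_le)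
qed

lemma emeasure_path_Icc:
  assumes "0 \<le> t"
  shows "emeasure (interval_measure c) {0..t} = ennreal (c t)"
proof -
  \<comment> \<open>Any negative left end would do: the half-open interval then contains the atom at
    0, of mass \<open>c 0\<close>.\<close>
  have "emeasure (interval_measure c) {0..t} = emeasure (interval_measure c) {-1<..t}"
    using AE_path_nonneg by (intro emeasure_eq_AE) (auto elim: eventually_mono)
  also have "\<dots> = ennreal (c t)"
    using assms distribution_pathD(3)[OF c, of "-1"] by (subst emeasure_path_Ioc) auto
  finally show ?thesis .
qed

lemma measure_path:
  "0 \<le> t \<Longrightarrow> measure (interval_measure c) {0..t} = c t"
  "a \<le> b \<Longrightarrow> measure (interval_measure c) {a<..b} = c b - c a"
  using emeasure_path_Icc emeasure_path_Ioc distribution_pathD[OF c] by (auto simp: measure_def)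

lemma set_integrable_path:
  fixes f :: "real \<Rightarrow> real"
  assumes "continuous_on {0..t} f" "0 \<le> t"
  shows "set_integrable (interval_measure c) {0..t} f"
proof -
  obtain b where b: "\<And>s. s \<in> {0..t} \<Longrightarrow> norm (f s) \<le> b"
    using compact_imp_bounded[OF compact_continuous_image[OF assms(1)]] by (force simp: bounded_iff)
  have "integrable (interval_measure c) (\<lambda>s. indicator {0..t} s *\<^sub>R (indicator {0..t} s *\<^sub>R f s))"
  proof (rule integrableI_bounded_set_indicator)
    show "(\<lambda>s. indicator {0..t} s *\<^sub>R f s) \<in> borel_measurable (interval_measure c)"
      using borel_measurable_continuous_on_indicator[OF _ assms(1)] by (simp cong: measurable_cong_sets)
    show "emeasure (interval_measure c) {0..t} < \<infinity>" using emeasure_path_Icc[OF assms(2)] by simp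
    show "AE s in interval_measure c. s \<in> {0..t} \<longrightarrow> norm (indicator {0..t} s *\<^sub>R f s) \<le> b"
      using b by auto
  qed simp
  then show ?thesis by (simp add: set_integrable_def mult.assoc[symmetric] flip: indicator_inter_arith)
qed

lemma nn_set_integral_path:
  fixes f :: "real \<Rightarrow> real"
  assumes "continuous_on {0..t} f" "0 \<le> t" "\<And>s. s \<in> {0..t} \<Longrightarrow> 0 \<le> f s"
  shows "(\<integral>\<^sup>+s\<in>{0..t}. ennreal (f s) \<partial>interval_measure c) = ennreal (LINT s:{0..t}|interval_measure c. f s)"
proof -
  have "(\<integral>\<^sup>+s\<in>{0..t}. ennreal (f s) \<partial>interval_measure c) = (\<integral>\<^sup>+s. ennreal (indicator {0..t} s *\<^sub>R f s) \<partial>interval_measure c)"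
    by (intro nn_integral_cong) (auto simp: indicator_def)
  also have "\<dots> = ennreal (LINT s:{0..t}|interval_measure c. f s)"
    using set_integrable_path[OF assms(1,2)] assms(3) unfolding set_integrable_def set_lebesgue_integral_def
    by (intro nn_integral_eq_integral) (auto simp: indicator_def)
  finally show ?thesis .
qed

lemma set_integral_path_nonneg:
  fixes f :: "real \<Rightarrow> real"
  shows "(\<And>s. s \<in> {0..t} \<Longrightarrow> 0 \<le> f s) \<Longrightarrow> 0 \<le> (LINT s:{0..t}|interval_measure c. f s)"
  unfolding set_lebesgue_integral_def by (intro Bochner_Integration.integral_nonneg) (auto simp: indicator_def)

end

text \<open>The first term is the atom at time 0. The integrand is evaluated at right end points
  because the consumption of a cell is known only there; \<open>Suc n\<close> cells avoid an empty
  grid.\<close>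

definition stieltjes_sum :: "nat \<Rightarrow> real \<Rightarrow> (real \<Rightarrow> real) \<Rightarrow> (real \<Rightarrow> real) \<Rightarrow> real" where
  "stieltjes_sum n t f c = f 0 * c 0 +
    (\<Sum>i<Suc n. f (t * real (Suc i) / real (Suc n)) *
      (c (t * real (Suc i) / real (Suc n)) - c (t * real i / real (Suc n))))"

lemma grid_in_Icc: "0 \<le> (t::real) \<Longrightarrow> i \<le> Suc n \<Longrightarrow> t * real i / real (Suc n) \<in> {0..t}"
  by (auto simp: divide_le_eq intro!: mult_left_mono)

lemma grid_mono: "0 \<le> (t::real) \<Longrightarrow> t * real i / real (Suc n) \<le> t * real (Suc i) / real (Suc n)"
  by (intro divide_right_mono mult_left_mono) auto

lemma stieltjes_sum_mono:
  assumes "distribution_path c" "0 \<le> t" "\<And>s. s \<in> {0..t} \<Longrightarrow> f s \<le> g s"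
  shows "stieltjes_sum n t f c \<le> stieltjes_sum n t g c"
  unfolding stieltjes_sum_def
  using assms(3)[OF grid_in_Icc[OF assms(2)]] assms(2,3) distribution_pathD[OF assms(1)] grid_mono[OF assms(2)]
  by (intro add_mono sum_mono mult_right_mono) (auto simp: less_Suc_eq_le simp del: of_nat_Suc)

lemma stieltjes_sum_const: "stieltjes_sum n t (\<lambda>_. k) c = k * c t"
proof -
  have sum: "(\<Sum>i<Suc n. c (t * real (Suc i) / real (Suc n)) - c (t * real i / real (Suc n))) = c t - c 0"
    using sum_lessThan_telescope[of "\<lambda>i. c (t * real i / real (Suc n))" "Suc n"] by simp
  show ?thesis unfolding stieltjes_sum_def sum_distrib_left[symmetric] sum by (simp add: algebra_simps)
qed

text \<open>Capping a monotone path shrinks each of its increments, and the integrand is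
  nonnegative.\<close>

lemma stieltjes_sum_min_le:
  assumes "distribution_path c" "0 \<le> t" "\<And>s. s \<in> {0..t} \<Longrightarrow> 0 \<le> f s"
  shows "stieltjes_sum n t f (\<lambda>s. min (c s) N) \<le> stieltjes_sum n t f c"
  unfolding stieltjes_sum_def
proof (intro add_mono sum_mono mult_left_mono)
  fix i assume "i \<in> {..<Suc n}"
  then show "0 \<le> f (t * real (Suc i) / real (Suc n))"
    using assms(3)[OF grid_in_Icc[OF assms(2), of "Suc i" n]] by simp
  show "min (c (t * real (Suc i) / real (Suc n))) N - min (c (t * real i / real (Suc n))) N
      \<le> c (t * real (Suc i) / real (Suc n)) - c (t * real i / real (Suc n))"
    using distribution_pathD(1)[OF assms(1) grid_mono[OF assms(2), of i n]] by linarith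
qed (use assms(2,3) in auto)

lemma stieltjes_sum_tendsto:
  fixes f :: "real \<Rightarrow> real"
  assumes c: "distribution_path c" and t: "0 \<le> t" and f: "continuous_on {0..t} f"
  shows "(\<lambda>n. stieltjes_sum n t f c) \<longlonglongrightarrow> (LINT s:{0..t}|interval_measure c. f s)"
proof (rule LIMSEQ_I)
  fix e' :: real assume "0 < e'"
  \<comment> \<open>The total error will be at most \<open>e * c t\<close>; the summand 1 allows
    \<open>c t = 0\<close> and makes the final bound strict.\<close>
  define e where "e = e' / (c t + 1)"
  have ct: "0 \<le> c t" using distribution_pathD(4)[OF c] .
  have e: "0 < e" using \<open>0 < e'\<close> ct by (simp add: e_def)
  let ?\<mu> = "interval_measure c"
  have "uniformly_continuous_on {0..t} f" by (intro compact_uniformly_continuous f) simp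
  then obtain d where d: "0 < d" "\<And>x y. x \<in> {0..t} \<Longrightarrow> y \<in> {0..t} \<Longrightarrow> dist y x < d \<Longrightarrow> dist (f y) (f x) < e"
    using e unfolding uniformly_continuous_on_def by meson
  obtain m where m: "t / d < real m" using reals_Archimedean2 by blast
  have "\<bar>stieltjes_sum n t f c - (LINT s:{0..t}|?\<mu>. f s)\<bar> < e'" if "m \<le> n" for n
  proof -
    define g where "g i = t * real i / real (Suc n)" for i
    have g: "g i \<le> g (Suc i)" "0 \<le> g i" "i \<le> Suc n \<Longrightarrow> g i \<le> t" for i
      using grid_mono[OF t, of i n] grid_in_Icc[OF t, of i n] t unfolding g_def by auto
    have step: "g (Suc i) - g i < d" for i
    proof -
      have "t < d * real m" using m d by (simp add: field_simps)
      also have "\<dots> \<le> d * real (Suc n)" using that d by (intro mult_left_mono) auto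
      finally have "t / real (Suc n) < d" by (simp add: field_simps)
      moreover have "g (Suc i) - g i = t / real (Suc n)" by (simp add: g_def add_divide_distrib distrib_left)
      ultimately show ?thesis by simp
    qed
    \<comment> \<open>The atom at 0 is integrated exactly, and every cell adds an error of at most
      \<open>e\<close> times its mass.\<close>
    have "k \<le> Suc n \<Longrightarrow> \<bar>f 0 * c 0 + (\<Sum>i<k. f (g (Suc i)) * (c (g (Suc i)) - c (g i))) - (LINT s:{0..g k}|?\<mu>. f s)\<bar>
        \<le> e * (c (g k) - c 0)" for k
    proof (induction k)
      case 0
      have "(LINT s:{0..0}|?\<mu>. f s) = (LINT s:{0..0}|?\<mu>. f 0)"
        by (intro set_lebesgue_integral_cong) auto
      also have "\<dots> = f 0 * c 0"
        using emeasure_path_Icc[OF c, of 0] measure_path(1)[OF c, of 0] by (subst set_integral_const) auto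
      finally show ?case by (simp add: g_def)
    next
      case (Suc k)
      have fg: "continuous_on {0..g (Suc k)} f" using g(3)[OF Suc.prems] by (intro continuous_on_subset[OF f]) auto
      have i: "set_integrable ?\<mu> {0..g (Suc k)} f" by (rule set_integrable_path[OF c fg g(2)])
      have i': "set_integrable ?\<mu> {0..g k} f" "set_integrable ?\<mu> {g k<..g (Suc k)} f"
        using g[of k] by (auto intro: set_integrable_subset[OF i])
      have un: "{0..g (Suc k)} = {0..g k} \<union> {g k<..g (Suc k)}" using g[of k] by auto
      have split: "(LINT s:{0..g (Suc k)}|?\<mu>. f s) = (LINT s:{0..g k}|?\<mu>. f s) + (LINT s:{g k<..g (Suc k)}|?\<mu>. f s)"
        unfolding un by (intro set_integral_Un i') auto
      have ic: "set_integrable ?\<mu> {g k<..g (Suc k)} (\<lambda>s. a)" for a :: real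
        using emeasure_path_Ioc[OF c g(1)[of k]] by (auto simp: set_integrable_def integrable_indicator_iff)
      have ci: "(LINT s:{g k<..g (Suc k)}|?\<mu>. a) = a * (c (g (Suc k)) - c (g k))" for a :: real
        using emeasure_path_Ioc[OF c g(1)[of k]] measure_path(2)[OF c g(1)[of k]]
        by (subst set_integral_const) auto
      have "\<bar>f (g (Suc k)) * (c (g (Suc k)) - c (g k)) - (LINT s:{g k<..g (Suc k)}|?\<mu>. f s)\<bar>
        = \<bar>LINT s:{g k<..g (Suc k)}|?\<mu>. f (g (Suc k)) - f s\<bar>"
        using ci[of "f (g (Suc k))"] set_integral_diff(2)[OF ic i'(2)] by simp
      also have "\<dots> \<le> (LINT s:{g k<..g (Suc k)}|?\<mu>. \<bar>f (g (Suc k)) - f s\<bar>)"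
        using set_integral_norm_bound[OF set_integral_diff(1)[OF ic i'(2)]] by simp
      also have "\<dots> \<le> (LINT s:{g k<..g (Suc k)}|?\<mu>. e)"
      proof (intro set_integral_mono ic)
        show "set_integrable ?\<mu> {g k<..g (Suc k)} (\<lambda>s. \<bar>f (g (Suc k)) - f s\<bar>)"
          using set_integrable_norm[OF set_integral_diff(1)[OF ic i'(2)]] by simp
        fix s assume "s \<in> {g k<..g (Suc k)}"
        then have "dist (f (g (Suc k))) (f s) < e"
          using g[of k] g(3)[OF Suc.prems] step[of k] by (intro d(2)) (auto simp: dist_real_def)
        then show "\<bar>f (g (Suc k)) - f s\<bar> \<le> e" by (simp add: dist_real_def)
      qed
      finally have "\<bar>f (g (Suc k)) * (c (g (Suc k)) - c (g k)) - (LINT s:{g k<..g (Suc k)}|?\<mu>. f s)\<bar>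
         \<le> e * (c (g (Suc k)) - c (g k))" by (simp only: ci)
      moreover have "\<bar>f 0 * c 0 + (\<Sum>i<k. f (g (Suc i)) * (c (g (Suc i)) - c (g i))) - (LINT s:{0..g k}|?\<mu>. f s)\<bar>
        \<le> e * (c (g k) - c 0)" using Suc by simp
      ultimately show ?case unfolding split by (simp add: algebra_simps)
    qed
    from this[of "Suc n"] have "\<bar>stieltjes_sum n t f c - (LINT s:{0..t}|?\<mu>. f s)\<bar> \<le> e * (c t - c 0)"
      by (simp add: stieltjes_sum_def g_def)
    also have "\<dots> \<le> e * c t" using e distribution_pathD(4)[OF c, of 0] by (intro mult_left_mono) auto
    also have "\<dots> < e * (c t + 1)" using e by simp
    also have "\<dots> = e'" using ct by (simp add: e_def)
    finally show ?thesis .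
  qed
  then show "\<exists>m. \<forall>n\<ge>m. norm (stieltjes_sum n t f c - (LINT s:{0..t}|?\<mu>. f s)) < e'" by auto
qed

section \<open>Joint measurability of plans and of their Stieltjes integrals\<close>

lemma borel_measurable_right_continuous_process:
  fixes X :: "real \<Rightarrow> 'a \<Rightarrow> real"
  assumes [measurable]: "\<And>t. X t \<in> borel_measurable M"
    and rc: "\<And>\<omega> t. \<omega> \<in> space M \<Longrightarrow> continuous (at_right t) (\<lambda>s. X s \<omega>)"
  shows "(\<lambda>(t, \<omega>). X t \<omega>) \<in> borel_measurable (borel \<Otimes>\<^sub>M M)"
proof (rule borel_measurable_LIMSEQ_real)
  \<comment> \<open>Rounding up to a grid of mesh 1 / (n + 1). The \<open>+ 1\<close> after the
    floor keeps the approximation strictly to the right of \<open>t\<close>, and the countably many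
    grid values make the composite measurable.\<close>
  let ?g = "\<lambda>n t. real_of_int (\<lfloor>real (Suc n) * t\<rfloor> + 1) / real (Suc n)"
  show "(\<lambda>z. X (?g n (fst z)) (snd z)) \<in> borel_measurable (borel \<Otimes>\<^sub>M M)" for n
    by (rule measurable_compose_countable[where f="\<lambda>(i::int) z. X (real_of_int (i + 1) / real (Suc n)) (snd z)"
          and g="\<lambda>z. \<lfloor>real (Suc n) * fst z\<rfloor>"]) measurable
  fix z :: "real \<times> 'a" assume "z \<in> space (borel \<Otimes>\<^sub>M M)"
  then have \<omega>: "snd z \<in> space M" by (auto simp: space_pair_measure)
  let ?t = "fst z"
  have gt: "?t < ?g n ?t" and le: "?g n ?t \<le> ?t + inverse (real (Suc n))" for n
  proof -
    have "real (Suc n) * ?t < real_of_int (\<lfloor>real (Suc n) * ?t\<rfloor> + 1)" "real_of_int (\<lfloor>real (Suc n) * ?t\<rfloor>) \<le> real (Suc n) * ?t"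
      by linarith+
    then show "?t < ?g n ?t" "?g n ?t \<le> ?t + inverse (real (Suc n))"
      by (simp_all add: field_simps del: of_nat_Suc)
  qed
  have "(\<lambda>n. ?g n ?t) \<longlonglongrightarrow> ?t"
  proof (rule tendsto_sandwich[OF _ _ tendsto_const])
    show "(\<lambda>n. ?t + inverse (real (Suc n))) \<longlonglongrightarrow> ?t"
      using tendsto_add[OF tendsto_const LIMSEQ_inverse_real_of_nat, of ?t] by simp
  qed (use gt le in \<open>auto intro!: always_eventually less_imp_le\<close>)
  then have "filterlim (\<lambda>n. ?g n ?t) (at_right ?t) sequentially"
    unfolding filterlim_at using gt less_imp_neq[OF gt, symmetric]
    by (intro conjI always_eventually allI) (simp_all only: greaterThan_iff not_False_eq_True)
  with rc[OF \<omega>, of ?t] have "(\<lambda>n. X (?g n ?t) (snd z)) \<longlonglongrightarrow> X ?t (snd z)"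
    unfolding continuous_within by (rule filterlim_compose)
  then show "(\<lambda>n. X (?g n (fst z)) (snd z)) \<longlonglongrightarrow> (case z of (t, \<omega>) \<Rightarrow> X t \<omega>)"
    by (simp add: case_prod_beta')
qed

lemma borel_measurable_consumption_plan:
  assumes "C \<in> consumption_plans M F" and sub: "\<And>t. subalgebra M (F t)"
  shows "(\<lambda>(t, \<omega>). C t \<omega>) \<in> borel_measurable (borel \<Otimes>\<^sub>M M)" "C t \<in> borel_measurable M"
proof -
  show *: "C t \<in> borel_measurable M" for t
  proof (cases "0 \<le> t")
    case True
    then show ?thesis using assms(1) measurable_from_subalg[OF sub] by (auto simp: consumption_plans_def)
  next
    case False
    then have "\<omega> \<in> space M \<Longrightarrow> C t \<omega> = 0" for \<omega>
      using distribution_pathD(3)[OF consumption_plan_path[OF assms(1)]] by auto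
    then show ?thesis by (simp cong: measurable_cong)
  qed
  show "(\<lambda>(t, \<omega>). C t \<omega>) \<in> borel_measurable (borel \<Otimes>\<^sub>M M)"
    using distribution_pathD(2)[OF consumption_plan_path[OF assms(1)]]
    by (intro borel_measurable_right_continuous_process *) auto
qed

lemma borel_measurable_stieltjes_integral:
  fixes f :: "real \<Rightarrow> 'a \<Rightarrow> real"
  assumes C: "C \<in> consumption_plans M F" and sub: "\<And>t. subalgebra M (F t)"
    and f: "\<And>t. 0 \<le> t \<Longrightarrow> f t \<in> borel_measurable M" "\<And>\<omega>. \<omega> \<in> space M \<Longrightarrow> continuous_on {0..} (\<lambda>s. f s \<omega>)"
  shows "(\<lambda>(t, \<omega>). if 0 \<le> t then LINT s:{0..t}|interval_measure (\<lambda>s. C s \<omega>). f s \<omega> else 0)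
      \<in> borel_measurable (borel \<Otimes>\<^sub>M M)"
    and "(\<lambda>(t, \<omega>). if 0 \<le> t then f t \<omega> else 0) \<in> borel_measurable (borel \<Otimes>\<^sub>M M)"
proof -
  note [measurable] = borel_measurable_consumption_plan[OF C sub]
  \<comment> \<open>Freezing \<open>f\<close> at its initial value extends it continuously to
    negative times, as the right-continuity lemma requires.\<close>
  have max: "(\<lambda>(t, \<omega>). f (max 0 t) \<omega>) \<in> borel_measurable (borel \<Otimes>\<^sub>M M)"
  proof (rule borel_measurable_right_continuous_process)
    fix \<omega> t assume "\<omega> \<in> space M"
    then have "continuous_on UNIV (\<lambda>s. f (max 0 s) \<omega>)"
      by (intro continuous_on_compose2[OF f(2)] continuous_intros) auto
    then show "continuous (at_right t) (\<lambda>s. f (max 0 s) \<omega>)"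
      by (auto simp: continuous_on_eq_continuous_at intro: continuous_at_imp_continuous_within)
  qed (use f(1) in auto)
  note [measurable] = max
  have "(\<lambda>(t, \<omega>). if 0 \<le> t then f (max 0 t) \<omega> else 0) \<in> borel_measurable (borel \<Otimes>\<^sub>M M)" by measurable
  then show "(\<lambda>(t, \<omega>). if 0 \<le> t then f t \<omega> else 0) \<in> borel_measurable (borel \<Otimes>\<^sub>M M)"
    by (rule measurable_cong[THEN iffD1, rotated]) auto
  show "(\<lambda>(t, \<omega>). if 0 \<le> t then LINT s:{0..t}|interval_measure (\<lambda>s. C s \<omega>). f s \<omega> else 0)
      \<in> borel_measurable (borel \<Otimes>\<^sub>M M)"
  proof (rule borel_measurable_LIMSEQ_real)
    show "(\<lambda>(t, \<omega>). if 0 \<le> t then stieltjes_sum n t (\<lambda>s. f (max 0 s) \<omega>) (\<lambda>s. C s \<omega>) else 0) \<in> borel_measurable (borel \<Otimes>\<^sub>M M)" for n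
      unfolding stieltjes_sum_def by measurable
    fix z :: "real \<times> 'a" assume "z \<in> space (borel \<Otimes>\<^sub>M M)"
    then have \<omega>: "snd z \<in> space M" by (auto simp: space_pair_measure)
    have cont: "continuous_on {0..fst z} (\<lambda>s. f (max 0 s) (snd z))"
      by (intro continuous_on_compose2[OF f(2)[OF \<omega>]] continuous_intros) auto
    have "(LINT s:{0..fst z}|interval_measure (\<lambda>s. C s (snd z)). f (max 0 s) (snd z)) = (LINT s:{0..fst z}|interval_measure (\<lambda>s. C s (snd z)). f s (snd z))"
      by (intro set_lebesgue_integral_cong) auto
    then show "(\<lambda>n. case z of (t, \<omega>) \<Rightarrow> if 0 \<le> t then stieltjes_sum n t (\<lambda>s. f (max 0 s) \<omega>) (\<lambda>s. C s \<omega>) else 0)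
       \<longlonglongrightarrow> (case z of (t, \<omega>) \<Rightarrow> if 0 \<le> t then LINT s:{0..t}|interval_measure (\<lambda>s. C s \<omega>). f s \<omega> else 0)"
      using stieltjes_sum_tendsto[OF consumption_plan_path[OF C \<omega>] _ cont] by (auto simp: case_prod_beta')
  qed
qed

subsection \<open>Moving the density inside the Stieltjes integral\<close>

lemma ennreal_sum_mult:
  assumes "\<And>i. i \<in> A \<Longrightarrow> 0 \<le> f i" "\<And>i. i \<in> A \<Longrightarrow> 0 \<le> g i"
  shows "ennreal (\<Sum>i\<in>A. f i * g i) = (\<Sum>i\<in>A. ennreal (f i) * ennreal (g i))"
  using assms by (simp add: sum_ennreal[symmetric] ennreal_mult cong: sum.cong)

text \<open>The mass of cell \<open>i\<close>, with the atom at 0 as cell 0; the Riemann sum becomes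
  one sum over nonnegative weights.\<close>

definition grid_increment :: "nat \<Rightarrow> real \<Rightarrow> (real \<Rightarrow> real) \<Rightarrow> nat \<Rightarrow> real" where
  "grid_increment n t c i = c (t * real i / real (Suc n)) - (if i = 0 then 0 else c (t * real (i - 1) / real (Suc n)))"

lemma stieltjes_sum_grid_increment:
  "stieltjes_sum n t f c = (\<Sum>i\<le>Suc n. f (t * real i / real (Suc n)) * grid_increment n t c i)"
  unfolding stieltjes_sum_def sum.atMost_Suc_shift by (simp add: grid_increment_def lessThan_Suc_atMost)

lemma grid_increment_bounds:
  assumes "distribution_path c" "0 \<le> t"
  shows "0 \<le> grid_increment n t c i" "i \<le> Suc n \<Longrightarrow> grid_increment n t c i \<le> c t"
proof -
  show "0 \<le> grid_increment n t c i"
    using distribution_pathD(1)[OF assms(1) grid_mono[OF assms(2), of "i - 1" n]] distribution_pathD(4)[OF assms(1)]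
    by (cases i) (auto simp: grid_increment_def)
  assume "i \<le> Suc n"
  then have "c (t * real i / real (Suc n)) \<le> c t"
    using grid_in_Icc[OF assms(2), of i n] by (intro distribution_pathD(1)[OF assms(1)]) auto
  then show "grid_increment n t c i \<le> c t"
    using distribution_pathD(4)[OF assms(1)] by (auto simp: grid_increment_def intro: order_trans[rotated] simp: diff_le_eq add_increasing2)
qed

lemma consumption_plan_min:
  assumes C: "C \<in> consumption_plans M F" and N: "0 \<le> N"
  shows "(\<lambda>t \<omega>. min (C t \<omega>) N) \<in> consumption_plans M F"
proof -
  have "continuous (at_right t) (\<lambda>s. min (C s \<omega>) N)" if "\<omega> \<in> space M" for t \<omega>
    using distribution_pathD(2)[OF consumption_plan_path[OF C that], of t]
    unfolding continuous_within by (intro tendsto_min tendsto_const)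
  moreover have "mono (\<lambda>t. min (C t \<omega>) N)" if "\<omega> \<in> space M" for \<omega>
    by (intro monoI min.mono distribution_pathD(1)[OF consumption_plan_path[OF C that]] order_refl)
  ultimately show ?thesis using C N by (auto simp: consumption_plans_def)
qed

context martingale_density
begin

lemma grid_increment_measurable:
  assumes "C \<in> consumption_plans M F" "0 \<le> t"
  shows "(\<lambda>\<omega>. grid_increment n t (\<lambda>s. C s \<omega>) i) \<in> borel_measurable (F (t * real i / real (Suc n)))"
    "(\<lambda>\<omega>. grid_increment n t (\<lambda>s. C s \<omega>) i) \<in> borel_measurable M"
proof -
  have C: "C s \<in> borel_measurable (F u)" if "0 \<le> s" "s \<le> u" for s u
    using assms(1) that measurable_F_mono[OF that(2)] by (auto simp: consumption_plans_def)
  have le: "t * real (i - 1) / real (Suc n) \<le> t * real i / real (Suc n)"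
    using assms(2) by (intro divide_right_mono mult_left_mono) auto
  have pos: "0 \<le> t * real j / real (Suc n)" for j using assms(2) by simp
  show "(\<lambda>\<omega>. grid_increment n t (\<lambda>s. C s \<omega>) i) \<in> borel_measurable (F (t * real i / real (Suc n)))"
  proof (cases "i = 0")
    case True
    then show ?thesis using C[of 0 0] by (simp add: grid_increment_def)
  next
    case False
    then show ?thesis unfolding grid_increment_def
      by (simp only: if_False) (intro borel_measurable_diff C pos le order_refl)
  qed
  from measurable_F_M[OF this] show "(\<lambda>\<omega>. grid_increment n t (\<lambda>s. C s \<omega>) i) \<in> borel_measurable M" .
qed

text \<open>The weight of each cell is known at its right end, so the supermartingale inequality may
  replace the density at \<open>t\<close> by the density there. The bounds \<open>H\<close> and
  \<open>N\<close> make the weights bounded, as that inequality demands.\<close>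

lemma stieltjes_sum_truncated_le:
  assumes C: "C \<in> consumption_plans M F" and t: "0 \<le> t" and h: "\<And>s. s \<in> {0..t} \<Longrightarrow> 0 \<le> h s" and "0 \<le> k"
    and H: "\<And>s. s \<in> {0..t} \<Longrightarrow> h s \<le> H" and N: "\<And>\<omega>. \<omega> \<in> space M \<Longrightarrow> C t \<omega> \<le> N"
  shows "(\<integral>\<^sup>+\<omega>. ennreal (min (Z t \<omega>) k * stieltjes_sum n t h (\<lambda>s. C s \<omega>)) \<partial>M)
    \<le> (\<integral>\<^sup>+\<omega>. ennreal (stieltjes_sum n t (\<lambda>s. h s * min (Z s \<omega>) k) (\<lambda>s. C s \<omega>)) \<partial>M)"
proof -
  let ?v = "\<lambda>i. t * real i / real (Suc n)" let ?A = "\<lambda>i \<omega>. grid_increment n t (\<lambda>s. C s \<omega>) i"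
  let ?X = "\<lambda>i \<omega>. ennreal (h (?v i) * ?A i \<omega>)"
  have v: "?v i \<in> {0..t}" if "i \<le> Suc n" for i by (rule grid_in_Icc[OF t that])
  have A: "0 \<le> ?A i \<omega>" if "\<omega> \<in> space M" for i \<omega> by (rule grid_increment_bounds[OF consumption_plan_path[OF C that] t])
  note [measurable] = grid_increment_measurable[OF C t] measurable_density
  have XF: "?X i \<in> borel_measurable (F (?v i))" for i
    using grid_increment_measurable(1)[OF C t, of n i] by measurable
  have meas: "(\<lambda>\<omega>. ?X i \<omega> * ennreal (min (Z s \<omega>) k)) \<in> borel_measurable M" if "0 \<le> s" for i s
    using that by measurable
  have "(\<integral>\<^sup>+\<omega>. ennreal (min (Z t \<omega>) k * stieltjes_sum n t h (\<lambda>s. C s \<omega>)) \<partial>M) = (\<integral>\<^sup>+\<omega>. (\<Sum>i\<le>Suc n. ?X i \<omega> * ennreal (min (Z t \<omega>) k)) \<partial>M)"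
  proof (intro nn_integral_cong)
    fix \<omega> assume \<omega>: "\<omega> \<in> space M"
    have "min (Z t \<omega>) k * stieltjes_sum n t h (\<lambda>s. C s \<omega>) = (\<Sum>i\<le>Suc n. (h (?v i) * ?A i \<omega>) * min (Z t \<omega>) k)"
      unfolding stieltjes_sum_grid_increment sum_distrib_left by (simp only: mult_ac)
    then show "ennreal (min (Z t \<omega>) k * stieltjes_sum n t h (\<lambda>s. C s \<omega>)) = (\<Sum>i\<le>Suc n. ?X i \<omega> * ennreal (min (Z t \<omega>) k))"
      using h[OF v] A[OF \<omega>] less_imp_le[OF density_pos[OF t \<omega>]] \<open>0 \<le> k\<close>
      by (simp only:) (intro ennreal_sum_mult mult_nonneg_nonneg min.boundedI; simp only: atMost_iff)
  qed
  also have "\<dots> = (\<Sum>i\<le>Suc n. \<integral>\<^sup>+\<omega>. ?X i \<omega> * ennreal (min (Z t \<omega>) k) \<partial>M)"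
    using meas[OF t] by (intro nn_integral_sum) auto
  also have "\<dots> \<le> (\<Sum>i\<le>Suc n. \<integral>\<^sup>+\<omega>. ?X i \<omega> * ennreal (min (Z (?v i) \<omega>) k) \<partial>M)"
  proof (intro sum_mono)
    fix i assume i: "i \<in> {..Suc n}"
    have "?X i \<omega> \<le> ennreal (H * N)" if "\<omega> \<in> space M" for \<omega>
      using grid_increment_bounds[OF consumption_plan_path[OF C that] t, where n=n and i=i] h[OF v] H[OF v] i N[OF that]
      by (intro ennreal_leI mult_mono) (auto intro: order_trans)
    with i show "(\<integral>\<^sup>+\<omega>. ?X i \<omega> * ennreal (min (Z t \<omega>) k) \<partial>M) \<le> (\<integral>\<^sup>+\<omega>. ?X i \<omega> * ennreal (min (Z (?v i) \<omega>) k) \<partial>M)"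
      using v[of i] by (intro truncated_supermartingale[where c="H * N"] XF \<open>0 \<le> k\<close>) auto
  qed
  also have "\<dots> = (\<integral>\<^sup>+\<omega>. (\<Sum>i\<le>Suc n. ?X i \<omega> * ennreal (min (Z (?v i) \<omega>) k)) \<partial>M)"
    using v meas by (intro nn_integral_sum[symmetric]) auto
  also have "\<dots> = (\<integral>\<^sup>+\<omega>. ennreal (stieltjes_sum n t (\<lambda>s. h s * min (Z s \<omega>) k) (\<lambda>s. C s \<omega>)) \<partial>M)"
  proof (intro nn_integral_cong)
    fix \<omega> assume \<omega>: "\<omega> \<in> space M"
    have "stieltjes_sum n t (\<lambda>s. h s * min (Z s \<omega>) k) (\<lambda>s. C s \<omega>) = (\<Sum>i\<le>Suc n. (h (?v i) * ?A i \<omega>) * min (Z (?v i) \<omega>) k)"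
      unfolding stieltjes_sum_grid_increment by (simp only: mult_ac)
    moreover have "0 \<le> Z (?v i) \<omega>" if "i \<le> Suc n" for i using density_pos[OF _ \<omega>, of "?v i"] v[OF that] by auto
    ultimately show "(\<Sum>i\<le>Suc n. ?X i \<omega> * ennreal (min (Z (?v i) \<omega>) k)) = ennreal (stieltjes_sum n t (\<lambda>s. h s * min (Z s \<omega>) k) (\<lambda>s. C s \<omega>))"
      using h[OF v] A[OF \<omega>] \<open>0 \<le> k\<close>
      by (simp only:) (intro ennreal_sum_mult[symmetric] mult_nonneg_nonneg min.boundedI; simp only: atMost_iff)
  qed
  finally show ?thesis .
qed

lemma stieltjes_sum_measurable:
  assumes "C \<in> consumption_plans M F" "0 \<le> t" "\<And>s. 0 \<le> s \<Longrightarrow> f s \<in> borel_measurable M"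
  shows "(\<lambda>\<omega>. stieltjes_sum n t (\<lambda>s. f s \<omega>) (\<lambda>s. C s \<omega>)) \<in> borel_measurable M"
  unfolding stieltjes_sum_grid_increment
  using assms by (intro borel_measurable_sum borel_measurable_times grid_increment_measurable assms) auto

text \<open>Density and plan are both cut at the same level \<open>k\<close>. For fixed
  \<open>k\<close> the Riemann sums pass to the limit, by Fatou on the left and dominated
  convergence on the right. The right side is then bounded by its untruncated form, and Fatou in
  \<open>k\<close> restores the left side.\<close>

lemma weighted_integral_le:
  assumes C: "C \<in> consumption_plans M F" and t: "0 \<le> t"
    and h: "continuous_on {0..t} h" "\<And>s. s \<in> {0..t} \<Longrightarrow> 0 \<le> h s"
  shows "(\<integral>\<^sup>+\<omega>. ennreal (Z t \<omega> * (LINT s:{0..t}|interval_measure (\<lambda>s. C s \<omega>). h s)) \<partial>M)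
    \<le> (\<integral>\<^sup>+\<omega>. ennreal (LINT s:{0..t}|interval_measure (\<lambda>s. C s \<omega>). h s * Z s \<omega>) \<partial>M)"
proof -
  let ?c = "\<lambda>\<omega> s. C s \<omega>" and ?C = "\<lambda>k \<omega> s. min (C s \<omega>) (real k)"
  let ?J = "\<lambda>c f. LINT s:{0..t}|interval_measure c. f s"
  let ?m = "\<lambda>k \<omega> s. h s * min (Z s \<omega>) (real k)"
  let ?R = "stieltjes_sum"
  obtain H where H: "\<And>s. s \<in> {0..t} \<Longrightarrow> h s \<le> H"
    using continuous_attains_sup[OF compact_Icc _ h(1)] t by force
  have H0: "0 \<le> H" using order_trans[OF h(2) H, of 0] t by simp
  have CN: "(\<lambda>t \<omega>. ?C k \<omega> t) \<in> consumption_plans M F" for k by (rule consumption_plan_min[OF C]) simp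
  note path = consumption_plan_path[OF C] and pathN = consumption_plan_path[OF CN]
  have lim: "(\<lambda>n. ?R n t h (?C k \<omega>)) \<longlonglongrightarrow> ?J (?C k \<omega>) h" if "\<omega> \<in> space M" for k \<omega>
    by (rule stieltjes_sum_tendsto[OF pathN[OF that] t h(1)])
  have cont: "continuous_on {0..t} (\<lambda>s. h s * Z s \<omega>)" "continuous_on {0..t} (?m k \<omega>)" if "\<omega> \<in> space M" for k \<omega>
    by (intro continuous_intros h(1) continuous_on_subset[OF continuous_density[OF that]]; auto)+
  have limm: "(\<lambda>n. ?R n t (?m k \<omega>) (?C k \<omega>)) \<longlonglongrightarrow> ?J (?C k \<omega>) (?m k \<omega>)" if "\<omega> \<in> space M" for k \<omega>
    by (rule stieltjes_sum_tendsto[OF pathN[OF that] t cont(2)[OF that]])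
  have [measurable]: "(\<lambda>\<omega>. ?R n t h (?C k \<omega>)) \<in> borel_measurable M" "(\<lambda>\<omega>. ?R n t (?m k \<omega>) (?C k \<omega>)) \<in> borel_measurable M" for n k
    using measurable_density by (auto intro!: stieltjes_sum_measurable[OF CN t])
  have [measurable]: "(\<lambda>\<omega>. ?J (?C k \<omega>) h) \<in> borel_measurable M" "(\<lambda>\<omega>. ?J (?C k \<omega>) (?m k \<omega>)) \<in> borel_measurable M" for k
    by (rule borel_measurable_LIMSEQ_real[OF lim] borel_measurable_LIMSEQ_real[OF limm], assumption, measurable)+
  note [measurable] = measurable_density[OF t]
  have "(\<integral>\<^sup>+\<omega>. ennreal (Z t \<omega> * ?J (?c \<omega>) h) \<partial>M)
    = (\<integral>\<^sup>+\<omega>. liminf (\<lambda>k. ennreal (min (Z t \<omega>) (real k) * ?J (?C k \<omega>) h)) \<partial>M)"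
  proof (intro nn_integral_cong lim_imp_Liminf[symmetric] tendsto_eventually)
    fix \<omega> assume \<omega>: "\<omega> \<in> space M"
    obtain m where m: "max (C t \<omega>) (Z t \<omega>) \<le> real m" using real_arch_simple by blast
    have eq: "?J (?C k \<omega>) h = ?J (?c \<omega>) h" "min (Z t \<omega>) (real k) = Z t \<omega>" if "m \<le> k" for k
    proof -
      have mk: "max (C t \<omega>) (Z t \<omega>) \<le> real k" using m that by (meson of_nat_le_iff order_trans)
      then show "min (Z t \<omega>) (real k) = Z t \<omega>" by simp
      \<comment> \<open>Beyond the larger of \<open>C t \<omega>\<close> and
        \<open>Z t \<omega>\<close> neither cut acts on \<open>[0, t]\<close>. The capped path may
        still differ after \<open>t\<close>, so the two integrals are identified through their
        Riemann sums on \<open>[0, t]\<close>.\<close>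
      have min_eq: "min (C (t * real i / real (Suc n)) \<omega>) (real k) = C (t * real i / real (Suc n)) \<omega>" if "i \<le> Suc n" for i n
      proof -
        have "C (t * real i / real (Suc n)) \<omega> \<le> C t \<omega>"
          using grid_in_Icc[OF t that] by (intro distribution_pathD(1)[OF path[OF \<omega>]]) simp
        then show ?thesis using mk by (intro min_absorb1) linarith
      qed
      have "grid_increment n t (?C k \<omega>) i = grid_increment n t (?c \<omega>) i" if "i \<le> Suc n" for i n
      proof -
        have "i - 1 \<le> Suc n" using that by simp
        show ?thesis unfolding grid_increment_def min_eq[OF that] min_eq[OF \<open>i - 1 \<le> Suc n\<close>] by (rule refl)
      qed
      then have "?R n t h (?C k \<omega>) = ?R n t h (?c \<omega>)" for n
        unfolding stieltjes_sum_grid_increment by (intro sum.cong refl) (simp only: atMost_iff)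
      then show "?J (?C k \<omega>) h = ?J (?c \<omega>) h"
        using LIMSEQ_unique[OF lim[OF \<omega>, of k], of "?J (?c \<omega>) h"] stieltjes_sum_tendsto[OF path[OF \<omega>] t h(1)]
        by (simp only:)
    qed
    show "\<forall>\<^sub>F k in sequentially. ennreal (min (Z t \<omega>) (real k) * ?J (?C k \<omega>) h) = ennreal (Z t \<omega> * ?J (?c \<omega>) h)"
      by (rule eventually_sequentiallyI[of m]) (simp only: eq)
  qed simp
  also have "\<dots> \<le> liminf (\<lambda>k. \<integral>\<^sup>+\<omega>. ennreal (min (Z t \<omega>) (real k) * ?J (?C k \<omega>) h) \<partial>M)"
    by (intro nn_integral_liminf) measurable
  also have "\<dots> \<le> limsup (\<lambda>k. \<integral>\<^sup>+\<omega>. ennreal (min (Z t \<omega>) (real k) * ?J (?C k \<omega>) h) \<partial>M)"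
    by (rule Liminf_le_Limsup) simp
  also have "\<dots> \<le> (\<integral>\<^sup>+\<omega>. ennreal (?J (?c \<omega>) (\<lambda>s. h s * Z s \<omega>)) \<partial>M)"
  proof (intro Limsup_bounded always_eventually allI)
    fix k
    have "(\<integral>\<^sup>+\<omega>. ennreal (min (Z t \<omega>) (real k) * ?J (?C k \<omega>) h) \<partial>M)
      = (\<integral>\<^sup>+\<omega>. liminf (\<lambda>n. ennreal (min (Z t \<omega>) (real k) * ?R n t h (?C k \<omega>))) \<partial>M)"
      by (intro nn_integral_cong lim_imp_Liminf[symmetric] tendsto_ennrealI tendsto_mult tendsto_const lim) auto
    also have "\<dots> \<le> liminf (\<lambda>n. \<integral>\<^sup>+\<omega>. ennreal (min (Z t \<omega>) (real k) * ?R n t h (?C k \<omega>)) \<partial>M)"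
      by (intro nn_integral_liminf) measurable
    also have "\<dots> \<le> liminf (\<lambda>n. \<integral>\<^sup>+\<omega>. ennreal (?R n t (?m k \<omega>) (?C k \<omega>)) \<partial>M)"
      by (intro Liminf_mono always_eventually allI stieltjes_sum_truncated_le[OF CN t h(2) _ H, where N="real k"]) auto
    also have "\<dots> = (\<integral>\<^sup>+\<omega>. ennreal (?J (?C k \<omega>) (?m k \<omega>)) \<partial>M)"
    \<comment> \<open>The dominating constant multiplies the bound \<open>H\<close> of
      \<open>h\<close>, the cut \<open>k\<close> of the density, and the cap \<open>k\<close> on the
      mass of the plan.\<close>
    proof (intro lim_imp_Liminf nn_integral_dominated_convergence[where w="\<lambda>_. ennreal (H * real k * real k)"])
      show "AE \<omega> in M. ennreal (?R n t (?m k \<omega>) (?C k \<omega>)) \<le> ennreal (H * real k * real k)" for n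
      proof (intro AE_I2 ennreal_leI)
        fix \<omega> assume \<omega>: "\<omega> \<in> space M"
        have "?R n t (?m k \<omega>) (?C k \<omega>) \<le> ?R n t (\<lambda>_. H * real k) (?C k \<omega>)"
          using h(2) H H0 less_imp_le[OF density_pos[OF _ \<omega>]]
          by (intro stieltjes_sum_mono[OF pathN[OF \<omega>] t] mult_mono) auto
        also have "\<dots> \<le> H * real k * real k"
          unfolding stieltjes_sum_const using H0 by (intro mult_left_mono) auto
        finally show "?R n t (?m k \<omega>) (?C k \<omega>) \<le> H * real k * real k" .
      qed
    qed (use limm in \<open>auto simp: emeasure_space_1 intro!: AE_I2 tendsto_ennrealI\<close>)
    also have "\<dots> \<le> (\<integral>\<^sup>+\<omega>. ennreal (?J (?c \<omega>) (\<lambda>s. h s * Z s \<omega>)) \<partial>M)"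
    proof (intro nn_integral_mono ennreal_leI)
      fix \<omega> assume \<omega>: "\<omega> \<in> space M"
      have "?R n t (?m k \<omega>) (?C k \<omega>) \<le> ?R n t (\<lambda>s. h s * Z s \<omega>) (?c \<omega>)" for n
      proof (rule order_trans)
        show "?R n t (?m k \<omega>) (?C k \<omega>) \<le> ?R n t (\<lambda>s. h s * Z s \<omega>) (?C k \<omega>)"
          using h(2) by (intro stieltjes_sum_mono[OF pathN[OF \<omega>] t] mult_left_mono) auto
        show "?R n t (\<lambda>s. h s * Z s \<omega>) (?C k \<omega>) \<le> ?R n t (\<lambda>s. h s * Z s \<omega>) (?c \<omega>)"
          by (intro stieltjes_sum_min_le path \<omega> t mult_nonneg_nonneg h(2) less_imp_le[OF density_pos[OF _ \<omega>]]) auto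
      qed
      then show "?J (?C k \<omega>) (?m k \<omega>) \<le> ?J (?c \<omega>) (\<lambda>s. h s * Z s \<omega>)"
        by (intro LIMSEQ_le[OF limm[OF \<omega>] stieltjes_sum_tendsto[OF path[OF \<omega>] t cont(1)[OF \<omega>]]]) auto
    qed
    finally show "(\<integral>\<^sup>+\<omega>. ennreal (min (Z t \<omega>) (real k) * ?J (?C k \<omega>) h) \<partial>M) \<le> (\<integral>\<^sup>+\<omega>. ennreal (?J (?c \<omega>) (\<lambda>s. h s * Z s \<omega>)) \<partial>M)" .
  qed
  finally show ?thesis .
qed

end

text \<open>The part of \<open>satisfaction\<close> produced by consumption, for a single
  path.\<close>

definition service :: "real \<Rightarrow> (real \<Rightarrow> real) \<Rightarrow> real \<Rightarrow> real" where
  "service \<beta> c t = (LINT s:{0..t}|interval_measure c. \<beta> * exp (- \<beta> * (t - s)))"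

text \<open>With the dependence on \<open>t\<close> factored out, the integrand no longer involves
  the upper limit; joint measurability then follows from the general Stieltjes lemma.\<close>

lemma discounted_stieltjes_integral:
  "(LINT s:{0..t}|interval_measure c. \<beta> * exp (- \<beta> * (t - s)) * z s) =
    \<beta> * exp (- \<beta> * t) * (LINT s:{0..t}|interval_measure c. exp (\<beta> * s) * z s)" for z :: "real \<Rightarrow> real"
proof -
  have "\<beta> * exp (- \<beta> * (t - s)) * z s = \<beta> * exp (- \<beta> * t) * (exp (\<beta> * s) * z s)" for s
    by (simp add: exp_diff exp_minus right_diff_distrib field_simps)
  then show ?thesis by (simp only: set_integral_mult_right)
qed

lemma nn_integral_exp_tail:
  fixes \<rho> :: real
  assumes "0 < \<rho>"
  shows "(\<integral>\<^sup>+t. ennreal (exp (- \<rho> * t)) * indicator {s..} t \<partial>lborel) = ennreal (exp (- \<rho> * s) / \<rho>)"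
proof -
  have "(\<integral>\<^sup>+t. ennreal (exp (- \<rho> * t)) * indicator {s..} t \<partial>lborel) = ennreal (0 - (- exp (- \<rho> * s) / \<rho>))"
  proof (rule nn_integral_FTC_atLeast)
    fix x :: real
    show "((\<lambda>x. - exp (- \<rho> * x) / \<rho>) has_real_derivative exp (- \<rho> * x)) (at x)"
      using assms by (auto intro!: derivative_eq_intros)
    have "((\<lambda>x. exp (- (\<rho> * x))) \<longlongrightarrow> 0) at_top"
      using assms by (intro filterlim_compose[OF exp_at_bot] filterlim_uminus_at_bot_at_top[THEN filterlim_compose] filterlim_tendsto_pos_mult_at_top[OF tendsto_const] filterlim_ident)
    then have "((\<lambda>x. - exp (- \<rho> * x) / \<rho>) \<longlongrightarrow> - 0 / \<rho>) at_top"
      using assms by (intro tendsto_intros) auto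
    then show "((\<lambda>x. - exp (- \<rho> * x) / \<rho>) \<longlongrightarrow> 0) at_top" by simp
  qed (use assms in auto)
  then show ?thesis by simp
qed

text \<open>By Tonelli, one unit consumed at \<open>s\<close> yields the service
  \<open>\<beta> * exp (- \<beta> * (t - s))\<close> at all later \<open>t\<close>, whose total
  discounted at rate \<open>q\<close> is
  \<open>\<beta> / (q + \<beta>) * exp (- q * s)\<close>.\<close>

lemma nn_integral_discounted_service:
  assumes c: "distribution_path c" and z: "continuous_on {0..} z" "\<And>s. 0 \<le> s \<Longrightarrow> 0 \<le> z s"
    and "0 \<le> A" "0 < \<beta>" "0 < q + \<beta>"
  shows "(\<integral>\<^sup>+t\<in>{0..}. ennreal (A * exp (- q * t) * (LINT s:{0..t}|interval_measure c. \<beta> * exp (- \<beta> * (t - s)) * z s)) \<partial>lborel)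
    = ennreal (A * \<beta> / (q + \<beta>)) * (\<integral>\<^sup>+s\<in>{0..}. ennreal (z s * exp (- q * s)) \<partial>interval_measure c)"
proof -
  let ?\<mu> = "interval_measure c"
  interpret \<mu>: sigma_finite_measure ?\<mu>
    using distribution_pathD[OF c] by (intro sigma_finite_interval_measure) auto
  interpret pair_sigma_finite ?\<mu> lborel ..
  have zm: "(\<lambda>s. indicator {0..} s * z s) \<in> borel_measurable borel"
    using borel_measurable_continuous_on_indicator[OF _ z(1)] by simp
  let ?f = "\<lambda>s t. ennreal (A * exp (- q * t) * (\<beta> * exp (- \<beta> * (t - s)) * (indicator {0..} s * z s))) * indicator {0..} t * indicator {..t} s"
  have "(\<integral>\<^sup>+t\<in>{0..}. ennreal (A * exp (- q * t) * (LINT s:{0..t}|?\<mu>. \<beta> * exp (- \<beta> * (t - s)) * z s)) \<partial>lborel)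
    = (\<integral>\<^sup>+t. \<integral>\<^sup>+s. ?f s t \<partial>?\<mu> \<partial>lborel)"
  proof (intro nn_integral_cong)
    fix t :: real
    show "ennreal (A * exp (- q * t) * (LINT s:{0..t}|?\<mu>. \<beta> * exp (- \<beta> * (t - s)) * z s)) * indicator {0..} t = (\<integral>\<^sup>+s. ?f s t \<partial>?\<mu>)"
    proof (cases "0 \<le> t")
      case True
      let ?g = "\<lambda>s. A * exp (- q * t) * (\<beta> * exp (- \<beta> * (t - s)) * z s)"
      have cont: "continuous_on {0..t} ?g"
        by (intro continuous_intros continuous_on_subset[OF z(1)]) auto
      have "ennreal (A * exp (- q * t) * (LINT s:{0..t}|?\<mu>. \<beta> * exp (- \<beta> * (t - s)) * z s)) = ennreal (LINT s:{0..t}|?\<mu>. ?g s)"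
        by (simp only: set_integral_mult_right)
      also have "\<dots> = (\<integral>\<^sup>+s\<in>{0..t}. ennreal (?g s) \<partial>?\<mu>)"
        using assms by (intro nn_set_integral_path[OF c cont True, symmetric]) auto
      also have "\<dots> = (\<integral>\<^sup>+s. ?f s t \<partial>?\<mu>)"
        using True by (intro nn_integral_cong) (auto simp: indicator_def)
      finally show ?thesis using True by simp
    qed simp
  qed
  also have "\<dots> = (\<integral>\<^sup>+s. \<integral>\<^sup>+t. ?f s t \<partial>lborel \<partial>?\<mu>)"
  proof (rule Fubini')
    define y where "y s = indicator {0..} s * z s" for s
    have [measurable]: "y \<in> borel_measurable borel" using zm by (simp add: y_def[abs_def])
    have "(\<lambda>(s, t). if 0 \<le> t \<and> s \<le> t then ennreal (A * exp (- q * t) * (\<beta> * exp (- \<beta> * (t - s)) * y s)) else 0)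
        \<in> borel_measurable (?\<mu> \<Otimes>\<^sub>M lborel)" by measurable
    also have "(\<lambda>(s, t). if 0 \<le> t \<and> s \<le> t then ennreal (A * exp (- q * t) * (\<beta> * exp (- \<beta> * (t - s)) * y s)) else 0)
        = (\<lambda>(s, t). ?f s t)" by (auto simp: y_def indicator_def fun_eq_iff)
    finally show "(\<lambda>(s, t). ?f s t) \<in> borel_measurable (?\<mu> \<Otimes>\<^sub>M lborel)" .
  qed
  also have "\<dots> = (\<integral>\<^sup>+s. ennreal (A * \<beta> / (q + \<beta>)) * (ennreal (z s * exp (- q * s)) * indicator {0..} s) \<partial>?\<mu>)"
  proof (rule nn_integral_cong)
    fix s :: real
    show "(\<integral>\<^sup>+t. ?f s t \<partial>lborel) = ennreal (A * \<beta> / (q + \<beta>)) * (ennreal (z s * exp (- q * s)) * indicator {0..} s)"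
    proof (cases "0 \<le> s")
      case True
      have "A * exp (- q * t) * (\<beta> * exp (- \<beta> * (t - s)) * z s) = A * \<beta> * exp (\<beta> * s) * z s * exp (- (q + \<beta>) * t)" for t
      proof -
        have "exp (- q * t) * exp (- \<beta> * (t - s)) = exp (\<beta> * s) * exp (- (q + \<beta>) * t)"
          unfolding exp_add[symmetric] by (simp add: algebra_simps)
        then show ?thesis by (simp only: mult_ac)
      qed
      then have "?f s t = ennreal (A * \<beta> * exp (\<beta> * s) * z s) * (ennreal (exp (- (q + \<beta>) * t)) * indicator {s..} t)" for t
        using True z(2)[OF True] assms by (auto simp: indicator_def ennreal_mult[symmetric])
      then have "(\<integral>\<^sup>+t. ?f s t \<partial>lborel) = ennreal (A * \<beta> * exp (\<beta> * s) * z s) * ennreal (exp (- (q + \<beta>) * s) / (q + \<beta>))"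
        by (simp only: nn_integral_exp_tail[OF \<open>0 < q + \<beta>\<close>, symmetric]) (rule nn_integral_cmult, measurable)
      also have "\<dots> = ennreal (A * \<beta> / (q + \<beta>) * (z s * (exp (\<beta> * s) * exp (- (q + \<beta>) * s))))"
        using z(2)[OF True] assms by (subst ennreal_mult[symmetric]) auto
      also have "exp (\<beta> * s) * exp (- (q + \<beta>) * s) = exp (- q * s)"
        unfolding exp_add[symmetric] by (simp add: algebra_simps)
      also have "ennreal (A * \<beta> / (q + \<beta>) * (z s * exp (- q * s))) = ennreal (A * \<beta> / (q + \<beta>)) * ennreal (z s * exp (- q * s))"
        using assms by (intro ennreal_mult') auto
      finally show ?thesis using True by simp
    qed simp
  qed
  also have "\<dots> = ennreal (A * \<beta> / (q + \<beta>)) * (\<integral>\<^sup>+s\<in>{0..}. ennreal (z s * exp (- q * s)) \<partial>?\<mu>)"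
  proof (rule nn_integral_cmult)
    have "(\<lambda>s. ennreal (z s * exp (- q * s)) * indicator {0..} s) = (\<lambda>s. ennreal (indicator {0..} s * z s * exp (- q * s)))"
      by (auto simp: indicator_def)
    then show "(\<lambda>s. ennreal (z s * exp (- q * s)) * indicator {0..} s) \<in> borel_measurable ?\<mu>"
      using zm by simp
  qed
  finally show ?thesis .
qed

section \<open>The mean discounted service is bounded by the mean discounted cost\<close>

context martingale_density
begin

lemma measurable_density_pair: "(\<lambda>(t, \<omega>). if 0 \<le> t then Z t \<omega> else 0) \<in> borel_measurable (borel \<Otimes>\<^sub>M M)"
proof (rule borel_measurable_stieltjes_integral(2))
  show "(\<lambda>t \<omega>. 0) \<in> consumption_plans M F" by (auto simp: consumption_plans_def mono_def)
qed (use subalgebra measurable_density continuous_density in auto)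

lemma measurable_discounted_service:
  assumes C: "C \<in> consumption_plans M F"
    and f: "\<And>t. 0 \<le> t \<Longrightarrow> f t \<in> borel_measurable M" "\<And>\<omega>. \<omega> \<in> space M \<Longrightarrow> continuous_on {0..} (\<lambda>s. f s \<omega>)"
  shows "(\<lambda>(t, \<omega>). if 0 \<le> t then LINT s:{0..t}|interval_measure (\<lambda>s. C s \<omega>). \<beta> * exp (- \<beta> * (t - s)) * f s \<omega> else 0)
    \<in> borel_measurable (borel \<Otimes>\<^sub>M M)"
proof -
  have [measurable]: "(\<lambda>(t, \<omega>). if 0 \<le> t then LINT s:{0..t}|interval_measure (\<lambda>s. C s \<omega>). exp (\<beta> * s) * f s \<omega> else 0)
    \<in> borel_measurable (borel \<Otimes>\<^sub>M M)"
    using f by (intro borel_measurable_stieltjes_integral(1)[OF C subalgebra] continuous_intros) auto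
  have "(\<lambda>(t, \<omega>). \<beta> * exp (- \<beta> * t) * (if 0 \<le> t then LINT s:{0..t}|interval_measure (\<lambda>s. C s \<omega>). exp (\<beta> * s) * f s \<omega> else 0))
    \<in> borel_measurable (borel \<Otimes>\<^sub>M M)" by measurable
  also have "(\<lambda>(t, \<omega>). \<beta> * exp (- \<beta> * t) * (if 0 \<le> t then LINT s:{0..t}|interval_measure (\<lambda>s. C s \<omega>). exp (\<beta> * s) * f s \<omega> else 0))
    = (\<lambda>(t, \<omega>). if 0 \<le> t then LINT s:{0..t}|interval_measure (\<lambda>s. C s \<omega>). \<beta> * exp (- \<beta> * (t - s)) * f s \<omega> else 0)"
    unfolding discounted_stieltjes_integral by (auto simp: fun_eq_iff)
  finally show ?thesis .
qed

lemma measurable_service: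
  assumes "C \<in> consumption_plans M F"
  shows "(\<lambda>(t, \<omega>). if 0 \<le> t then service \<beta> (\<lambda>s. C s \<omega>) t else 0) \<in> borel_measurable (borel \<Otimes>\<^sub>M M)"
  unfolding service_def
  using measurable_discounted_service[OF assms, where f="\<lambda>_ _. 1" and \<beta>=\<beta>]
  by (simp only: mult_1_right) simp

text \<open>For each fixed \<open>t\<close> the density enters the service integral by
  \<open>weighted_integral_le\<close>. The order of integration is then restored, and the pathwise
  identity is applied with \<open>Z\<close> as the weight \<open>z\<close>.\<close>

lemma nn_integral_service_le:
  assumes C: "C \<in> consumption_plans M F" and "0 \<le> A" "0 < \<beta>" "0 < q + \<beta>"
  shows "(\<integral>\<^sup>+\<omega>. (\<integral>\<^sup>+t\<in>{0..}. ennreal (Z t \<omega> * (A * exp (- q * t) * service \<beta> (\<lambda>s. C s \<omega>) t)) \<partial>lborel) \<partial>M)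
    \<le> ennreal (A * \<beta> / (q + \<beta>)) * (\<integral>\<^sup>+\<omega>. (\<integral>\<^sup>+t\<in>{0..}. ennreal (Z t \<omega> * exp (- q * t)) \<partial>interval_measure (\<lambda>t. C t \<omega>)) \<partial>M)"
proof -
  interpret pair_sigma_finite lborel M ..
  let ?N = "\<lambda>t \<omega>. service \<beta> (\<lambda>s. C s \<omega>) t"
  let ?J = "\<lambda>t \<omega>. LINT s:{0..t}|interval_measure (\<lambda>s. C s \<omega>). \<beta> * exp (- \<beta> * (t - s)) * Z s \<omega>"
  note [measurable] = measurable_density_pair measurable_service[OF C, of \<beta>]
    measurable_discounted_service[OF C measurable_density continuous_density, of \<beta>]
  let ?D = "\<lambda>\<omega>. \<integral>\<^sup>+t\<in>{0..}. ennreal (Z t \<omega> * exp (- q * t)) \<partial>interval_measure (\<lambda>t. C t \<omega>)"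
  have tail: "(\<integral>\<^sup>+t. ennreal (A * exp (- q * t)) * ennreal (if 0 \<le> t then ?J t \<omega> else 0) \<partial>lborel)
      = ennreal (A * \<beta> / (q + \<beta>)) * ?D \<omega>" if \<omega>: "\<omega> \<in> space M" and "0 \<le> A" for A \<omega>
  proof -
    have "(\<integral>\<^sup>+t. ennreal (A * exp (- q * t)) * ennreal (if 0 \<le> t then ?J t \<omega> else 0) \<partial>lborel)
      = (\<integral>\<^sup>+t\<in>{0..}. ennreal (A * exp (- q * t) * ?J t \<omega>) \<partial>lborel)"
      using \<open>0 \<le> A\<close> by (intro nn_integral_cong) (auto simp: indicator_def ennreal_mult'[symmetric])
    also have "\<dots> = ennreal (A * \<beta> / (q + \<beta>)) * ?D \<omega>"
      using less_imp_le[OF density_pos[OF _ \<omega>]] assms \<open>0 \<le> A\<close>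
      by (intro nn_integral_discounted_service consumption_plan_path[OF C] \<omega> continuous_density) auto
    finally show ?thesis .
  qed
  have "(\<integral>\<^sup>+\<omega>. (\<integral>\<^sup>+t\<in>{0..}. ennreal (Z t \<omega> * (A * exp (- q * t) * ?N t \<omega>)) \<partial>lborel) \<partial>M)
    = (\<integral>\<^sup>+\<omega>. \<integral>\<^sup>+t. ennreal ((if 0 \<le> t then Z t \<omega> else 0) * (A * exp (- q * t) * (if 0 \<le> t then ?N t \<omega> else 0))) \<partial>lborel \<partial>M)"
    by (intro nn_integral_cong) (auto simp: indicator_def)
  also have "\<dots> = (\<integral>\<^sup>+t. \<integral>\<^sup>+\<omega>. ennreal ((if 0 \<le> t then Z t \<omega> else 0) * (A * exp (- q * t) * (if 0 \<le> t then ?N t \<omega> else 0))) \<partial>M \<partial>lborel)"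
    by (rule Fubini') measurable
  also have "\<dots> \<le> (\<integral>\<^sup>+t. \<integral>\<^sup>+\<omega>. ennreal (A * exp (- q * t)) * ennreal (if 0 \<le> t then ?J t \<omega> else 0) \<partial>M \<partial>lborel)"
  proof (rule nn_integral_mono)
    fix t :: real
    show "(\<integral>\<^sup>+\<omega>. ennreal ((if 0 \<le> t then Z t \<omega> else 0) * (A * exp (- q * t) * (if 0 \<le> t then ?N t \<omega> else 0))) \<partial>M)
      \<le> (\<integral>\<^sup>+\<omega>. ennreal (A * exp (- q * t)) * ennreal (if 0 \<le> t then ?J t \<omega> else 0) \<partial>M)"
    proof (cases "0 \<le> t")
      case True
      have m: "(\<lambda>\<omega>. ?N t \<omega>) \<in> borel_measurable M" "(\<lambda>\<omega>. ?J t \<omega>) \<in> borel_measurable M"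
        using measurable_compose[OF measurable_Pair1' measurable_service[OF C, of \<beta>], of t]
          measurable_compose[OF measurable_Pair1' measurable_discounted_service[OF C measurable_density continuous_density, of \<beta>], of t] True
        by simp_all
      note [measurable] = m measurable_density[OF True]
      have "(\<integral>\<^sup>+\<omega>. ennreal (Z t \<omega> * (A * exp (- q * t) * ?N t \<omega>)) \<partial>M) = (\<integral>\<^sup>+\<omega>. ennreal (A * exp (- q * t)) * ennreal (Z t \<omega> * ?N t \<omega>) \<partial>M)"
        using \<open>0 \<le> A\<close> by (intro nn_integral_cong) (simp add: ennreal_mult'[symmetric] mult_ac)
      also have "\<dots> = ennreal (A * exp (- q * t)) * (\<integral>\<^sup>+\<omega>. ennreal (Z t \<omega> * ?N t \<omega>) \<partial>M)"
        by (rule nn_integral_cmult) measurable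
      also have "\<dots> \<le> ennreal (A * exp (- q * t)) * (\<integral>\<^sup>+\<omega>. ennreal (?J t \<omega>) \<partial>M)"
        unfolding service_def using \<open>0 < \<beta>\<close>
        by (intro mult_left_mono weighted_integral_le[OF C True]) (auto intro!: continuous_intros)
      also have "\<dots> = (\<integral>\<^sup>+\<omega>. ennreal (A * exp (- q * t)) * ennreal (?J t \<omega>) \<partial>M)"
        by (rule nn_integral_cmult[symmetric]) measurable
      finally show ?thesis using True by simp
    qed simp
  qed
  also have "\<dots> = (\<integral>\<^sup>+\<omega>. \<integral>\<^sup>+t. ennreal (A * exp (- q * t)) * ennreal (if 0 \<le> t then ?J t \<omega> else 0) \<partial>lborel \<partial>M)"
    by (rule Fubini'[symmetric]) measurable
  also have "\<dots> = (\<integral>\<^sup>+\<omega>. ennreal (A * \<beta> / (q + \<beta>)) * ?D \<omega> \<partial>M)"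
    by (intro nn_integral_cong tail \<open>0 \<le> A\<close>)
  also have "\<dots> = ennreal (A * \<beta> / (q + \<beta>)) * (\<integral>\<^sup>+\<omega>. ?D \<omega> \<partial>M)"
  proof (rule nn_integral_cmult)
    \<comment> \<open>The measure in \<open>?D\<close> depends on the scenario, so its measurability
      is not immediate. The choice \<open>A = (q + \<beta>) / \<beta>\<close> turns the factor in
      \<open>tail\<close> into 1 and presents \<open>?D\<close> as an ordinary time
      integral.\<close>
    have "?D \<omega> = (\<integral>\<^sup>+t. ennreal ((q + \<beta>) / \<beta> * exp (- q * t)) * ennreal (if 0 \<le> t then ?J t \<omega> else 0) \<partial>lborel)"
      if "\<omega> \<in> space M" for \<omega>
      using tail[OF that, of "(q + \<beta>) / \<beta>"] assms by simp
    moreover have "(\<lambda>\<omega>. \<integral>\<^sup>+t. ennreal ((q + \<beta>) / \<beta> * exp (- q * t)) * ennreal (if 0 \<le> t then ?J t \<omega> else 0) \<partial>lborel) \<in> borel_measurable M"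
      by measurable
    ultimately show "?D \<in> borel_measurable M" by (simp cong: measurable_cong)
  qed
  finally show ?thesis .
qed

end

subsection \<open>The deterministic problem\<close>

text \<open>Converse of \<open>interval_measure\<close>: a plan may be specified by its measure, and
  integrals against the plan are then integrals against that measure.\<close>

lemma distribution_path_of_measure:
  fixes \<nu> :: "real measure"
  assumes [measurable_cong, simp]: "sets \<nu> = sets borel" and fin: "\<And>t. emeasure \<nu> {..t} < \<infinity>" and zero: "emeasure \<nu> {..<0} = 0"
  shows "distribution_path (\<lambda>t. measure \<nu> {..t})" "interval_measure (\<lambda>t. measure \<nu> {..t}) = \<nu>"
proof -
  let ?c = "\<lambda>t. measure \<nu> {..t}"
  have fm: "{..t} \<in> fmeasurable \<nu>" for t using fin[of t] by (auto intro: fmeasurableI)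
  have mono: "mono ?c" using fm by (intro monoI measure_mono_fmeasurable) auto
  have rc: "continuous (at_right t) ?c" for t
    unfolding continuous_within
  proof (rule tendsto_at_right_sequentially[where b="t + 1"])
    fix f :: "nat \<Rightarrow> real" and x assume f: "decseq f" "f \<longlonglongrightarrow> t"
    then have "(\<lambda>n. measure \<nu> {.. f n}) \<longlonglongrightarrow> measure \<nu> (\<Inter>i. {.. f i})"
      using fin by (intro Lim_measure_decseq) (auto simp: decseq_def less_top)
    also have "(\<Inter>i. {.. f i}) = {.. t}"
      using decseq_ge[OF f] by (auto intro: order_trans LIMSEQ_le_const[OF f(2)])
    finally show "(\<lambda>n. measure \<nu> {.. f n}) \<longlonglongrightarrow> measure \<nu> {.. t}" .
  qed simp
  have "measure \<nu> {..t} = 0" if "t < 0" for t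
  proof -
    have "emeasure \<nu> {..t} \<le> emeasure \<nu> {..<0}" using that by (intro emeasure_mono) auto
    then show ?thesis using zero by (simp add: measure_def)
  qed
  then show path: "distribution_path ?c" using mono rc by (auto simp: distribution_path_def)
  show "interval_measure ?c = \<nu>"
  proof (rule measure_eqI_generator_eq[where \<Omega>=UNIV and E="range (\<lambda>(a, b). {a<..b::real})" and A="\<lambda>i. {- real i<..real i}"])
    show "Int_stable (range (\<lambda>(a, b). {a<..b::real}))"
    proof (rule Int_stableI, safe)
      fix a b a' b' :: real
      have "{a<..b} \<inter> {a'<..b'} = {max a a'<..min b b'}" by auto
      then show "{a<..b} \<inter> {a'<..b'} \<in> range (\<lambda>(a, b). {a<..b})" by (auto intro: image_eqI[where x="(max a a', min b b')"])
    qed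
    show "emeasure (interval_measure ?c) X = emeasure \<nu> X" if ran: "X \<in> range (\<lambda>(a, b). {a<..b::real})" for X
    proof -
      obtain a b where X: "X = {a<..b}" using ran by auto
      show ?thesis
      proof (cases "a \<le> b")
        case True
        have "{a<..b} = {..b} - {..a}" by auto
        then have "measure \<nu> X = measure \<nu> {..b} - measure \<nu> {..a}"
          using True fm by (simp add: X measurable_measure_Diff)
        moreover have "X \<in> fmeasurable \<nu>" unfolding X by (rule fmeasurableI2[OF fm[of b]]) auto
        ultimately show ?thesis using emeasure_path_Ioc[OF path True] by (simp add: X emeasure_eq_measure2)
      qed (simp add: X)
    qed
    show "sets (interval_measure ?c) = sigma_sets UNIV (range (\<lambda>(a, b). {a<..b::real}))"
      by (simp add: borel_sigma_sets_Ioc)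
    show "sets \<nu> = sigma_sets UNIV (range (\<lambda>(a, b). {a<..b::real}))"
      by (simp add: borel_sigma_sets_Ioc)
    show "(\<Union>i. {- real i<..real i}) = UNIV"
    proof (intro equalityI subsetI UNIV_I)
      fix x :: real
      obtain i where "\<bar>x\<bar> < real i" using reals_Archimedean2 by blast
      then show "x \<in> (\<Union>i. {- real i<..real i})" by (intro UN_I[of i]) auto
    qed
    show "emeasure (interval_measure ?c) {- real i<..real i} \<noteq> \<infinity>" for i
      by (subst emeasure_path_Ioc[OF path]) auto
  qed auto
qed

text \<open>An atom of mass \<open>c0\<close> at time 0 plus the density \<open>\<gamma> e\<^sup>-\<^sup>\<theta>\<^sup>x\<close> from time \<open>\<tau>\<close> on; the atom is the image of
  the uniform mass on \<open>[-1, 0)\<close> under \<open>max 0\<close>.\<close>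

lemma exponential_plan_exists:
  fixes c0 \<gamma> \<theta> \<tau> :: real
  assumes "0 \<le> c0" "0 \<le> \<gamma>" "0 \<le> \<tau>"
  obtains c where "distribution_path c"
    "\<And>f. f \<in> borel_measurable borel \<Longrightarrow> (\<integral>\<^sup>+s. f s \<partial>interval_measure c) =
      ennreal c0 * f 0 + (\<integral>\<^sup>+x\<in>{\<tau>..}. ennreal (\<gamma> * exp (- \<theta> * x)) * f x \<partial>lborel)"
proof -
  let ?\<rho> = "\<lambda>x. ennreal c0 * indicator {-1..<0} x + ennreal (\<gamma> * exp (- \<theta> * x)) * indicator {\<tau>..} x"
  define \<nu> where "\<nu> = distr (density lborel ?\<rho>) borel (max (0::real))"
  have sets [measurable_cong, simp]: "sets \<nu> = sets borel" by (simp add: \<nu>_def)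
  have int: "(\<integral>\<^sup>+s. f s \<partial>\<nu>) = ennreal c0 * f 0 + (\<integral>\<^sup>+x\<in>{\<tau>..}. ennreal (\<gamma> * exp (- \<theta> * x)) * f x \<partial>lborel)"
    if [measurable]: "f \<in> borel_measurable borel" for f
  proof -
    have "(\<integral>\<^sup>+s. f s \<partial>\<nu>) = (\<integral>\<^sup>+x. ?\<rho> x * f (max 0 x) \<partial>lborel)"
      unfolding \<nu>_def by (subst nn_integral_distr) (auto simp: nn_integral_density)
    also have "\<dots> = (\<integral>\<^sup>+x. (ennreal c0 * f 0) * indicator {-1..<0} x + ennreal (\<gamma> * exp (- \<theta> * x)) * f x * indicator {\<tau>..} x \<partial>lborel)"
      using \<open>0 \<le> \<tau>\<close> by (intro nn_integral_cong) (auto simp: indicator_def max_def)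
    also have "\<dots> = ennreal c0 * f 0 + (\<integral>\<^sup>+x\<in>{\<tau>..}. ennreal (\<gamma> * exp (- \<theta> * x)) * f x \<partial>lborel)"
      by (subst nn_integral_add) (auto simp: nn_integral_cmult_indicator)
    finally show ?thesis .
  qed
  have em: "emeasure \<nu> A = ennreal c0 * indicator A 0 + (\<integral>\<^sup>+x\<in>{\<tau>..}. ennreal (\<gamma> * exp (- \<theta> * x)) * indicator A x \<partial>lborel)"
    if "A \<in> sets borel" for A
    using int[of "indicator A"] that by simp
  have "emeasure \<nu> {..t} < \<infinity>" for t
  proof -
    have "(\<integral>\<^sup>+x\<in>{\<tau>..}. ennreal (\<gamma> * exp (- \<theta> * x)) * indicator {..t} x \<partial>lborel)
      \<le> (\<integral>\<^sup>+x. ennreal (\<gamma> * exp (\<bar>\<theta>\<bar> * \<bar>t\<bar>)) * indicator {\<tau>..t} x \<partial>lborel)"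
    proof (intro nn_integral_mono)
      fix x :: real
      have "- \<theta> * x \<le> \<bar>\<theta>\<bar> * \<bar>t\<bar>" if "\<tau> \<le> x" "x \<le> t"
      proof -
        have "- \<theta> * x \<le> \<bar>\<theta>\<bar> * \<bar>x\<bar>" using abs_ge_self[of "- \<theta> * x"] by (simp add: abs_mult)
        also have "\<dots> \<le> \<bar>\<theta>\<bar> * \<bar>t\<bar>" using that \<open>0 \<le> \<tau>\<close> by (intro mult_left_mono) auto
        finally show ?thesis .
      qed
      then show "ennreal (\<gamma> * exp (- \<theta> * x)) * indicator {..t} x * indicator {\<tau>..} x \<le> ennreal (\<gamma> * exp (\<bar>\<theta>\<bar> * \<bar>t\<bar>)) * indicator {\<tau>..t} x"
        using \<open>0 \<le> \<gamma>\<close> by (auto simp: indicator_def intro!: ennreal_leI mult_left_mono)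
    qed
    also have "\<dots> < \<infinity>" by (subst nn_integral_cmult_indicator) (auto simp: emeasure_lborel_Icc_eq ennreal_mult_less_top)
    finally show ?thesis by (subst em) (auto simp: indicator_def)
  qed
  moreover have "emeasure \<nu> {..<0} = 0"
  proof -
    have "(\<integral>\<^sup>+x\<in>{\<tau>..}. ennreal (\<gamma> * exp (- \<theta> * x)) * indicator {..<0} x \<partial>lborel) = (\<integral>\<^sup>+(x::real). 0 \<partial>lborel)"
      using \<open>0 \<le> \<tau>\<close> by (intro nn_integral_cong) (auto simp: indicator_def)
    then show ?thesis by (subst em) auto
  qed
  ultimately show thesis
    using that[of "\<lambda>t. measure \<nu> {..t}"] distribution_path_of_measure[OF sets] int by simp
qed

text \<open>Here \<kappa> = \<beta> - \<theta> is the decay that consumption has to make good, and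
  \<open>\<tau>\<close> the time at which the decaying satisfaction meets the curve. The last
  equation says that the plan exhausts the budget.\<close>

lemma optimal_parameters:
  fixes r \<delta> \<beta> \<eta> w \<alpha> :: real
  assumes "r > 0" "\<beta> > 0" "\<eta> > 0" "w > 0" "0 < \<alpha>" "\<alpha> < 1" "\<delta> > \<alpha> * r"
  obtains \<kappa> K \<tau> c0 q where "0 \<le> \<kappa>" "0 < K" "0 \<le> \<tau>" "0 \<le> c0" "\<eta> + \<beta> * c0 = K * exp (\<kappa> * \<tau>)" "c0 = 0 \<or> \<tau> = 0"
    "q = \<delta> - (1 - \<alpha>) * (\<beta> - \<kappa>)" "r \<le> q" "\<kappa> = 0 \<or> q = r" "0 < r + \<beta> - \<kappa>"
    "c0 + \<kappa> * K / \<beta> * exp (- (r + \<beta> - \<kappa>) * \<tau>) / (r + \<beta> - \<kappa>) = w"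
proof -
  define \<theta> where "\<theta> = min \<beta> ((\<delta> - r) / (1 - \<alpha>))"
  define \<kappa> where "\<kappa> = \<beta> - \<theta>"
  define q where "q = \<delta> - (1 - \<alpha>) * (\<beta> - \<kappa>)"
  have \<kappa>: "0 \<le> \<kappa>" by (simp add: \<kappa>_def \<theta>_def)
  have "(1 - \<alpha>) * \<theta> \<le> (1 - \<alpha>) * ((\<delta> - r) / (1 - \<alpha>))" using assms by (intro mult_left_mono) (auto simp: \<theta>_def)
  then have q: "r \<le> q" using assms by (simp add: q_def \<kappa>_def)
  have qr: "\<kappa> = 0 \<or> q = r" using assms by (auto simp: q_def \<kappa>_def \<theta>_def min_def)
  have s: "0 < r + \<beta> - \<kappa>"
  proof -
    have "r + (\<delta> - r) / (1 - \<alpha>) = (\<delta> - \<alpha> * r) / (1 - \<alpha>)" using assms by (simp add: field_simps)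
    then have "0 < r + (\<delta> - r) / (1 - \<alpha>)" using assms by simp
    then show ?thesis using assms by (auto simp: \<kappa>_def \<theta>_def min_def)
  qed
  let ?s = "r + \<beta> - \<kappa>"
  \<comment> \<open>The cost of staying on the curve from time 0 with \<open>K = \<eta>\<close>,
    without an initial jump: the threshold between jumping and waiting.\<close>
  define w0 where "w0 = \<kappa> * \<eta> / (\<beta> * ?s)"
  show thesis
  proof (cases "w0 \<le> w")
    case True
    \<comment> \<open>A unit of initial jump raises \<open>K\<close> by \<open>\<beta>\<close>, so
      with the larger flow that follows it costs \<open>1 + \<kappa> / ?s\<close>.\<close>
    define c0 where "c0 = (w - w0) / (1 + \<kappa> / ?s)"
    have pos: "0 < 1 + \<kappa> / ?s" using \<kappa> s by (intro add_pos_nonneg) auto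
    then have c0: "0 \<le> c0" using True by (simp add: c0_def)
    have "c0 + \<kappa> * (\<eta> + \<beta> * c0) / \<beta> / ?s = c0 * (1 + \<kappa> / ?s) + w0"
      using assms by (simp add: w0_def add_divide_distrib distrib_left mult.commute)
    also have "\<dots> = w" using pos by (simp add: c0_def)
    finally show thesis
      using that[of \<kappa> "\<eta> + \<beta> * c0" 0 c0 q] \<kappa> c0 assms q qr s by (simp add: q_def add_pos_nonneg)
  next
    case False
    then have w0: "w < w0" "0 < w0" using assms by auto
    \<comment> \<open>Waiting until \<open>\<tau>\<close> multiplies the cost \<open>w0\<close> by
      \<open>exp (- (\<beta> + r) * \<tau>)\<close>; this is solved for the value
      \<open>w\<close>.\<close>
    define \<tau> where "\<tau> = ln (w0 / w) / (\<beta> + r)"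
    have \<tau>: "0 \<le> \<tau>" using w0 assms by (auto simp: \<tau>_def)
    have "exp (- (\<beta> + r) * \<tau>) = w / w0"
    proof -
      have "(\<beta> + r) * \<tau> = ln (w0 / w)" using assms by (simp add: \<tau>_def)
      then have "exp (- (\<beta> + r) * \<tau>) = inverse (exp (ln (w0 / w)))" by (simp only: mult_minus_left exp_minus)
      then show ?thesis using w0 assms by simp
    qed
    moreover have "exp (- (\<kappa> * \<tau>)) * exp (- ?s * \<tau>) = exp (- (\<beta> + r) * \<tau>)"
      unfolding exp_add[symmetric] by (simp add: algebra_simps)
    ultimately have "\<kappa> * (\<eta> * exp (- (\<kappa> * \<tau>))) / \<beta> * exp (- ?s * \<tau>) / ?s = w0 * (w / w0)"
      by (simp add: w0_def mult.assoc)
    then have "\<kappa> * (\<eta> * exp (- (\<kappa> * \<tau>))) / \<beta> * exp (- ?s * \<tau>) / ?s = w" using w0 by simp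
    then show thesis
      using that[of \<kappa> "\<eta> * exp (- (\<kappa> * \<tau>))" \<tau> 0 q] \<kappa> \<tau> assms q qr s by (simp add: q_def mult.assoc exp_add[symmetric])
  qed
qed

lemma optimal_deterministic_plan:
  fixes r \<delta> \<beta> \<eta> w \<alpha> :: real
  assumes "r > 0" "\<beta> > 0" "\<eta> > 0" "w > 0" "0 < \<alpha>" "\<alpha> < 1" "\<delta> > \<alpha> * r"
  obtains c K \<theta> q where "distribution_path c" "0 < K" "q = \<delta> - (1 - \<alpha>) * \<theta>" "r \<le> q"
    "(\<integral>\<^sup>+s\<in>{0..}. ennreal (exp (- r * s)) \<partial>interval_measure c) = ennreal w"
    "(\<integral>\<^sup>+s\<in>{0..}. ennreal (exp (- q * s)) \<partial>interval_measure c) = ennreal w"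
    "\<And>t. 0 \<le> t \<Longrightarrow> K * exp (- \<theta> * t) \<le> \<eta> * exp (- \<beta> * t) + service \<beta> c t"
    "\<And>t. 0 \<le> t \<Longrightarrow> service \<beta> c t = 0 \<or> \<eta> * exp (- \<beta> * t) + service \<beta> c t = K * exp (- \<theta> * t)"
proof -
  obtain \<kappa> K \<tau> c0 q where par: "0 \<le> \<kappa>" "0 < K" "0 \<le> \<tau>" "0 \<le> c0" "\<eta> + \<beta> * c0 = K * exp (\<kappa> * \<tau>)" "c0 = 0 \<or> \<tau> = 0"
    "q = \<delta> - (1 - \<alpha>) * (\<beta> - \<kappa>)" "r \<le> q" "\<kappa> = 0 \<or> q = r" "0 < r + \<beta> - \<kappa>"
    "c0 + \<kappa> * K / \<beta> * exp (- (r + \<beta> - \<kappa>) * \<tau>) / (r + \<beta> - \<kappa>) = w"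
    by (rule optimal_parameters[OF assms])
  \<comment> \<open>On the curve the decay - \<beta> K plus the inflow \<beta> \<gamma> must equal
    the slope - \<theta> K; this fixes the consumption rate \<gamma>.\<close>
  define \<theta> \<gamma> where "\<theta> = \<beta> - \<kappa>" and "\<gamma> = \<kappa> * K / \<beta>"
  have \<gamma>: "0 \<le> \<gamma>" using par assms by (simp add: \<gamma>_def)
  obtain c where c: "distribution_path c"
    and int: "\<And>f. f \<in> borel_measurable borel \<Longrightarrow> (\<integral>\<^sup>+s. f s \<partial>interval_measure c) =
      ennreal c0 * f 0 + (\<integral>\<^sup>+x\<in>{\<tau>..}. ennreal (\<gamma> * exp (- \<theta> * x)) * f x \<partial>lborel)"
    using exponential_plan_exists[OF par(4) \<gamma> par(3)] by blast
  have cost: "(\<integral>\<^sup>+s\<in>{0..}. ennreal (exp (- r * s)) \<partial>interval_measure c) = ennreal w"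
  proof -
    have "(\<integral>\<^sup>+s\<in>{0..}. ennreal (exp (- r * s)) \<partial>interval_measure c)
      = ennreal c0 + (\<integral>\<^sup>+x\<in>{\<tau>..}. ennreal (\<gamma> * exp (- \<theta> * x)) * (ennreal (exp (- r * x)) * indicator {0..} x) \<partial>lborel)"
      by (subst int) auto
    also have "(\<integral>\<^sup>+x\<in>{\<tau>..}. ennreal (\<gamma> * exp (- \<theta> * x)) * (ennreal (exp (- r * x)) * indicator {0..} x) \<partial>lborel)
      = (\<integral>\<^sup>+x. ennreal \<gamma> * (ennreal (exp (- (r + \<theta>) * x)) * indicator {\<tau>..} x) \<partial>lborel)"
    proof (intro nn_integral_cong)
      fix x :: real
      have "\<gamma> * exp (- \<theta> * x) * exp (- r * x) = \<gamma> * exp (- (r + \<theta>) * x)"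
        unfolding mult.assoc exp_add[symmetric] by (simp add: algebra_simps)
      then show "ennreal (\<gamma> * exp (- \<theta> * x)) * (ennreal (exp (- r * x)) * indicator {0..} x) * indicator {\<tau>..} x
        = ennreal \<gamma> * (ennreal (exp (- (r + \<theta>) * x)) * indicator {\<tau>..} x)"
        using \<gamma> \<open>0 \<le> \<tau>\<close> by (auto simp: indicator_def ennreal_mult[symmetric])
    qed
    also have "\<dots> = ennreal \<gamma> * ennreal (exp (- (r + \<theta>) * \<tau>) / (r + \<theta>))"
    proof -
      have "0 < r + \<theta>" using par(10) by (simp add: \<theta>_def)
      from nn_integral_exp_tail[OF this, of \<tau>] show ?thesis by (subst nn_integral_cmult) simp_all
    qed
    also have "ennreal c0 + \<dots> = ennreal (c0 + \<gamma> * (exp (- (r + \<theta>) * \<tau>) / (r + \<theta>)))"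
      using par \<gamma> by (subst ennreal_mult[symmetric]) (auto simp: \<theta>_def ennreal_plus[symmetric] simp del: ennreal_plus)
    also have "c0 + \<gamma> * (exp (- (r + \<theta>) * \<tau>) / (r + \<theta>)) = w"
      using par(11) by (simp add: \<gamma>_def \<theta>_def add_diff_eq)
    finally show ?thesis .
  qed
  have cost': "(\<integral>\<^sup>+s\<in>{0..}. ennreal (exp (- q * s)) \<partial>interval_measure c) = ennreal w"
  proof (cases "q = r")
    case False
    \<comment> \<open>There is then no flow, only an atom at time 0, whose cost is the same under
      every discount rate.\<close>
    then have "\<kappa> = 0" using par by simp
    then have "\<gamma> = 0" "c0 = w" using par by (auto simp: \<gamma>_def)
    then show ?thesis by (subst int) auto
  qed (use cost in simp)
  have serv: "service \<beta> c t = \<beta> * c0 * exp (- \<beta> * t) + (if \<tau> \<le> t then K * exp (- \<theta> * t) - K * exp (\<kappa> * \<tau>) * exp (- \<beta> * t) else 0)"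
    if t: "0 \<le> t" for t
  proof -
    have cont: "continuous_on {0..t} (\<lambda>s. \<beta> * exp (- \<beta> * (t - s)))" by (intro continuous_intros)
    have mono: "K * exp (\<kappa> * \<tau>) * exp (- \<beta> * t) \<le> K * exp (- \<theta> * t)" if "\<tau> \<le> t"
    proof -
      have "\<kappa> * \<tau> \<le> \<kappa> * t" using that par by (intro mult_left_mono) auto
      then have "exp (\<kappa> * \<tau>) * exp (- \<beta> * t) \<le> exp (- \<theta> * t)"
        unfolding exp_add[symmetric] by (simp add: \<theta>_def algebra_simps)
      then show ?thesis using par by (simp add: mult.assoc)
    qed
    have "ennreal (service \<beta> c t) = (\<integral>\<^sup>+s\<in>{0..t}. ennreal (\<beta> * exp (- \<beta> * (t - s))) \<partial>interval_measure c)"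
      unfolding service_def using assms by (intro nn_set_integral_path[OF c cont t, symmetric]) auto
    also have "\<dots> = ennreal c0 * ennreal (\<beta> * exp (- \<beta> * t))
      + (\<integral>\<^sup>+x\<in>{\<tau>..}. ennreal (\<gamma> * exp (- \<theta> * x)) * (ennreal (\<beta> * exp (- \<beta> * (t - x))) * indicator {0..t} x) \<partial>lborel)"
      using t by (subst int) auto
    also have "(\<integral>\<^sup>+x\<in>{\<tau>..}. ennreal (\<gamma> * exp (- \<theta> * x)) * (ennreal (\<beta> * exp (- \<beta> * (t - x))) * indicator {0..t} x) \<partial>lborel)
      = ennreal (if \<tau> \<le> t then K * exp (- \<theta> * t) - K * exp (\<kappa> * \<tau>) * exp (- \<beta> * t) else 0)"
    proof (cases "\<tau> \<le> t")
      case True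
      have "(\<integral>\<^sup>+x\<in>{\<tau>..}. ennreal (\<gamma> * exp (- \<theta> * x)) * (ennreal (\<beta> * exp (- \<beta> * (t - x))) * indicator {0..t} x) \<partial>lborel)
        = (\<integral>\<^sup>+x. ennreal (K * exp (- \<beta> * t) * (\<kappa> * exp (\<kappa> * x))) * indicator {\<tau>..t} x \<partial>lborel)"
      proof (intro nn_integral_cong)
        fix x :: real
        have "exp (- \<theta> * x) * exp (- \<beta> * (t - x)) = exp (- \<beta> * t) * exp (\<kappa> * x)"
          unfolding exp_add[symmetric] by (simp add: \<theta>_def algebra_simps)
        moreover have "\<gamma> * \<beta> = K * \<kappa>" using assms by (simp add: \<gamma>_def)
        ultimately have "\<gamma> * exp (- \<theta> * x) * (\<beta> * exp (- \<beta> * (t - x))) = K * exp (- \<beta> * t) * (\<kappa> * exp (\<kappa> * x))"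
          by (metis (no_types, lifting) mult.assoc mult.left_commute)
        then show "ennreal (\<gamma> * exp (- \<theta> * x)) * (ennreal (\<beta> * exp (- \<beta> * (t - x))) * indicator {0..t} x) * indicator {\<tau>..} x
          = ennreal (K * exp (- \<beta> * t) * (\<kappa> * exp (\<kappa> * x))) * indicator {\<tau>..t} x"
          using \<gamma> assms \<open>0 \<le> \<tau>\<close> by (auto simp: indicator_def ennreal_mult[symmetric])
      qed
      also have "\<dots> = ennreal (K * exp (- \<beta> * t) * exp (\<kappa> * t) - K * exp (- \<beta> * t) * exp (\<kappa> * \<tau>))"
        using par True by (intro nn_integral_FTC_Icc) (auto intro!: derivative_eq_intros)
      also have "K * exp (- \<beta> * t) * exp (\<kappa> * t) - K * exp (- \<beta> * t) * exp (\<kappa> * \<tau>) = K * exp (- \<theta> * t) - K * exp (\<kappa> * \<tau>) * exp (- \<beta> * t)"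
      proof -
        have "exp (- \<beta> * t) * exp (\<kappa> * t) = exp (- \<theta> * t)"
          unfolding exp_add[symmetric] by (simp add: \<theta>_def algebra_simps)
        then show ?thesis by (simp only: mult.assoc mult.commute[of "exp (\<kappa> * \<tau>)"])
      qed
      finally show ?thesis using True by simp
    next
      case False
      then have "(\<integral>\<^sup>+x\<in>{\<tau>..}. ennreal (\<gamma> * exp (- \<theta> * x)) * (ennreal (\<beta> * exp (- \<beta> * (t - x))) * indicator {0..t} x) \<partial>lborel)
        = (\<integral>\<^sup>+(x::real). 0 \<partial>lborel)" by (intro nn_integral_cong) (auto simp: indicator_def)
      then show ?thesis using False by simp
    qed
    also have "ennreal c0 * ennreal (\<beta> * exp (- \<beta> * t)) + \<dots> = ennreal (\<beta> * c0 * exp (- \<beta> * t) + (if \<tau> \<le> t then K * exp (- \<theta> * t) - K * exp (\<kappa> * \<tau>) * exp (- \<beta> * t) else 0))"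
      using par assms mono by (subst ennreal_plus) (auto simp: ennreal_mult[symmetric] mult_ac)
    finally have eq: "ennreal (service \<beta> c t) = ennreal (\<beta> * c0 * exp (- \<beta> * t) + (if \<tau> \<le> t then K * exp (- \<theta> * t) - K * exp (\<kappa> * \<tau>) * exp (- \<beta> * t) else 0))" .
    have "0 \<le> service \<beta> c t" unfolding service_def using assms by (intro set_integral_path_nonneg[OF c]) auto
    moreover have "0 \<le> \<beta> * c0 * exp (- \<beta> * t) + (if \<tau> \<le> t then K * exp (- \<theta> * t) - K * exp (\<kappa> * \<tau>) * exp (- \<beta> * t) else 0)"
      using par assms mono by (auto intro!: add_nonneg_nonneg mult_nonneg_nonneg)
    ultimately show ?thesis using eq by (subst (asm) ennreal_inj)
  qed
  have level: "\<eta> * exp (- \<beta> * t) + \<beta> * c0 * exp (- \<beta> * t) = K * exp (\<kappa> * \<tau>) * exp (- \<beta> * t)" for t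
    using par(5) by (simp add: distrib_right[symmetric])
  have eq: "\<eta> * exp (- \<beta> * t) + service \<beta> c t = K * exp (- \<theta> * t)" if "0 \<le> t" "\<tau> \<le> t" for t
    using serv[OF that(1)] that(2) level[of t] by simp
  have ge: "K * exp (- \<theta> * t) \<le> \<eta> * exp (- \<beta> * t) + service \<beta> c t" if "0 \<le> t" for t
  proof (cases "\<tau> \<le> t")
    case False
    \<comment> \<open>Before \<open>\<tau>\<close> satisfaction decays at rate \<beta>, at least as
      fast as the curve that it meets at \<open>\<tau>\<close>; so it lies on or above the curve
      until then.\<close>
    then have "\<kappa> * t \<le> \<kappa> * \<tau>" using par by (intro mult_left_mono) auto
    then have "exp (- \<theta> * t) \<le> exp (\<kappa> * \<tau>) * exp (- \<beta> * t)"
      unfolding exp_add[symmetric] by (simp add: \<theta>_def algebra_simps)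
    then show ?thesis using serv[OF that] False level[of t] par(2) by (simp add: mult.assoc)
  qed (use eq that in simp)
  show thesis
  proof (rule that[OF c par(2) _ par(8) cost cost' ge])
    show "q = \<delta> - (1 - \<alpha>) * \<theta>" using par(7) by (simp add: \<theta>_def)
    \<comment> \<open>For \<open>t < \<tau>\<close> the meeting time is positive, so there is no
      initial jump and nothing has been consumed yet.\<close>
    show "service \<beta> c t = 0 \<or> \<eta> * exp (- \<beta> * t) + service \<beta> c t = K * exp (- \<theta> * t)" if "0 \<le> t" for t
      using eq[OF that] serv[OF that] par(3,6) that by (cases "\<tau> \<le> t") auto
  qed
qed

subsection \<open>Verification\<close>

lemma powr_strict_tangent:
  fixes x y \<alpha> :: real
  assumes "0 < x" "0 < y" "x \<noteq> y" "0 < \<alpha>" "\<alpha> < 1"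
  shows "1 / \<alpha> * x powr \<alpha> < 1 / \<alpha> * y powr \<alpha> + y powr (\<alpha> - 1) * (x - y)"
proof -
  have D: "((\<lambda>x. 1 / \<alpha> * x powr \<alpha>) has_real_derivative z powr (\<alpha> - 1)) (at z)" if "0 < z" for z
    using that \<open>0 < \<alpha>\<close> by (auto intro!: derivative_eq_intros)
  show ?thesis
  proof (cases "y < x")
    case True
    obtain z where z: "y < z" "z < x" "1 / \<alpha> * x powr \<alpha> - 1 / \<alpha> * y powr \<alpha> = (x - y) * z powr (\<alpha> - 1)"
      using MVT2[OF True, of "\<lambda>x. 1 / \<alpha> * x powr \<alpha>" "\<lambda>z. z powr (\<alpha> - 1)"] D \<open>0 < y\<close> by force
    have "z powr (\<alpha> - 1) < y powr (\<alpha> - 1)" using z assms by (intro powr_less_mono2_neg) auto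
    then have "(x - y) * z powr (\<alpha> - 1) < (x - y) * y powr (\<alpha> - 1)" using True by simp
    then show ?thesis using z(3) by (simp add: mult.commute)
  next
    case False
    then have yx: "x < y" using assms by simp
    obtain z where z: "x < z" "z < y" "1 / \<alpha> * y powr \<alpha> - 1 / \<alpha> * x powr \<alpha> = (y - x) * z powr (\<alpha> - 1)"
      using MVT2[OF yx, of "\<lambda>x. 1 / \<alpha> * x powr \<alpha>" "\<lambda>z. z powr (\<alpha> - 1)"] D \<open>0 < x\<close> by force
    have "y powr (\<alpha> - 1) < z powr (\<alpha> - 1)" using z assms by (intro powr_less_mono2_neg) auto
    then have "(y - x) * y powr (\<alpha> - 1) < (y - x) * z powr (\<alpha> - 1)" using yx by simp
    then show ?thesis using z(3) by (simp add: algebra_simps)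
  qed
qed

lemma service_nonneg:
  assumes "distribution_path c" "0 < \<beta>"
  shows "0 \<le> service \<beta> c t"
  unfolding service_def using assms by (intro set_integral_path_nonneg) auto

text \<open>Of a unit consumed at \<open>s\<close>, the amount
  \<open>1 - exp (- \<beta> * (t - s))\<close> has been delivered as service by time
  \<open>t\<close>; the rest is its share of \<open>service \<beta> c t / \<beta>\<close>. Hence
  service determines the path.\<close>

lemma nn_integral_service_Icc:
  assumes c: "distribution_path c" and "0 < \<beta>" and t: "0 \<le> t"
  shows "(\<integral>\<^sup>+u\<in>{0..t}. ennreal (service \<beta> c u) \<partial>lborel) + ennreal (service \<beta> c t / \<beta>) = ennreal (c t)"
proof -
  let ?\<mu> = "interval_measure c"
  interpret \<mu>: sigma_finite_measure ?\<mu>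
    using distribution_pathD[OF c] by (intro sigma_finite_interval_measure) auto
  interpret pair_sigma_finite ?\<mu> lborel ..
  have serv: "ennreal (service \<beta> c u) = (\<integral>\<^sup>+s\<in>{0..u}. ennreal (\<beta> * exp (- \<beta> * (u - s))) \<partial>?\<mu>)" if "0 \<le> u" for u
    unfolding service_def using that \<open>0 < \<beta>\<close>
    by (intro nn_set_integral_path[OF c, symmetric]) (auto intro!: continuous_intros)
  let ?f = "\<lambda>s u. if 0 \<le> s \<and> s \<le> u \<and> u \<le> t then ennreal (\<beta> * exp (- \<beta> * (u - s))) else 0"
  have "(\<integral>\<^sup>+u\<in>{0..t}. ennreal (service \<beta> c u) \<partial>lborel) = (\<integral>\<^sup>+u. \<integral>\<^sup>+s. ?f s u \<partial>?\<mu> \<partial>lborel)"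
  proof (intro nn_integral_cong)
    fix u :: real
    show "ennreal (service \<beta> c u) * indicator {0..t} u = (\<integral>\<^sup>+s. ?f s u \<partial>?\<mu>)"
    proof (cases "u \<in> {0..t}")
      case True
      then have "ennreal (service \<beta> c u) = (\<integral>\<^sup>+s. ?f s u \<partial>?\<mu>)"
        by (simp add: serv del: mult_minus_left) (intro nn_integral_cong, auto simp: indicator_def)
      then show ?thesis using True by simp
    next
      case False
      then have "(\<integral>\<^sup>+s. ?f s u \<partial>?\<mu>) = (\<integral>\<^sup>+s. 0 \<partial>?\<mu>)" by (intro nn_integral_cong) auto
      then show ?thesis using False by simp
    qed
  qed
  also have "\<dots> = (\<integral>\<^sup>+s. \<integral>\<^sup>+u. ?f s u \<partial>lborel \<partial>?\<mu>)"
    by (rule Fubini') measurable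
  also have "\<dots> = (\<integral>\<^sup>+s. ennreal (1 - exp (- \<beta> * (t - s))) * indicator {0..t} s \<partial>?\<mu>)"
  proof (intro nn_integral_cong)
    fix s :: real
    show "(\<integral>\<^sup>+u. ?f s u \<partial>lborel) = ennreal (1 - exp (- \<beta> * (t - s))) * indicator {0..t} s"
    proof (cases "s \<in> {0..t}")
      case True
      then have "(\<integral>\<^sup>+u. ?f s u \<partial>lborel) = (\<integral>\<^sup>+u. ennreal (\<beta> * exp (- \<beta> * (u - s))) * indicator {s..t} u \<partial>lborel)"
        by (intro nn_integral_cong) (auto simp: indicator_def)
      also have "\<dots> = ennreal (- exp (- \<beta> * (t - s)) - - exp (- \<beta> * (s - s)))"
        using True \<open>0 < \<beta>\<close> by (intro nn_integral_FTC_Icc) (auto intro!: derivative_eq_intros)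
      finally show ?thesis using True by simp
    next
      case False
      then have "(\<integral>\<^sup>+u. ?f s u \<partial>lborel) = (\<integral>\<^sup>+(u::real). 0 \<partial>lborel)" by (intro nn_integral_cong) auto
      then show ?thesis using False by simp
    qed
  qed
  finally have 1: "(\<integral>\<^sup>+u\<in>{0..t}. ennreal (service \<beta> c u) \<partial>lborel) = \<dots>" .
  have 2: "ennreal (service \<beta> c t / \<beta>) = (\<integral>\<^sup>+s\<in>{0..t}. ennreal (exp (- \<beta> * (t - s))) \<partial>?\<mu>)"
  proof -
    have "service \<beta> c t = \<beta> * (LINT s:{0..t}|?\<mu>. exp (- \<beta> * (t - s)))"
      unfolding service_def by simp
    then show ?thesis using \<open>0 < \<beta>\<close> t
      by (subst nn_set_integral_path[OF c]) (auto intro!: continuous_intros)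
  qed
  have "(\<integral>\<^sup>+s. ennreal (1 - exp (- \<beta> * (t - s))) * indicator {0..t} s \<partial>?\<mu>) + (\<integral>\<^sup>+s\<in>{0..t}. ennreal (exp (- \<beta> * (t - s))) \<partial>?\<mu>)
    = (\<integral>\<^sup>+s. ennreal (1 - exp (- \<beta> * (t - s))) * indicator {0..t} s + ennreal (exp (- \<beta> * (t - s))) * indicator {0..t} s \<partial>?\<mu>)"
    by (rule nn_integral_add[symmetric]) measurable
  also have "\<dots> = (\<integral>\<^sup>+s. indicator {0..t} s \<partial>?\<mu>)"
    using \<open>0 < \<beta>\<close> by (intro nn_integral_cong) (auto simp: indicator_def ennreal_plus[symmetric] simp del: ennreal_plus)
  also have "\<dots> = ennreal (c t)" using emeasure_path_Icc[OF c t] by simp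
  finally show ?thesis using 1 2 by simp
qed

text \<open>Every interval to the right of \<open>t\<close> has positive length and so contains a
  point of agreement; such points can be chosen converging to \<open>t\<close>.\<close>

lemma right_continuous_eq_AE:
  fixes f g :: "real \<Rightarrow> real"
  assumes ae: "AE t in lborel. 0 \<le> t \<longrightarrow> f t = g t" and t: "0 \<le> t"
    and cont: "continuous (at_right t) f" "continuous (at_right t) g"
  shows "f t = g t"
proof -
  have "\<exists>x. t < x \<and> x < t + inverse (real (Suc n)) \<and> f x = g x" for n
  proof (rule ccontr)
    assume "\<not> ?thesis"
    then have "AE x in lborel. x \<notin> {t<..<t + inverse (real (Suc n))}"
      using ae t by (auto elim!: eventually_mono)
    then have "emeasure lborel {t<..<t + inverse (real (Suc n))} = 0"
      by (subst (asm) AE_iff_measurable[where N="{t<..<t + inverse (real (Suc n))}"]) auto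
    then show False by simp
  qed
  then obtain x where x: "\<And>n. t < x n" "\<And>n. x n < t + inverse (real (Suc n))" "\<And>n. f (x n) = g (x n)" by metis
  have "x \<longlonglongrightarrow> t"
  proof (rule tendsto_sandwich[OF _ _ tendsto_const])
    show "(\<lambda>n. t + inverse (real (Suc n))) \<longlonglongrightarrow> t"
      using tendsto_add[OF tendsto_const LIMSEQ_inverse_real_of_nat, of t] by simp
    show "\<forall>\<^sub>F n in sequentially. t \<le> x n" using x(1) by (auto intro: always_eventually less_imp_le)
    show "\<forall>\<^sub>F n in sequentially. x n \<le> t + inverse (real (Suc n))" using x(2) by (intro always_eventually allI less_imp_le)
  qed
  then have lim: "filterlim x (at_right t) sequentially"
    using x(1) less_imp_neq[OF x(1), symmetric] by (auto simp: filterlim_at intro!: always_eventually)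
  have "(\<lambda>n. f (x n)) \<longlonglongrightarrow> f t" "(\<lambda>n. g (x n)) \<longlonglongrightarrow> g t"
    using cont lim unfolding continuous_within by (auto intro: filterlim_compose)
  then show ?thesis using x(3) by (auto intro: LIMSEQ_unique)
qed

text \<open>Recovering \<open>c t\<close> uses both the service integral up to \<open>t\<close> and
  the value of the service at \<open>t\<close> itself, which is known only for almost all
  \<open>t\<close>; right continuity extends the equality to all times.\<close>

lemma distribution_path_eqI_service:
  assumes c: "distribution_path c" and d: "distribution_path d" and "0 < \<beta>"
    and ae: "AE t in lborel. 0 \<le> t \<longrightarrow> service \<beta> c t = service \<beta> d t"
  shows "c t = d t"
proof (cases "0 \<le> t")
  case True
  have "AE t in lborel. 0 \<le> t \<longrightarrow> c t = d t"
    using ae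
  proof eventually_elim
    case (elim t)
    show ?case
    proof
      assume t: "0 \<le> t"
      have "(\<integral>\<^sup>+u\<in>{0..t}. ennreal (service \<beta> c u) \<partial>lborel) = (\<integral>\<^sup>+u\<in>{0..t}. ennreal (service \<beta> d u) \<partial>lborel)"
        using ae by (intro nn_integral_cong_AE) (auto elim!: eventually_mono simp: indicator_def)
      then have "ennreal (c t) = ennreal (d t)"
        using nn_integral_service_Icc[OF c \<open>0 < \<beta>\<close> t] nn_integral_service_Icc[OF d \<open>0 < \<beta>\<close> t] elim t by simp
      then show "c t = d t" using distribution_pathD(4)[OF c] distribution_pathD(4)[OF d] by simp
    qed
  qed
  then show ?thesis using True distribution_pathD(2)[OF c] distribution_pathD(2)[OF d]
    by (intro right_continuous_eq_AE)
qed (use distribution_pathD(3)[OF c] distribution_pathD(3)[OF d] in auto)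

section \<open>Expected time integrals under a density process\<close>

context martingale_density
begin

text \<open>The form of \<open>expectation_dt\<close> with an abstract density \<open>Z\<close> in
  place of the chosen \<open>density_process\<close>.\<close>

definition density_integral :: "(real \<Rightarrow> 'a \<Rightarrow> real) \<Rightarrow> ennreal" where
  "density_integral f = (\<integral>\<^sup>+\<omega>. (\<integral>\<^sup>+t\<in>{0..}. ennreal (Z t \<omega> * f t \<omega>) \<partial>lborel) \<partial>M)"

text \<open>Processes here are meaningful only from time 0 on, so joint measurability is asked after
  setting them to 0 before.\<close>

definition process_measurable :: "(real \<Rightarrow> 'a \<Rightarrow> real) \<Rightarrow> bool" where
  "process_measurable f \<longleftrightarrow> (\<lambda>(t, \<omega>). if 0 \<le> t then f t \<omega> else 0) \<in> borel_measurable (borel \<Otimes>\<^sub>M M)"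

lemma integrand_measurable:
  assumes "process_measurable f"
  shows "(\<lambda>(t, \<omega>). ennreal (Z t \<omega> * f t \<omega>) * indicator {0..} t) \<in> borel_measurable (borel \<Otimes>\<^sub>M M)"
proof -
  note [measurable] = assms[unfolded process_measurable_def] measurable_density_pair
  have "(\<lambda>(t, \<omega>). ennreal ((if 0 \<le> t then Z t \<omega> else 0) * (if 0 \<le> t then f t \<omega> else 0))) \<in> borel_measurable (borel \<Otimes>\<^sub>M M)"
    by measurable
  also have "(\<lambda>(t, \<omega>). ennreal ((if 0 \<le> t then Z t \<omega> else 0) * (if 0 \<le> t then f t \<omega> else 0)))
    = (\<lambda>(t, \<omega>). ennreal (Z t \<omega> * f t \<omega>) * indicator {0..} t)"
    by (auto simp: indicator_def fun_eq_iff)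
  finally show ?thesis .
qed

lemma section_integrand_measurable:
  assumes "process_measurable f"
  shows "\<omega> \<in> space M \<Longrightarrow> (\<lambda>t. ennreal (Z t \<omega> * f t \<omega>) * indicator {0..} t) \<in> borel_measurable borel"
    "(\<lambda>\<omega>. \<integral>\<^sup>+t\<in>{0..}. ennreal (Z t \<omega> * f t \<omega>) \<partial>lborel) \<in> borel_measurable M"
proof -
  note [measurable] = integrand_measurable[OF assms]
  show "\<omega> \<in> space M \<Longrightarrow> (\<lambda>t. ennreal (Z t \<omega> * f t \<omega>) * indicator {0..} t) \<in> borel_measurable borel"
    using measurable_compose[OF measurable_Pair2' integrand_measurable[OF assms], of \<omega>] by simp
  show "(\<lambda>\<omega>. \<integral>\<^sup>+t\<in>{0..}. ennreal (Z t \<omega> * f t \<omega>) \<partial>lborel) \<in> borel_measurable M"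
    by measurable
qed

lemma density_integral_add:
  assumes "process_measurable f" "process_measurable g"
    and "\<And>t \<omega>. 0 \<le> t \<Longrightarrow> \<omega> \<in> space M \<Longrightarrow> 0 \<le> f t \<omega>" "\<And>t \<omega>. 0 \<le> t \<Longrightarrow> \<omega> \<in> space M \<Longrightarrow> 0 \<le> g t \<omega>"
  shows "density_integral (\<lambda>t \<omega>. f t \<omega> + g t \<omega>) = density_integral f + density_integral g"
proof -
  have "density_integral (\<lambda>t \<omega>. f t \<omega> + g t \<omega>) = (\<integral>\<^sup>+\<omega>. (\<integral>\<^sup>+t\<in>{0..}. ennreal (Z t \<omega> * f t \<omega>) \<partial>lborel) + (\<integral>\<^sup>+t\<in>{0..}. ennreal (Z t \<omega> * g t \<omega>) \<partial>lborel) \<partial>M)"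
    unfolding density_integral_def
  proof (rule nn_integral_cong)
    fix \<omega> assume \<omega>: "\<omega> \<in> space M"
    have "(\<integral>\<^sup>+t\<in>{0..}. ennreal (Z t \<omega> * (f t \<omega> + g t \<omega>)) \<partial>lborel)
      = (\<integral>\<^sup>+t. ennreal (Z t \<omega> * f t \<omega>) * indicator {0..} t + ennreal (Z t \<omega> * g t \<omega>) * indicator {0..} t \<partial>lborel)"
      using assms(3,4)[OF _ \<omega>] less_imp_le[OF density_pos[OF _ \<omega>]]
      by (intro nn_integral_cong) (auto simp: indicator_def distrib_left ennreal_plus mult_nonneg_nonneg)
    also have "\<dots> = (\<integral>\<^sup>+t\<in>{0..}. ennreal (Z t \<omega> * f t \<omega>) \<partial>lborel) + (\<integral>\<^sup>+t\<in>{0..}. ennreal (Z t \<omega> * g t \<omega>) \<partial>lborel)"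
      using section_integrand_measurable(1)[OF assms(1) \<omega>] section_integrand_measurable(1)[OF assms(2) \<omega>]
      by (intro nn_integral_add) simp_all
    finally show "(\<integral>\<^sup>+t\<in>{0..}. ennreal (Z t \<omega> * (f t \<omega> + g t \<omega>)) \<partial>lborel) = \<dots>" .
  qed
  also have "\<dots> = density_integral f + density_integral g"
    unfolding density_integral_def by (intro nn_integral_add section_integrand_measurable assms)
  finally show ?thesis .
qed

lemma density_integral_mono:
  assumes "\<And>t \<omega>. 0 \<le> t \<Longrightarrow> \<omega> \<in> space M \<Longrightarrow> f t \<omega> \<le> g t \<omega>"
  shows "density_integral f \<le> density_integral g"
  unfolding density_integral_def
proof (intro nn_integral_mono)
  fix \<omega> t assume "\<omega> \<in> space M"
  then show "ennreal (Z t \<omega> * f t \<omega>) * indicator {0..} t \<le> ennreal (Z t \<omega> * g t \<omega>) * indicator {0..} t"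
    using assms[of t \<omega>] density_pos[of t \<omega>] by (auto simp: indicator_def intro!: ennreal_leI mult_left_mono)
qed

lemma density_integral_eq_0D:
  assumes "process_measurable f" "density_integral f = 0" and "\<And>t \<omega>. 0 \<le> t \<Longrightarrow> \<omega> \<in> space M \<Longrightarrow> 0 \<le> f t \<omega>"
  shows "AE \<omega> in M. AE t in lborel. 0 \<le> t \<longrightarrow> f t \<omega> = 0"
proof -
  have "AE \<omega> in M. (\<integral>\<^sup>+t\<in>{0..}. ennreal (Z t \<omega> * f t \<omega>) \<partial>lborel) = 0"
    using assms(2) section_integrand_measurable(2)[OF assms(1)] unfolding density_integral_def
    by (subst (asm) nn_integral_0_iff_AE) auto
  then show ?thesis using AE_space
  proof eventually_elim
    case (elim \<omega>)
    then have "AE t in lborel. ennreal (Z t \<omega> * f t \<omega>) * indicator {0..} t = 0"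
      using section_integrand_measurable(1)[OF assms(1) elim(2)]
      by (subst (asm) nn_integral_0_iff_AE) auto
    then show ?case
    proof eventually_elim
      case (elim t)
      show ?case
      proof
        assume t: "0 \<le> t"
        then have "Z t \<omega> * f t \<omega> \<le> 0" using elim by (simp add: ennreal_eq_0_iff)
        then show "f t \<omega> = 0" using density_pos[OF t \<open>\<omega> \<in> space M\<close>] assms(3)[OF t \<open>\<omega> \<in> space M\<close>]
          by (auto simp: mult_le_0_iff)
      qed
    qed
  qed
qed

text \<open>Tonelli and the unit mean of \<open>Z t\<close>. The measure is left general: it is
  \<open>lborel\<close> for utilities and \<open>interval_measure c\<close> for costs, so a
  deterministic plan is worth and costs the same under every prior.\<close>

lemma nn_integral_density_deterministic:
  fixes X :: "real \<Rightarrow> real"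
  assumes "sigma_finite_measure \<mu>" and [measurable_cong, simp]: "sets \<mu> = sets borel"
    and [measurable]: "X \<in> borel_measurable borel" and X: "\<And>t. 0 \<le> t \<Longrightarrow> 0 \<le> X t"
  shows "(\<integral>\<^sup>+\<omega>. (\<integral>\<^sup>+t\<in>{0..}. ennreal (Z t \<omega> * X t) \<partial>\<mu>) \<partial>M) = (\<integral>\<^sup>+t\<in>{0..}. ennreal (X t) \<partial>\<mu>)"
proof -
  interpret \<mu>: sigma_finite_measure \<mu> by fact
  interpret pair_sigma_finite \<mu> M ..
  note [measurable] = measurable_density_pair
  have "(\<integral>\<^sup>+\<omega>. (\<integral>\<^sup>+t\<in>{0..}. ennreal (Z t \<omega> * X t) \<partial>\<mu>) \<partial>M) = (\<integral>\<^sup>+\<omega>. \<integral>\<^sup>+t. ennreal ((if 0 \<le> t then Z t \<omega> else 0) * X t) \<partial>\<mu> \<partial>M)"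
    by (intro nn_integral_cong) (auto simp: indicator_def)
  also have "\<dots> = (\<integral>\<^sup>+t. \<integral>\<^sup>+\<omega>. ennreal ((if 0 \<le> t then Z t \<omega> else 0) * X t) \<partial>M \<partial>\<mu>)"
    by (rule Fubini') measurable
  also have "\<dots> = (\<integral>\<^sup>+t\<in>{0..}. ennreal (X t) \<partial>\<mu>)"
  proof (rule nn_integral_cong)
    fix t
    show "(\<integral>\<^sup>+\<omega>. ennreal ((if 0 \<le> t then Z t \<omega> else 0) * X t) \<partial>M) = ennreal (X t) * indicator {0..} t"
    proof (cases "0 \<le> t")
      case True
      have "(\<integral>\<^sup>+\<omega>. ennreal (Z t \<omega> * X t) \<partial>M) = (\<integral>\<^sup>+\<omega>. ennreal (Z t \<omega>) * ennreal (X t) \<partial>M)"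
        using X[OF True] by (intro nn_integral_cong) (simp add: ennreal_mult'')
      also have "\<dots> = ennreal (X t)"
        using measurable_density[OF True] normalized[OF True] by (subst nn_integral_multc) auto
      finally show ?thesis using True by simp
    qed simp
  qed
  finally show ?thesis .
qed

lemma deterministic_plan: "distribution_path c \<Longrightarrow> (\<lambda>t \<omega>. c t) \<in> consumption_plans M F"
  by (auto simp: consumption_plans_def distribution_path_def)

lemma borel_measurable_service:
  assumes "distribution_path c"
  shows "(\<lambda>t. if 0 \<le> t then service \<beta> c t else 0) \<in> borel_measurable borel"
proof -
  obtain \<omega> where "\<omega> \<in> space M" using not_empty by blast
  from measurable_compose[OF measurable_Pair2'[OF this] measurable_service[OF deterministic_plan[OF assms]]]
  show ?thesis by simp
qed

text \<open>The function \<open>h\<close> sees the services of two plans, which covers the utility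
  and price terms of either plan as well as the gap between them.\<close>

lemma process_measurable_service:
  assumes "C \<in> consumption_plans M F" "D \<in> consumption_plans M F"
    and h: "(\<lambda>(t, x, y). h t x y) \<in> borel_measurable (borel \<Otimes>\<^sub>M borel \<Otimes>\<^sub>M borel)"
  shows "process_measurable (\<lambda>t \<omega>. h t (service \<beta> (\<lambda>s. C s \<omega>) t) (service \<beta> (\<lambda>s. D s \<omega>) t))"
proof -
  let ?C = "\<lambda>z. (\<lambda>(t, \<omega>). if 0 \<le> t then service \<beta> (\<lambda>s. C s \<omega>) t else 0) z"
  let ?D = "\<lambda>z. (\<lambda>(t, \<omega>). if 0 \<le> t then service \<beta> (\<lambda>s. D s \<omega>) t else 0) z"
  note [measurable] = measurable_service[OF assms(1), of \<beta>] measurable_service[OF assms(2), of \<beta>]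
  have "(\<lambda>z. (fst z, ?C z, ?D z)) \<in> measurable (borel \<Otimes>\<^sub>M M) (borel \<Otimes>\<^sub>M borel \<Otimes>\<^sub>M borel)"
    by measurable
  from measurable_compose[OF this h]
  have [measurable]: "(\<lambda>z. h (fst z) (?C z) (?D z)) \<in> borel_measurable (borel \<Otimes>\<^sub>M M)"
    by (simp only: prod.case)
  have "(\<lambda>z. if 0 \<le> fst z then h (fst z) (?C z) (?D z) else 0) \<in> borel_measurable (borel \<Otimes>\<^sub>M M)"
    by measurable
  also have "(\<lambda>z. if 0 \<le> fst z then h (fst z) (?C z) (?D z) else 0)
    = (\<lambda>(t, \<omega>). if 0 \<le> t then h t (service \<beta> (\<lambda>s. C s \<omega>) t) (service \<beta> (\<lambda>s. D s \<omega>) t) else 0)"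
    by (auto simp: fun_eq_iff)
  finally show ?thesis by (simp add: process_measurable_def)
qed

end

lemma satisfaction_eq_service: "satisfaction \<beta> \<eta> C t \<omega> = \<eta> * exp (- \<beta> * t) + service \<beta> (\<lambda>s. C s \<omega>) t"
  by (simp add: satisfaction_def service_def)

text \<open>The choice may return a density built from another drift with other bounds, but each
  candidate is the stochastic exponential of some bounded drift.\<close>

lemma (in brownian_motion) martingale_density_density_process:
  assumes "P \<in> priors M F B l u"
  shows "martingale_density M F (density_process M F B P)"
proof -
  have "\<exists>\<epsilon>. (\<exists>\<xi> l u. drift M F l u \<xi> \<and> stochastic_exponential M F B \<xi> \<epsilon>) \<and> P = prior_with_density M F \<epsilon>"
    using assms unfolding priors_def by blast
  from someI_ex[OF this] show ?thesis
    unfolding density_process_def[symmetric] using martingale_density_stochastic_exponential by blast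
qed

section \<open>Marginal utility along the deterministic optimum\<close>

locale deterministic_optimum =
  fixes r \<delta> \<beta> \<eta> w \<alpha> :: real and c :: "real \<Rightarrow> real" and K \<theta> q :: real
  assumes par: "r > 0" "\<beta> > 0" "\<eta> > 0" "w > 0" "0 < \<alpha>" "\<alpha> < 1"
    and path: "distribution_path c" and K: "0 < K" and q: "q = \<delta> - (1 - \<alpha>) * \<theta>" "r \<le> q"
    and cost: "(\<integral>\<^sup>+s\<in>{0..}. ennreal (exp (- r * s)) \<partial>interval_measure c) = ennreal w"
      "(\<integral>\<^sup>+s\<in>{0..}. ennreal (exp (- q * s)) \<partial>interval_measure c) = ennreal w"
    and level_ge: "\<And>t. 0 \<le> t \<Longrightarrow> K * exp (- \<theta> * t) \<le> \<eta> * exp (- \<beta> * t) + service \<beta> c t"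
    and level_eq: "\<And>t. 0 \<le> t \<Longrightarrow> service \<beta> c t = 0 \<or> \<eta> * exp (- \<beta> * t) + service \<beta> c t = K * exp (- \<theta> * t)"
begin

text \<open>Satisfaction \<open>Y\<close>, discounted utility \<open>U\<close> and marginal utility
  \<open>g\<close> are functions of time and of the service level \<open>n\<close>, so that plans
  enter through their service alone.\<close>

definition Y :: "real \<Rightarrow> real \<Rightarrow> real" where "Y t n = \<eta> * exp (- \<beta> * t) + n"
definition U :: "real \<Rightarrow> real \<Rightarrow> real" where "U t n = exp (- \<delta> * t) * (1 / \<alpha>) * Y t n powr \<alpha>"
definition g :: "real \<Rightarrow> real \<Rightarrow> real" where "g t n = exp (- \<delta> * t) * Y t n powr (\<alpha> - 1)"
definition A :: real where "A = K powr (\<alpha> - 1)"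

text \<open>\<open>G\<close> is the gradient of the utility at the level \<open>K e\<^sup>-\<^sup>\<theta>\<^sup>t\<close>.  It dominates the gradient \<open>g\<close> along the
  optimal plan and agrees with it whenever that plan has already consumed.\<close>

definition G :: "real \<Rightarrow> real" where "G t = A * exp (- q * t)"
text \<open>The defect of the tangent inequality for the concave function \<open>U t\<close> at
  \<open>m\<close>. It is carried along as a term of its own because its vanishing yields
  uniqueness.\<close>

definition gap :: "real \<Rightarrow> real \<Rightarrow> real \<Rightarrow> real" where "gap t n m = U t m + g t m * (n - m) - U t n"

lemma Y_pos: "0 \<le> n \<Longrightarrow> 0 < Y t n"
  using par by (auto simp: Y_def intro: add_pos_nonneg)

lemma U_nonneg: "0 \<le> U t n"
  using par by (simp add: U_def)

lemma gap_nonneg: "0 \<le> n \<Longrightarrow> 0 \<le> m \<Longrightarrow> 0 \<le> gap t n m" and gap_eq_0D: "0 \<le> n \<Longrightarrow> 0 \<le> m \<Longrightarrow> gap t n m = 0 \<Longrightarrow> n = m"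
proof -
  have strict: "0 < gap t n m" if "0 \<le> n" "0 \<le> m" "n \<noteq> m"
  proof -
    have "1 / \<alpha> * Y t n powr \<alpha> < 1 / \<alpha> * Y t m powr \<alpha> + Y t m powr (\<alpha> - 1) * (Y t n - Y t m)"
      using that par by (intro powr_strict_tangent Y_pos) (auto simp: Y_def)
    then have "exp (- \<delta> * t) * (1 / \<alpha> * Y t n powr \<alpha>) < exp (- \<delta> * t) * (1 / \<alpha> * Y t m powr \<alpha> + Y t m powr (\<alpha> - 1) * (Y t n - Y t m))"
      by (intro mult_strict_left_mono) auto
    moreover have "Y t n - Y t m = n - m" by (simp add: Y_def)
    ultimately show ?thesis by (simp add: gap_def U_def g_def distrib_left mult.assoc)
  qed
  show "0 \<le> n \<Longrightarrow> 0 \<le> m \<Longrightarrow> 0 \<le> gap t n m" using strict by (cases "n = m") (auto simp: gap_def)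
  show "0 \<le> n \<Longrightarrow> 0 \<le> m \<Longrightarrow> gap t n m = 0 \<Longrightarrow> n = m" using strict by force
qed

lemma service_c_nonneg: "0 \<le> service \<beta> c t"
  using service_nonneg[OF path] par by simp

lemma G_eq: "G t = exp (- \<delta> * t) * (K * exp (- \<theta> * t)) powr (\<alpha> - 1)"
proof -
  have "exp (- \<delta> * t) * exp (- \<theta> * t) powr (\<alpha> - 1) = exp (- q * t)"
    unfolding powr_def by (simp add: exp_add[symmetric] q algebra_simps)
  then show ?thesis using K by (simp add: G_def A_def powr_mult mult.left_commute)
qed

text \<open>These are complementary slackness conditions: the optimum never lies below the curve and
  marginal utility decreases in the level, while positive service occurs only on the curve.\<close>

lemma g_le_G:
  assumes "0 \<le> t"
  shows "g t (service \<beta> c t) \<le> G t" "g t (service \<beta> c t) * service \<beta> c t = G t * service \<beta> c t"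
proof -
  show "g t (service \<beta> c t) \<le> G t"
    unfolding g_def G_eq using level_ge[OF assms] K par
    by (intro mult_left_mono powr_mono2') (auto simp: Y_def)
  show "g t (service \<beta> c t) * service \<beta> c t = G t * service \<beta> c t"
    using level_eq[OF assms] by (auto simp: g_def G_eq Y_def)
qed

lemma A_pos: "0 < A" using K by (simp add: A_def)

lemma q_\<beta>_pos: "0 < q + \<beta>" using par q by simp

text \<open>The tangent inequality with \<open>g\<close> replaced by the price \<open>G\<close>:
  this raises the term in \<open>n\<close> and leaves the term in the optimal service unchanged. All
  terms are moved to where they are nonnegative, ready for integration in
  \<open>ennreal\<close>.\<close>

lemma supporting_inequality:
  assumes "0 \<le> t" "0 \<le> n"
  shows "U t n + gap t n (service \<beta> c t) + G t * service \<beta> c t \<le> U t (service \<beta> c t) + G t * n"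
proof -
  have "U t n + gap t n (service \<beta> c t) + g t (service \<beta> c t) * service \<beta> c t = U t (service \<beta> c t) + g t (service \<beta> c t) * n"
    by (simp add: gap_def algebra_simps)
  also have "\<dots> \<le> U t (service \<beta> c t) + G t * n"
    using g_le_G(1)[OF assms(1)] assms(2) by (intro add_left_mono mult_right_mono)
  finally show ?thesis using g_le_G(2)[OF assms(1)] by simp
qed

lemma measurable_U: "(\<lambda>(t, n). U t n) \<in> borel_measurable (borel \<Otimes>\<^sub>M borel)"
  unfolding U_def Y_def by measurable

lemma measurable_gap: "(\<lambda>(t, n, m). gap t n m) \<in> borel_measurable (borel \<Otimes>\<^sub>M borel \<Otimes>\<^sub>M borel)"
  unfolding gap_def U_def Y_def g_def by measurable

lemma measurable_G: "G \<in> borel_measurable borel"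
  unfolding G_def[abs_def] by measurable

lemma nn_integral_G_service: "(\<integral>\<^sup>+t\<in>{0..}. ennreal (G t * service \<beta> c t) \<partial>lborel) = ennreal (A * \<beta> / (q + \<beta>)) * ennreal w"
  using nn_integral_discounted_service[OF path, of "\<lambda>_. 1" A \<beta> q] A_pos q_\<beta>_pos par cost(2)
  by (simp add: G_def service_def)

text \<open>The power function is homogeneous, so utility is 1 / \<alpha> times marginal utility
  times level; bounding marginal utility by \<open>G\<close> leaves two terms with finite
  integral.\<close>

lemma U_le: "0 \<le> t \<Longrightarrow> U t (service \<beta> c t) \<le> 1 / \<alpha> * (G t * service \<beta> c t) + A * \<eta> / \<alpha> * exp (- (q + \<beta>) * t)"
proof -
  assume t: "0 \<le> t"
  let ?n = "service \<beta> c t"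
  have "Y t ?n powr \<alpha> = Y t ?n powr (\<alpha> - 1) * Y t ?n"
    using Y_pos[OF service_c_nonneg[of t], of t] by (simp add: powr_diff)
  then have "U t ?n = 1 / \<alpha> * (g t ?n * Y t ?n)" by (simp add: U_def g_def)
  also have "\<dots> \<le> 1 / \<alpha> * (G t * Y t ?n)"
    using g_le_G(1)[OF t] Y_pos[OF service_c_nonneg[of t], of t] par by (intro mult_left_mono mult_right_mono) auto
  also have "\<dots> = 1 / \<alpha> * (G t * ?n) + A * \<eta> / \<alpha> * (exp (- q * t) * exp (- \<beta> * t))"
    by (simp add: G_def Y_def algebra_simps add_divide_distrib)
  also have "exp (- q * t) * exp (- \<beta> * t) = exp (- (q + \<beta>) * t)"
    unfolding exp_add[symmetric] by (simp add: algebra_simps)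
  finally show ?thesis .
qed

end

section \<open>Comparison of all plans with the optimum under one prior\<close>

locale verification = martingale_density M F Z + deterministic_optimum r \<delta> \<beta> \<eta> w \<alpha> c K \<theta> q
  for M :: "'a measure" and F :: "real \<Rightarrow> 'a measure" and Z :: "real \<Rightarrow> 'a \<Rightarrow> real"
    and r \<delta> \<beta> \<eta> w \<alpha> :: real and c :: "real \<Rightarrow> real" and K \<theta> q :: real
begin

abbreviation "optimal_value \<equiv> (\<integral>\<^sup>+t\<in>{0..}. ennreal (U t (service \<beta> c t)) \<partial>lborel)"

lemma density_integral_deterministic:
  assumes [measurable]: "(\<lambda>(t, n). f t n) \<in> borel_measurable (borel \<Otimes>\<^sub>M borel)" and f: "\<And>t. 0 \<le> t \<Longrightarrow> 0 \<le> f t (service \<beta> c t)"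
  shows "density_integral (\<lambda>t \<omega>. f t (service \<beta> c t)) = (\<integral>\<^sup>+t\<in>{0..}. ennreal (f t (service \<beta> c t)) \<partial>lborel)"
proof -
  note [measurable] = borel_measurable_service[OF path, of \<beta>]
  let ?X = "\<lambda>t. f t (if 0 \<le> t then service \<beta> c t else 0)"
  have "density_integral (\<lambda>t \<omega>. f t (service \<beta> c t)) = (\<integral>\<^sup>+\<omega>. (\<integral>\<^sup>+t\<in>{0..}. ennreal (Z t \<omega> * ?X t) \<partial>lborel) \<partial>M)"
    unfolding density_integral_def by (intro nn_integral_cong) (auto simp: indicator_def)
  also have "\<dots> = (\<integral>\<^sup>+t\<in>{0..}. ennreal (?X t) \<partial>lborel)"
    using f by (intro nn_integral_density_deterministic) (auto intro: lborel.sigma_finite_measure_axioms)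
  also have "\<dots> = (\<integral>\<^sup>+t\<in>{0..}. ennreal (f t (service \<beta> c t)) \<partial>lborel)"
    by (intro nn_integral_cong) (auto simp: indicator_def)
  finally show ?thesis .
qed

lemma cost_deterministic:
  "(\<integral>\<^sup>+\<omega>. (\<integral>\<^sup>+t\<in>{0..}. ennreal (Z t \<omega> * exp (- r * t)) \<partial>interval_measure c) \<partial>M) = ennreal w"
  unfolding cost(1)[symmetric] using distribution_pathD[OF path]
  by (intro nn_integral_density_deterministic sigma_finite_interval_measure) auto

text \<open>Needed for uniqueness, where the optimal value is cancelled from both sides.\<close>

lemma optimal_value_finite: "optimal_value < \<infinity>"
proof -
  note [measurable] = borel_measurable_service[OF path, of \<beta>] measurable_G
  have "optimal_value \<le> (\<integral>\<^sup>+t. ennreal (1 / \<alpha>) * (ennreal (G t * (if 0 \<le> t then service \<beta> c t else 0)) * indicator {0..} t)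
      + ennreal (A * \<eta> / \<alpha>) * (ennreal (exp (- (q + \<beta>) * t)) * indicator {0..} t) \<partial>lborel)"
  proof (intro nn_integral_mono)
    fix t :: real
    show "ennreal (U t (service \<beta> c t)) * indicator {0..} t \<le> ennreal (1 / \<alpha>) * (ennreal (G t * (if 0 \<le> t then service \<beta> c t else 0)) * indicator {0..} t)
      + ennreal (A * \<eta> / \<alpha>) * (ennreal (exp (- (q + \<beta>) * t)) * indicator {0..} t)"
    proof (cases "0 \<le> t")
      case True
      have "0 \<le> G t * service \<beta> c t" using A_pos service_c_nonneg by (simp add: G_def)
      then have "ennreal (1 / \<alpha> * (G t * service \<beta> c t) + A * \<eta> / \<alpha> * exp (- (q + \<beta>) * t)) =
        ennreal (1 / \<alpha>) * ennreal (G t * service \<beta> c t) + ennreal (A * \<eta> / \<alpha>) * ennreal (exp (- (q + \<beta>) * t))"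
        using par A_pos by (subst ennreal_plus) (simp_all add: ennreal_mult[symmetric])
      then show ?thesis using ennreal_leI[OF U_le[OF True]] True by simp
    qed simp
  qed
  also have "\<dots> = ennreal (1 / \<alpha>) * (\<integral>\<^sup>+t\<in>{0..}. ennreal (G t * (if 0 \<le> t then service \<beta> c t else 0)) \<partial>lborel)
      + ennreal (A * \<eta> / \<alpha>) * (\<integral>\<^sup>+t\<in>{0..}. ennreal (exp (- (q + \<beta>) * t)) \<partial>lborel)"
    by (subst nn_integral_add) (auto simp: nn_integral_cmult)
  also have "(\<integral>\<^sup>+t\<in>{0..}. ennreal (G t * (if 0 \<le> t then service \<beta> c t else 0)) \<partial>lborel) = (\<integral>\<^sup>+t\<in>{0..}. ennreal (G t * service \<beta> c t) \<partial>lborel)"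
    by (intro nn_integral_cong) (auto simp: indicator_def)
  also have "ennreal (1 / \<alpha>) * \<dots> + ennreal (A * \<eta> / \<alpha>) * (\<integral>\<^sup>+t\<in>{0..}. ennreal (exp (- (q + \<beta>) * t)) \<partial>lborel) < \<infinity>"
    using nn_integral_exp_tail[OF q_\<beta>_pos, of 0] nn_integral_G_service by (simp add: ennreal_mult_less_top)
  finally show ?thesis .
qed

text \<open>Integrate the supporting inequality. The price term equals \<open>?k\<close> for the
  optimum, whose cost at rate \<open>q\<close> is exactly \<open>w\<close>, and is at most
  \<open>?k\<close> for any affordable plan; so it can be cancelled.\<close>

lemma utility_gap:
  assumes C: "C \<in> consumption_plans M F"
    and budget: "(\<integral>\<^sup>+\<omega>. (\<integral>\<^sup>+t\<in>{0..}. ennreal (Z t \<omega> * exp (- r * t)) \<partial>interval_measure (\<lambda>t. C t \<omega>)) \<partial>M) \<le> ennreal w"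
  shows "density_integral (\<lambda>t \<omega>. U t (service \<beta> (\<lambda>s. C s \<omega>) t))
    + density_integral (\<lambda>t \<omega>. gap t (service \<beta> (\<lambda>s. C s \<omega>) t) (service \<beta> c t)) \<le> optimal_value"
proof -
  let ?N = "\<lambda>t \<omega>. service \<beta> (\<lambda>s. C s \<omega>) t" and ?n = "service \<beta> c"
  let ?k = "ennreal (A * \<beta> / (q + \<beta>)) * ennreal w"
  note D = deterministic_plan[OF path]
  have N: "0 \<le> ?N t \<omega>" if "\<omega> \<in> space M" for t \<omega>
    using service_nonneg[OF consumption_plan_path[OF C that]] par by simp
  have G: "0 \<le> G t" for t using A_pos by (simp add: G_def)
  note [measurable] = measurable_U measurable_G measurable_gap
  note pm = process_measurable_service[OF C D, where \<beta>=\<beta>]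
  have m: "process_measurable (\<lambda>t \<omega>. U t (?N t \<omega>))" "process_measurable (\<lambda>t \<omega>. gap t (?N t \<omega>) (?n t))"
    "process_measurable (\<lambda>t \<omega>. G t * ?n t)" "process_measurable (\<lambda>t \<omega>. U t (?n t))" "process_measurable (\<lambda>t \<omega>. G t * ?N t \<omega>)"
    "process_measurable (\<lambda>t \<omega>. U t (?N t \<omega>) + gap t (?N t \<omega>) (?n t))"
  proof -
    have "(\<lambda>(t, x, y). U t x) \<in> borel_measurable (borel \<Otimes>\<^sub>M borel \<Otimes>\<^sub>M borel)"
      "(\<lambda>(t, x :: real, y). G t * y) \<in> borel_measurable (borel \<Otimes>\<^sub>M borel \<Otimes>\<^sub>M borel)"
      "(\<lambda>(t, x :: real, y). U t y) \<in> borel_measurable (borel \<Otimes>\<^sub>M borel \<Otimes>\<^sub>M borel)"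
      "(\<lambda>(t, x, y). G t * x) \<in> borel_measurable (borel \<Otimes>\<^sub>M borel \<Otimes>\<^sub>M borel)"
      "(\<lambda>(t, x, y). U t x + gap t x y) \<in> borel_measurable (borel \<Otimes>\<^sub>M borel \<Otimes>\<^sub>M borel)"
      unfolding U_def Y_def gap_def g_def G_def by measurable
    note h = this measurable_gap
    show "process_measurable (\<lambda>t \<omega>. U t (?N t \<omega>))" "process_measurable (\<lambda>t \<omega>. gap t (?N t \<omega>) (?n t))"
      "process_measurable (\<lambda>t \<omega>. G t * ?n t)" "process_measurable (\<lambda>t \<omega>. U t (?n t))" "process_measurable (\<lambda>t \<omega>. G t * ?N t \<omega>)"
      "process_measurable (\<lambda>t \<omega>. U t (?N t \<omega>) + gap t (?N t \<omega>) (?n t))"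
      by (fact pm[OF h(1)] pm[OF h(6)] pm[OF h(2)] pm[OF h(3)] pm[OF h(4)] pm[OF h(5)])+
  qed
  have GN: "density_integral (\<lambda>t \<omega>. G t * ?N t \<omega>) \<le> ?k"
  proof -
    have "density_integral (\<lambda>t \<omega>. G t * ?N t \<omega>) \<le> ennreal (A * \<beta> / (q + \<beta>)) *
        (\<integral>\<^sup>+\<omega>. (\<integral>\<^sup>+t\<in>{0..}. ennreal (Z t \<omega> * exp (- q * t)) \<partial>interval_measure (\<lambda>t. C t \<omega>)) \<partial>M)"
      unfolding density_integral_def G_def using A_pos par q_\<beta>_pos by (intro nn_integral_service_le[OF C]) auto
    \<comment> \<open>Discounting at the rate \<open>q\<close>, which is at least \<open>r\<close>,
      can only lower the cost, so the budget at rate \<open>r\<close> applies.\<close>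
    also have "\<dots> \<le> ennreal (A * \<beta> / (q + \<beta>)) *
        (\<integral>\<^sup>+\<omega>. (\<integral>\<^sup>+t\<in>{0..}. ennreal (Z t \<omega> * exp (- r * t)) \<partial>interval_measure (\<lambda>t. C t \<omega>)) \<partial>M)"
    proof (intro mult_left_mono nn_integral_mono)
      fix \<omega> t assume \<omega>: "\<omega> \<in> space M"
      show "ennreal (Z t \<omega> * exp (- q * t)) * indicator {0..} t \<le> ennreal (Z t \<omega> * exp (- r * t)) * indicator {0..} t"
        using density_pos[OF _ \<omega>, of t] q(2) by (auto simp: indicator_def intro!: ennreal_leI mult_left_mono mult_right_mono)
    qed simp
    also have "\<dots> \<le> ?k" using budget by (intro mult_left_mono) auto
    finally show ?thesis .
  qed
  have "(density_integral (\<lambda>t \<omega>. U t (?N t \<omega>)) + density_integral (\<lambda>t \<omega>. gap t (?N t \<omega>) (?n t))) + ?k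
    = density_integral (\<lambda>t \<omega>. (U t (?N t \<omega>) + gap t (?N t \<omega>) (?n t)) + G t * ?n t)"
  proof -
    have "density_integral (\<lambda>t \<omega>. G t * ?n t) = ?k"
      using density_integral_deterministic[of "\<lambda>t n. G t * n"] G service_c_nonneg nn_integral_G_service by simp
    then show ?thesis
      using m N G service_c_nonneg by (simp add: density_integral_add U_nonneg gap_nonneg)
  qed
  also have "\<dots> \<le> density_integral (\<lambda>t \<omega>. U t (?n t) + G t * ?N t \<omega>)"
    by (intro density_integral_mono supporting_inequality N)
  also have "\<dots> = optimal_value + density_integral (\<lambda>t \<omega>. G t * ?N t \<omega>)"
    using density_integral_deterministic[of U] m N G by (simp add: density_integral_add U_nonneg)
  also have "\<dots> \<le> optimal_value + ?k" using GN by (intro add_left_mono)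
  finally have "?k + (density_integral (\<lambda>t \<omega>. U t (?N t \<omega>)) + density_integral (\<lambda>t \<omega>. gap t (?N t \<omega>) (?n t))) \<le> ?k + optimal_value"
    by (simp only: add.commute)
  \<comment> \<open>Cancellation in \<open>ennreal\<close> is valid for finite terms only.\<close>
  moreover have "?k \<noteq> \<infinity>" by (simp add: ennreal_mult_eq_top_iff)
  ultimately show ?thesis by (simp only: ennreal_add_left_cancel_le simp_thms)
qed

text \<open>Attaining the optimal value leaves no room for a positive gap. Hence the gap vanishes
  almost everywhere, the services agree, and so do the paths.\<close>

lemma unique_if_value_attained:
  assumes C: "C \<in> consumption_plans M F"
    and budget: "(\<integral>\<^sup>+\<omega>. (\<integral>\<^sup>+t\<in>{0..}. ennreal (Z t \<omega> * exp (- r * t)) \<partial>interval_measure (\<lambda>t. C t \<omega>)) \<partial>M) \<le> ennreal w"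
    and attained: "optimal_value \<le> density_integral (\<lambda>t \<omega>. U t (service \<beta> (\<lambda>s. C s \<omega>) t))"
  shows "AE \<omega> in M. \<forall>t. C t \<omega> = c t"
proof -
  let ?N = "\<lambda>t \<omega>. service \<beta> (\<lambda>s. C s \<omega>) t" and ?n = "service \<beta> c"
  note D = deterministic_plan[OF path]
  have N: "0 \<le> ?N t \<omega>" if "\<omega> \<in> space M" for t \<omega>
    using service_nonneg[OF consumption_plan_path[OF C that]] par by simp
  let ?T = "density_integral (\<lambda>t \<omega>. gap t (?N t \<omega>) (?n t))"
  have "optimal_value + ?T \<le> optimal_value + 0"
    using order_trans[OF add_right_mono[OF attained] utility_gap[OF C budget]] by simp
  then have "?T = 0" using optimal_value_finite by (simp only: ennreal_add_left_cancel_le) auto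
  then have "AE \<omega> in M. AE t in lborel. 0 \<le> t \<longrightarrow> gap t (?N t \<omega>) (?n t) = 0"
    using measurable_gap N service_c_nonneg
    by (intro density_integral_eq_0D process_measurable_service[OF C D] gap_nonneg) auto
  then show ?thesis using AE_space
  proof eventually_elim
    case (elim \<omega>)
    have "AE t in lborel. 0 \<le> t \<longrightarrow> ?N t \<omega> = ?n t"
      using elim(1) by eventually_elim (use gap_eq_0D N[OF elim(2)] service_c_nonneg in blast)
    then show ?case
      using distribution_path_eqI_service[OF consumption_plan_path[OF C elim(2)] path] par by blast
  qed
qed

end

section \<open>Assembly over the two sets of priors\<close>

theorem proposition6p10:
  fixes M :: "'a measure" and F :: "real \<Rightarrow> 'a measure" and B :: "real \<Rightarrow> 'a \<Rightarrow> real"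
    and a a' b b' r \<delta> \<beta> \<eta> w \<alpha> :: real
  assumes "brownian_motion M F B"
    and "a' < a" and "b < b'"
    and "r > 0" and "\<delta> > 0" and "\<beta> > 0" and "\<eta> > 0" and "w > 0"
    and "0 < \<alpha>" and "\<alpha> < 1"
    and "\<exists>P. P \<in> priors M F B b b' \<inter> priors M F B a' a"
    and "\<delta> > \<alpha> * r"
  shows "\<exists>c :: real \<Rightarrow> real.
    optimal_in (budget_set M F B (priors M F B a' a) r w)
      (utility M F B (priors M F B b b') \<delta> \<alpha> \<beta> \<eta>) (\<lambda>t \<omega>. c t) \<and>
    (\<forall>C. optimal_in (budget_set M F B (priors M F B a' a) r w)
        (utility M F B (priors M F B b b') \<delta> \<alpha> \<beta> \<eta>) C \<longrightarrow>
      (AE \<omega> in M. \<forall>t. C t \<omega> = c t))"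
proof -
  interpret brownian_motion M F B by fact
  let ?P1 = "priors M F B b b'" and ?P2 = "priors M F B a' a"
  let ?U = "utility M F B ?P1 \<delta> \<alpha> \<beta> \<eta>" and ?A = "budget_set M F B ?P2 r w"
  let ?Z = "density_process M F B"
  obtain P where P: "P \<in> ?P1" "P \<in> ?P2" using assms(11) by blast
  obtain c K \<theta> q where "deterministic_optimum r \<delta> \<beta> \<eta> w \<alpha> c K \<theta> q"
  proof (rule optimal_deterministic_plan[OF assms(4,6-10,12)])
    fix c K \<theta> q
    assume "distribution_path c" "0 < K" "q = \<delta> - (1 - \<alpha>) * \<theta>" "r \<le> q"
      "(\<integral>\<^sup>+s\<in>{0..}. ennreal (exp (- r * s)) \<partial>interval_measure c) = ennreal w"
      "(\<integral>\<^sup>+s\<in>{0..}. ennreal (exp (- q * s)) \<partial>interval_measure c) = ennreal w"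
      "\<And>t. 0 \<le> t \<Longrightarrow> K * exp (- \<theta> * t) \<le> \<eta> * exp (- \<beta> * t) + service \<beta> c t"
      "\<And>t. 0 \<le> t \<Longrightarrow> service \<beta> c t = 0 \<or> \<eta> * exp (- \<beta> * t) + service \<beta> c t = K * exp (- \<theta> * t)"
    then have "deterministic_optimum r \<delta> \<beta> \<eta> w \<alpha> c K \<theta> q"
      using assms by unfold_locales
    then show thesis by (rule that)
  qed
  then interpret deterministic_optimum r \<delta> \<beta> \<eta> w \<alpha> c K \<theta> q .
  \<comment> \<open>All priors of both sets are covered, not just the common one, because the
    deterministic plan must be evaluated under each of them.\<close>
  have V: "verification M F (?Z P) r \<delta> \<beta> \<eta> w \<alpha> c K \<theta> q" if "P \<in> ?P1 \<or> P \<in> ?P2" for P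
    using that martingale_density_density_process deterministic_optimum_axioms by (auto intro: verification.intro)
  interpret VP: verification M F "?Z P" r \<delta> \<beta> \<eta> w \<alpha> c K \<theta> q by (rule V) (use P in simp)
  have U_eq: "exp (- \<delta> * t) * (1 / \<alpha>) * (satisfaction \<beta> \<eta> C t \<omega>) powr \<alpha> = U t (service \<beta> (\<lambda>s. C s \<omega>) t)" for C :: "real \<Rightarrow> 'a \<Rightarrow> real" and t \<omega>
    by (simp add: U_def Y_def satisfaction_eq_service)
  have utility_c: "?U (\<lambda>t \<omega>. c t) = VP.optimal_value"
  proof -
    have "expectation_dt M F B Q (\<lambda>t \<omega>. U t (service \<beta> c t)) = VP.optimal_value" if "Q \<in> ?P1" for Q
    proof -
      interpret VQ: verification M F "?Z Q" r \<delta> \<beta> \<eta> w \<alpha> c K \<theta> q by (rule V) (use that in simp)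
      show ?thesis
        using VQ.density_integral_deterministic[OF measurable_U U_nonneg] by (simp add: expectation_dt_def VQ.density_integral_def)
    qed
    \<comment> \<open>The common prior makes the index set nonempty; an empty infimum would be
      \<infinity>.\<close>
    then show ?thesis unfolding utility_def lower_expectation_dt_def U_eq using P(1) by (auto intro!: INF_eq_const)
  qed
  have c_in: "(\<lambda>t \<omega>. c t) \<in> ?A"
  proof -
    have "expectation_dC M F B Q (\<lambda>t \<omega>. exp (- r * t)) (\<lambda>t \<omega>. c t) = ennreal w" if "Q \<in> ?P2" for Q
    proof -
      interpret VQ: verification M F "?Z Q" r \<delta> \<beta> \<eta> w \<alpha> c K \<theta> q by (rule V) (use that in simp)
      show ?thesis using VQ.cost_deterministic by (simp add: expectation_dC_def)
    qed
    then show ?thesis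
      using VP.deterministic_plan[OF path] by (auto simp: budget_set_def upper_expectation_dC_def intro!: SUP_least)
  qed
  have bound: "C \<in> consumption_plans M F"
      "(\<integral>\<^sup>+\<omega>. (\<integral>\<^sup>+t\<in>{0..}. ennreal (?Z P t \<omega> * exp (- r * t)) \<partial>interval_measure (\<lambda>t. C t \<omega>)) \<partial>M) \<le> ennreal w"
      "?U C \<le> VP.density_integral (\<lambda>t \<omega>. U t (service \<beta> (\<lambda>s. C s \<omega>) t))"
    if "C \<in> ?A" for C
  proof -
    show "C \<in> consumption_plans M F" using that by (simp add: budget_set_def)
    \<comment> \<open>The common prior lies in \<open>?P2\<close>, so its expected cost obeys the
      budget, and in \<open>?P1\<close>, so its expected utility dominates the worst case.\<close>
    have "expectation_dC M F B P (\<lambda>t \<omega>. exp (- r * t)) C \<le> upper_expectation_dC M F B ?P2 (\<lambda>t \<omega>. exp (- r * t)) C"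
      unfolding upper_expectation_dC_def by (rule SUP_upper[OF P(2)])
    also have "\<dots> \<le> ennreal w" using that by (simp add: budget_set_def)
    finally show "(\<integral>\<^sup>+\<omega>. (\<integral>\<^sup>+t\<in>{0..}. ennreal (?Z P t \<omega> * exp (- r * t)) \<partial>interval_measure (\<lambda>t. C t \<omega>)) \<partial>M) \<le> ennreal w"
      by (simp add: expectation_dC_def)
    show "?U C \<le> VP.density_integral (\<lambda>t \<omega>. U t (service \<beta> (\<lambda>s. C s \<omega>) t))"
      unfolding utility_def lower_expectation_dt_def U_eq VP.density_integral_def expectation_dt_def[symmetric]
      by (rule INF_lower[OF P(1)])
  qed
  have opt: "?U C \<le> ?U (\<lambda>t \<omega>. c t)" if "C \<in> ?A" for C
    using order_trans[OF bound(3)[OF that] order_trans[OF _ VP.utility_gap[OF bound(1,2)[OF that]]]]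
    unfolding utility_c by (simp add: add_increasing2)
  have sup: "(SUP C\<in>?A. ?U C) = ?U (\<lambda>t \<omega>. c t)"
    using opt c_in by (intro antisym SUP_least SUP_upper) auto
  show ?thesis
  proof (intro exI[of _ c] conjI allI impI)
    show "optimal_in ?A ?U (\<lambda>t \<omega>. c t)" using c_in sup by (simp add: optimal_in_def)
    fix C assume "optimal_in ?A ?U C"
    then have C: "C \<in> ?A" "?U C = VP.optimal_value" using sup utility_c by (auto simp: optimal_in_def)
    show "AE \<omega> in M. \<forall>t. C t \<omega> = c t"
      using bound(3)[OF C(1)] C(2) by (intro VP.unique_if_value_attained bound(1,2) C(1)) simp
  qed
qed

end
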